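(* Let $\{\omega(n)\}_{n\geq 0}$ be the moment sequence of a weight $W$ satisfying $(C_1)$, $(C_2)$ and $(C_3)$. Let $\Omega(n) = 1/\omega(n)$, $n \geq 0$, be the associated dual weight. Then the following statements on a compact subset $E\subseteq \mathbb{T}$ of positive Lebesgue measure are all equivalent: (i) $E$ supports no non-trivial $f \in \ell^2(\Omega)$. (ii) For any arc $I\subset \mathbb{T}$: $\operatorname{Cap}_\omega(I \setminus E) = \operatorname{Cap}_\omega(I)$. (iii) $\operatorname{Cap}_\omega(\mathbb{T}\setminus E)= \operatorname{Cap}_\omega(\mathbb{T})$.
   Context: $\mathbb{T}$ is the unit circle. A weight is a non-negative continuously differentiable function $W$ on $(0,1]$ which is integrable on $[0,1]$ with respect to Lebesgue measure. Its associated moment sequence is $\omega(n)=\int_0^1 r^n W(1-r)\,dr$, $n=0,1,2,\dots$. The conditions on $W$ are: $(C_1)$ $W$ is either monotone non-decreasing or monotone non-increasing; $(C_2)$ $\int_0^1 \frac{W(t)}{t}\,dt=+\infty$; $(C_3)$ there is a constant $0<c<2$, depending only on $W$, such that $W(t)\leq c\,W(t/2)$ for all $0<t<1$. For a positive finite Borel measure $\mu$ on $\mathbb{T}$, its $\omega$-energy is $\mathcal{E}_\omega(\mu)=\sum_{n\in\mathbb{Z}}\omega(|n|)|\widehat\mu(n)|^2\in(0,\infty]$, where $\widehat\mu(n)=\int_{\mathbb{T}}\zeta^{-n}d\mu(\zeta)$. For compact $K\subset\mathbb{T}$, $\operatorname{Cap}_\omega(K)=\sup_\mu 1/\mathcal{E}_\omega(\mu)$,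 the supremum over probability measures $\mu$ supported on $K$ (with $1/\infty=0$, and value $0$ for $K=\emptyset$). For other sets $A\subset\mathbb{T}$ (in particular open ones), $\operatorname{Cap}_\omega(A)=\sup\{\operatorname{Cap}_\omega(K):K\subseteq A,\ K\text{ compact}\}$. $\ell^2(\Omega)$ is the Hilbert space of $f\in L^2(\mathbb{T})$ with $\|f\|_{\ell^2(\Omega)}^2=\sum_{n\in\mathbb{Z}}|\widehat f(n)|^2\Omega(|n|)<\infty$. $E$ supports $f$ if $f=0$ almost everywhere on $\mathbb{T}\setminus E$. *)

theory Defs
  imports "HOL-Probability.Probability"
begin

abbreviation unit_circle :: "complex set" where
  "unit_circle \<equiv> sphere 0 1"

definition circle_borel :: "complex measure" where
  "circle_borel = restrict_space borel unit_circle"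

text \<open>Lebesgue measure on the circle, normalised to have total mass 1.\<close>

definition circle_measure :: "complex measure" where
  "circle_measure = distr (uniform_measure lborel {0..<2 * pi}) circle_borel cis"

lemma prob_space_circle_measure: "prob_space circle_measure"
proof -
  have "prob_space (uniform_measure lborel {0..<2 * pi})"
    by (rule prob_space_uniform_measure) auto
  moreover have "cis \<in> measurable (uniform_measure lborel {0..<2 * pi}) circle_borel"
    unfolding circle_borel_def
    by (intro measurable_restrict_space2 borel_measurable_continuous_onI)
       (auto simp: measurable_cong_sets[OF sets_uniform_measure refl] sets_lborel
             intro!: borel_measurable_continuous_onI continuous_intros)
  ultimately show ?thesis
    unfolding circle_measure_def by (rule prob_space.prob_space_distr)
qed

text \<open>Arcs are nondegenerate; they may be open, closed or half-open, and the full circle is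
  one of them.\<close>

definition is_arc :: "complex set \<Rightarrow> bool" where
  "is_arc I \<longleftrightarrow> (\<exists>S. is_interval S \<and> interior S \<noteq> {} \<and> I = cis ` S)"


text \<open>A function on $(0,1]$ is represented by a function on the reals; all conditions below,
  and the moments, only depend on its values on $(0,1]$.\<close>

definition is_weight :: "(real \<Rightarrow> real) \<Rightarrow> bool" where
  "is_weight W \<longleftrightarrow>
     (\<forall>t\<in>{0<..1}. 0 \<le> W t) \<and>
     (\<exists>W'. continuous_on {0<..1} W' \<and>
        (\<forall>t\<in>{0<..1}. (W has_real_derivative W' t) (at t within {0<..1}))) \<and>
     set_integrable lborel {0<..1} W"

definition cond_C1 :: "(real \<Rightarrow> real) \<Rightarrow> bool" where
  "cond_C1 W \<longleftrightarrow> mono_on {0<..1} W \<or> antimono_on {0<..1} W"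

definition cond_C2 :: "(real \<Rightarrow> real) \<Rightarrow> bool" where
  "cond_C2 W \<longleftrightarrow> (\<integral>\<^sup>+t\<in>{0<..1}. ennreal (W t / t) \<partial>lborel) = \<infinity>"

definition cond_C3 :: "(real \<Rightarrow> real) \<Rightarrow> bool" where
  "cond_C3 W \<longleftrightarrow> (\<exists>c. 0 < c \<and> c < 2 \<and> (\<forall>t\<in>{0<..<1}. W t \<le> c * W (t / 2)))"

definition moment :: "(real \<Rightarrow> real) \<Rightarrow> nat \<Rightarrow> real" where
  "moment W n = (LBINT r:{0..<1}. r ^ n * W (1 - r))"


definition measure_fourier :: "complex measure \<Rightarrow> int \<Rightarrow> complex" where
  "measure_fourier M n = (LINT z|M. z powi (- n))"

definition energy :: "(nat \<Rightarrow> real) \<Rightarrow> complex measure \<Rightarrow> ennreal" where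
  "energy \<omega> M = (\<Sum>\<^sub>\<infinity>n::int. ennreal (\<omega> (nat \<bar>n\<bar>) * (cmod (measure_fourier M n))\<^sup>2))"

definition probs_on :: "complex set \<Rightarrow> complex measure set" where
  "probs_on K = {M. prob_space M \<and> sets M = sets circle_borel \<and> emeasure M (unit_circle - K) = 0}"

text \<open>In \<open>ennreal\<close>, \<open>1 / \<infinity> = 0\<close> and the supremum of the empty set is \<open>0\<close>, so the
  capacity of the empty set is \<open>0\<close>.\<close>

definition Cap_compact :: "(nat \<Rightarrow> real) \<Rightarrow> complex set \<Rightarrow> ennreal" where
  "Cap_compact \<omega> K = (SUP M\<in>probs_on K. 1 / energy \<omega> M)"

definition Cap :: "(nat \<Rightarrow> real) \<Rightarrow> complex set \<Rightarrow> ennreal" where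
  "Cap \<omega> A = (SUP K\<in>{K. compact K \<and> K \<subseteq> A}. Cap_compact \<omega> K)"

lemma Cap_compact_mono:
  assumes "compact K" "K \<subseteq> L"
  shows "Cap_compact \<omega> K \<le> Cap_compact \<omega> L"
proof -
  have "probs_on K \<subseteq> probs_on L"
  proof
    fix M assume M: "M \<in> probs_on K"
    have "unit_circle - K \<in> sets M"
      using M assms(1)
      by (auto simp: probs_on_def circle_borel_def sets_restrict_space_iff compact_imp_closed)
    then have "emeasure M (unit_circle - L) \<le> emeasure M (unit_circle - K)"
      using assms(2) by (intro emeasure_mono) auto
    then show "M \<in> probs_on L"
      using M by (auto simp: probs_on_def)
  qed
  then show ?thesis
    unfolding Cap_compact_def by (rule SUP_subset_mono) simp
qed

lemma Cap_eq_Cap_compact: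
  assumes "compact K"
  shows "Cap \<omega> K = Cap_compact \<omega> K"
  unfolding Cap_def
  using assms by (intro antisym SUP_least SUP_upper) (auto intro: Cap_compact_mono)


text \<open>Elements of $L^2$ and of $\ell^2(\Omega)$ are represented by Borel functions, whose values
  off the circle are irrelevant; two of them represent the same element iff they agree almost
  everywhere.\<close>

definition in_L2 :: "(complex \<Rightarrow> complex) \<Rightarrow> bool" where
  "in_L2 f \<longleftrightarrow> f \<in> borel_measurable circle_measure \<and>
     integrable circle_measure (\<lambda>z. (cmod (f z))\<^sup>2)"

definition fun_fourier :: "(complex \<Rightarrow> complex) \<Rightarrow> int \<Rightarrow> complex" where
  "fun_fourier f n = (LINT z|circle_measure. z powi (- n) * f z)"

definition in_ell2 :: "(nat \<Rightarrow> real) \<Rightarrow> (complex \<Rightarrow> complex) \<Rightarrow> bool" where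
  "in_ell2 \<Omega> f \<longleftrightarrow> in_L2 f \<and>
     (\<lambda>n::int. (cmod (fun_fourier f n))\<^sup>2 * \<Omega> (nat \<bar>n\<bar>)) summable_on UNIV"

definition supports :: "complex set \<Rightarrow> (complex \<Rightarrow> complex) \<Rightarrow> bool" where
  "supports E f \<longleftrightarrow> (AE z in circle_measure. z \<notin> E \<longrightarrow> f z = 0)"

end

theory Submission imports Defs
begin

text \<open>
  Testing an \<open>f\<close> in the dual space supported on \<open>E\<close> against mollified probability measures on
  \<open>unit_circle - E\<close> whose energies tend to the minimum \<open>\<omega> 0\<close>, attained by Lebesgue measure, shows
  that all Fourier coefficients of \<open>f\<close> vanish; hence (iii) implies (i).

  For the converse, the growth condition \<open>\<Omega> (2 n) \<le> q \<Omega> n\<close> with \<open>q < 4\<close>, which comes from (C1) and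
  (C3), makes the norm of the dual space equivalent to a Dirichlet form, on which contractions operate.
  If the positive densities on \<open>U - E\<close> were not dense in those on the open set \<open>U\<close>, then a separating
  \<open>f\<close> in the dual space would be nonpositive on \<open>U - E\<close> but not on \<open>U\<close>, and its positive part, cut
  off to \<open>U\<close>, would be a nontrivial element of the dual space supported on \<open>E\<close>. The end points of an
  arc are negligible because by (C2) measures with atoms have infinite energy.
\<close>

text \<open>Capacities see positive measures only, so the densities at hand form a cone and not a
  subspace: separation yields a sign condition on f instead of orthogonality, and positive parts
  must be shown to stay in the dual space. The coefficient norm says nothing about positive parts; a
  form built from the pointwise increments |f(e^{it} z) - f(z)|^2 does. Its kernel has to integrate
  t^2, and this is where q < 4 enters, through a series of ratio q / 4. The bound on q comes from c
  < 2 in (C3): the substitution in the moment integral costs the Jacobian 2 r, so that q = 2 max (1,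
  c).

  The other obstacle is to keep the approximating measures positive and compactly supported without
  raising their energy. Mollifying with a small bump can only decrease the moduli of the Fourier
  coefficients. Restricting a measure may increase some of them, but not the energy: the energy is a
  mixture over r of squared L2-norms of Poisson integrals, which are monotone in the
  measure.\<close>

abbreviation (input) \<mu> :: "complex measure" where "\<mu> \<equiv> circle_measure"

abbreviation (input) nsq :: "complex \<Rightarrow> ennreal" where "nsq x \<equiv> ennreal ((cmod x)\<^sup>2)"

subsection \<open>Square-integrable functions\<close>

text \<open>Stated over an arbitrary measure because it serves twice: on the circle with
  \<open>circle_measure\<close>, and on the integers with counting measure, where it gives the
  square-summable coefficient sequences.\<close>

definition L2 :: "'a measure \<Rightarrow> ('a \<Rightarrow> complex) \<Rightarrow> bool" where
  "L2 M f \<longleftrightarrow> f \<in> borel_measurable M \<and> integrable M (\<lambda>x. (cmod (f x))\<^sup>2)"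

text \<open>The real part of the Hermitian product. Separation of cones is a real notion, and
  imaginary parts are recovered later by multiplying a function by \<i>.\<close>

definition dotp :: "'a measure \<Rightarrow> ('a \<Rightarrow> complex) \<Rightarrow> ('a \<Rightarrow> complex) \<Rightarrow> real" where
  "dotp M f g = (LINT x|M. f x \<bullet> g x)"

abbreviation (input) sqnorm :: "'a measure \<Rightarrow> ('a \<Rightarrow> complex) \<Rightarrow> real" where
  "sqnorm M f \<equiv> dotp M f f"

lemma L2_measurable [measurable_dest]: "L2 M f \<Longrightarrow> f \<in> borel_measurable M"
  by (simp add: L2_def)

lemma L2_bound:
  assumes "L2 M f" "g \<in> borel_measurable M" "AE x in M. cmod (g x) \<le> C * cmod (f x)"
  shows "L2 M g"
proof -
  have "integrable M (\<lambda>x. C\<^sup>2 * (cmod (f x))\<^sup>2)"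
    using assms by (auto simp: L2_def)
  then have "integrable M (\<lambda>x. (cmod (g x))\<^sup>2)"
  proof (rule Bochner_Integration.integrable_bound)
    show "AE x in M. norm ((cmod (g x))\<^sup>2) \<le> norm (C\<^sup>2 * (cmod (f x))\<^sup>2)"
      using assms(3)
    proof eventually_elim
      case (elim x)
      then have "(cmod (g x))\<^sup>2 \<le> (C * cmod (f x))\<^sup>2" by (intro power_mono) auto
      then show ?case by (simp add: power_mult_distrib)
    qed
  qed (use assms in measurable)
  then show ?thesis using assms by (simp add: L2_def)
qed

lemma L2_scale: "L2 M f \<Longrightarrow> L2 M (\<lambda>x. c * f x)"
  by (rule L2_bound[where C="cmod c"]) (auto simp: norm_mult L2_def)

lemma L2_zero [simp]: "L2 M (\<lambda>x. 0)"
  by (simp add: L2_def)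

lemma square_add_le: "(cmod (a + b))\<^sup>2 \<le> 2 * (cmod a)\<^sup>2 + 2 * (cmod b)\<^sup>2"
proof -
  have "(cmod (a + b))\<^sup>2 \<le> (cmod a + cmod b)\<^sup>2"
    by (intro power_mono norm_triangle_ineq) auto
  then show ?thesis
    using sum_squares_bound[of "cmod a" "cmod b"] by (simp add: power2_sum)
qed

lemma L2_add:
  assumes "L2 M f" "L2 M g"
  shows "L2 M (\<lambda>x. f x + g x)"
proof -
  have "integrable M (\<lambda>x. 2 * (cmod (f x))\<^sup>2 + 2 * (cmod (g x))\<^sup>2)"
    using assms by (auto simp: L2_def)
  then have "integrable M (\<lambda>x. (cmod (f x + g x))\<^sup>2)"
    by (rule Bochner_Integration.integrable_bound)
       (use assms square_add_le in \<open>auto simp: L2_def\<close>)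
  then show ?thesis using assms unfolding L2_def by (auto intro: borel_measurable_add)
qed

lemma L2_diff: "L2 M f \<Longrightarrow> L2 M g \<Longrightarrow> L2 M (\<lambda>x. f x - g x)"
  using L2_add[of M f "\<lambda>x. (-1) * g x"] L2_scale[of M g "-1"] by simp

lemma L2_sum: "(\<And>i. i \<in> I \<Longrightarrow> L2 M (f i)) \<Longrightarrow> L2 M (\<lambda>x. \<Sum>i\<in>I. f i x)"
  by (induction I rule: infinite_finite_induct) (auto intro: L2_add)

lemma L2_integrable_dotp:
  assumes "L2 M f" "L2 M g"
  shows "integrable M (\<lambda>x. f x \<bullet> g x)"
proof -
  have "integrable M (\<lambda>x. (cmod (f x))\<^sup>2 + (cmod (g x))\<^sup>2)"
    using assms by (auto simp: L2_def)
  then show ?thesis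
  proof (rule Bochner_Integration.integrable_bound)
    show "AE x in M. norm (f x \<bullet> g x) \<le> norm ((cmod (f x))\<^sup>2 + (cmod (g x))\<^sup>2)"
    proof (intro AE_I2)
      fix x
      have "\<bar>f x \<bullet> g x\<bar> \<le> cmod (f x) * cmod (g x)" by (rule Cauchy_Schwarz_ineq2)
      moreover have "2 * (cmod (f x) * cmod (g x)) \<le> (cmod (f x))\<^sup>2 + (cmod (g x))\<^sup>2"
        using sum_squares_bound[of "cmod (f x)" "cmod (g x)"] by simp
      moreover have "0 \<le> cmod (f x) * cmod (g x)" by simp
      ultimately show "norm (f x \<bullet> g x) \<le> norm ((cmod (f x))\<^sup>2 + (cmod (g x))\<^sup>2)"
        unfolding real_norm_def by linarith
    qed
  qed (use assms in \<open>auto simp: L2_def\<close>)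
qed

lemma dotp_commute: "dotp M f g = dotp M g f"
  by (simp add: dotp_def inner_commute)

lemma dotp_self: "dotp M f f = (LINT x|M. (cmod (f x))\<^sup>2)"
  by (simp add: dotp_def dot_square_norm)

lemma dotp_self_nonneg: "0 \<le> dotp M f f"
  by (simp add: dotp_self)

lemma dotp_add_left:
  "L2 M f \<Longrightarrow> L2 M g \<Longrightarrow> L2 M h \<Longrightarrow> dotp M (\<lambda>x. f x + g x) h = dotp M f h + dotp M g h"
  by (simp add: dotp_def inner_add_left L2_integrable_dotp)

lemma dotp_diff_left:
  "L2 M f \<Longrightarrow> L2 M g \<Longrightarrow> L2 M h \<Longrightarrow> dotp M (\<lambda>x. f x - g x) h = dotp M f h - dotp M g h"
  by (simp add: dotp_def inner_diff_left L2_integrable_dotp)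

lemma dotp_scale_left: "dotp M (\<lambda>x. complex_of_real c * f x) g = c * dotp M f g"
  by (simp add: dotp_def inner_mult_left flip: scaleR_conv_of_real)

lemma dotp_add_scale_self:
  assumes "L2 M f" "L2 M g"
  shows "sqnorm M (\<lambda>x. f x + of_real c * g x)
           = dotp M f f + 2 * c * dotp M f g + c\<^sup>2 * dotp M g g"
proof -
  have "(f x + of_real c * g x) \<bullet> (f x + of_real c * g x) = f x \<bullet> f x + 2 * c * (f x \<bullet> g x) + c\<^sup>2 * (g x \<bullet> g x)" for x
    by (simp add: inner_add inner_commute power2_eq_square algebra_simps flip: scaleR_conv_of_real)
  then show ?thesis
    using assms by (simp add: dotp_def L2_integrable_dotp)
qed

lemma dotp_Cauchy_Schwarz:
  assumes "L2 M f" "L2 M g"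
  shows "(dotp M f g)\<^sup>2 \<le> dotp M f f * dotp M g g"
proof -
  have *: "0 \<le> dotp M f f + 2 * c * dotp M f g + c\<^sup>2 * dotp M g g" for c
    using dotp_self_nonneg[of M "\<lambda>x. f x + of_real c * g x"] dotp_add_scale_self[OF assms] by simp
  show ?thesis
  proof (cases "dotp M g g = 0")
    case True
    have "dotp M f g = 0"
    proof (rule ccontr)
      assume "dotp M f g \<noteq> 0"
      \<comment> \<open>With g of norm zero the quadratic is affine in c; this c makes its value
        -1.\<close>
      then show False using *[of "- (dotp M f f + 1) / (2 * dotp M f g)"] True by (simp add: field_simps)
    qed
    then show ?thesis using True by simp
  next
    case False
    then have "dotp M g g > 0" using dotp_self_nonneg[of M g] by simp
    then show ?thesis
      using *[of "- dotp M f g / dotp M g g"]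
      by (simp add: field_simps power2_eq_square)
  qed
qed

lemma dotp_tendsto:
  assumes "\<And>n. L2 M (f n)" "L2 M f'" "L2 M g"
    and "(\<lambda>n. sqnorm M (\<lambda>x. f n x - f' x)) \<longlonglongrightarrow> 0"
  shows "(\<lambda>n. dotp M (f n) g) \<longlonglongrightarrow> dotp M f' g"
proof -
  have "(\<lambda>n. (dotp M (\<lambda>x. f n x - f' x) g)\<^sup>2) \<longlonglongrightarrow> 0"
  proof (rule tendsto_sandwich[OF _ _ tendsto_const])
    show "(\<lambda>n. sqnorm M (\<lambda>x. f n x - f' x) * dotp M g g) \<longlonglongrightarrow> 0"
      using tendsto_mult_right[OF assms(4), of "dotp M g g"] by simp
  qed (use assms in \<open>auto intro!: always_eventually dotp_Cauchy_Schwarz L2_diff\<close>)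
  then have "(\<lambda>n. dotp M (\<lambda>x. f n x - f' x) g) \<longlonglongrightarrow> 0"
    by simp
  then have "(\<lambda>n. dotp M (f n) g - dotp M f' g) \<longlonglongrightarrow> 0"
    using assms by (simp add: dotp_diff_left)
  then show ?thesis by (simp add: LIM_zero_cancel)
qed

lemma dotp_self_tendsto:
  assumes "\<And>n. L2 M (f n)" "L2 M f'"
    and "(\<lambda>n. sqnorm M (\<lambda>x. f n x - f' x)) \<longlonglongrightarrow> 0"
  shows "(\<lambda>n. sqnorm M (f n)) \<longlonglongrightarrow> dotp M f' f'"
proof -
  have "sqnorm M (f n) = sqnorm M (\<lambda>x. f n x - f' x) + 2 * dotp M (f n) f' - dotp M f' f'" for n
    using dotp_add_scale_self[OF assms(1) assms(2), of n "-1"] by simp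
  moreover have "(\<lambda>n. sqnorm M (\<lambda>x. f n x - f' x) + 2 * dotp M (f n) f' - dotp M f' f')
      \<longlonglongrightarrow> 0 + 2 * dotp M f' f' - dotp M f' f'"
    by (intro tendsto_intros assms dotp_tendsto)
  ultimately show ?thesis by simp
qed

lemma nn_integral_square_eq_dotp:
  assumes "L2 M f"
  shows "(\<integral>\<^sup>+x. nsq (f x) \<partial>M) = ennreal (dotp M f f)"
  using assms by (simp add: L2_def dotp_self nn_integral_eq_integral)

lemma L2_iff_nn_integral:
  assumes "f \<in> borel_measurable M"
  shows "L2 M f \<longleftrightarrow> (\<integral>\<^sup>+x. nsq (f x) \<partial>M) < \<infinity>"
  using assms by (simp add: L2_def integrable_iff_bounded)

text \<open>The rate 1/8 leaves room in \<open>L2_complete\<close>: weighted by 2^k, the squared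
  increments are still bounded by a geometric series of ratio 1/4.\<close>

lemma fast_Cauchy_subsequence:
  fixes d :: "nat \<Rightarrow> nat \<Rightarrow> real"
  assumes "\<And>e. e > 0 \<Longrightarrow> \<exists>N. \<forall>m\<ge>N. \<forall>n\<ge>N. d m n < e"
  obtains r :: "nat \<Rightarrow> nat" where "\<And>k. k \<le> r k" "\<And>k. r k \<le> r (Suc k)" "\<And>k m n. m \<ge> r k \<Longrightarrow> n \<ge> r k \<Longrightarrow> d m n < (1/8)^k"
proof -
  have "\<exists>N. \<forall>m\<ge>N. \<forall>n\<ge>N. d m n < (1/8)^k" for k by (rule assms) simp
  then obtain s where s: "\<And>k m n. m \<ge> s k \<Longrightarrow> n \<ge> s k \<Longrightarrow> d m n < (1/8)^k" by metis
  define r where "r k = k + Max (s ` {..k})" for k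
  have "s k \<le> r k" for k unfolding r_def by (intro trans_le_add2 Max_ge) auto
  moreover have "r k \<le> r (Suc k)" for k unfolding r_def by (intro add_mono Max_mono) auto
  moreover have "k \<le> r k" for k by (simp add: r_def)
  ultimately show ?thesis using that[of r] s by (meson le_trans)
qed

text \<open>The weights 2^k turn summability of the squared increments along a fast subsequence into
  absolute convergence at almost every point. Fatou's lemma then gives convergence of the whole
  sequence in norm, and no triangle inequality for the norm is involved.\<close>

lemma L2_complete:
  assumes L2: "\<And>n. L2 M (f n)"
    and Cauchy: "\<And>e. e > 0 \<Longrightarrow> \<exists>N. \<forall>m\<ge>N. \<forall>n\<ge>N. sqnorm M (\<lambda>x. f m x - f n x) < e"
  obtains g where "L2 M g" "(\<lambda>n. sqnorm M (\<lambda>x. f n x - g x)) \<longlonglongrightarrow> 0"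
proof -
  define D where "D m n = sqnorm M (\<lambda>x. f m x - f n x)" for m n
  have [measurable]: "f n \<in> borel_measurable M" for n using L2 by (rule L2_measurable)
  obtain r where r_ge: "\<And>k. k \<le> r k" and r: "\<And>k. r k \<le> r (Suc k)" "\<And>k m n. m \<ge> r k \<Longrightarrow> n \<ge> r k \<Longrightarrow> D m n < (1/8)^k"
    using fast_Cauchy_subsequence[of D] Cauchy unfolding D_def by blast
  have nnD: "(\<integral>\<^sup>+x. nsq (f m x - f n x) \<partial>M) = ennreal (D m n)" for m n
    unfolding D_def by (intro nn_integral_square_eq_dotp L2_diff L2)
  define d where "d k x = f (r (Suc k)) x - f (r k) x" for k x
  have "(\<integral>\<^sup>+x. (\<Sum>k. ennreal (2^k * (cmod (d k x))\<^sup>2)) \<partial>M) = (\<Sum>k. \<integral>\<^sup>+x. ennreal (2^k * (cmod (d k x))\<^sup>2) \<partial>M)"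
    unfolding d_def by (intro nn_integral_suminf) measurable
  also have "\<dots> \<le> (\<Sum>k. ennreal ((1/4)^k))"
  proof (intro suminf_le)
    fix k
    have "(\<integral>\<^sup>+x. ennreal (2^k * (cmod (d k x))\<^sup>2) \<partial>M) = 2^k * ennreal (D (r (Suc k)) (r k))"
      by (simp add: ennreal_mult d_def nn_integral_cmult nnD del: ennreal_power flip: ennreal_power[of 2 k])
    also have "\<dots> \<le> ennreal (2^k) * ennreal ((1/8)^k)"
      using r(2)[of k "r (Suc k)" "r k"] r(1) by (intro mult_mono ennreal_leI) (auto simp: less_imp_le ennreal_power[symmetric])
    also have "\<dots> = ennreal ((1/4)^k)"
      by (simp add: power_mult_distrib[symmetric] flip: ennreal_mult)
    finally show "(\<integral>\<^sup>+x. ennreal (2^k * (cmod (d k x))\<^sup>2) \<partial>M) \<le> ennreal ((1/4)^k)" .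
  qed auto
  also have "\<dots> = ennreal (\<Sum>k. (1/4)^k)" by (intro suminf_ennreal2) auto
  finally have "(\<integral>\<^sup>+x. (\<Sum>k. ennreal (2^k * (cmod (d k x))\<^sup>2)) \<partial>M) \<noteq> \<infinity>"
    by (auto simp: top_unique)
  then have "AE x in M. (\<Sum>k. ennreal (2^k * (cmod (d k x))\<^sup>2)) \<noteq> \<infinity>"
    unfolding d_def by (intro nn_integral_PInf_AE) measurable
  then have conv: "AE x in M. convergent (\<lambda>k. f (r k) x)"
  proof eventually_elim
    case (elim x)
    then have s: "summable (\<lambda>k. 2^k * (cmod (d k x))\<^sup>2)"
      by (intro summable_suminf_not_top) auto
    have "summable (\<lambda>k. cmod (d k x))"
    proof (rule summable_comparison_test')
      show "summable (\<lambda>k. (1/2)^k + 2^k * (cmod (d k x))\<^sup>2)"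
        by (intro summable_add s summable_geometric) simp
      fix k
      \<comment> \<open>AM-GM for (1/2)^k and 2^k |d|^2, whose product is |d|^2.\<close>
      have "2 * (cmod (d k x)) \<le> (1/2)^k + 2^k * (cmod (d k x))\<^sup>2"
      proof -
        have "0 \<le> (1/2)^k * (1 - 2^k * cmod (d k x))\<^sup>2" by simp
        also have "\<dots> = (1/2)^k - 2 * cmod (d k x) + 2^k * (cmod (d k x))\<^sup>2"
          by (simp add: power2_eq_square algebra_simps power_divide)
        finally show ?thesis by simp
      qed
      then show "norm (cmod (d k x)) \<le> (1/2)^k + 2^k * (cmod (d k x))\<^sup>2"
        using norm_ge_zero[of "d k x"] unfolding real_norm_def by linarith
    qed
    then have "summable (\<lambda>k. d k x)" by (rule summable_norm_cancel)
    then have "convergent (\<lambda>n. \<Sum>k<n. d k x)" by (simp add: summable_iff_convergent)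
    moreover have "(\<Sum>k<n. d k x) = f (r n) x - f (r 0) x" for n
      unfolding d_def by (rule sum_lessThan_telescope)
    ultimately have "convergent (\<lambda>n. f (r n) x - f (r 0) x)" by simp
    then have "convergent (\<lambda>n. f (r 0) x + (f (r n) x - f (r 0) x))"
      by (intro convergent_add convergent_const)
    then show ?case by simp
  qed
  define g where "g x = lim (\<lambda>k. f (r k) x)" for x
  have [measurable]: "g \<in> borel_measurable M" unfolding g_def by measurable
  have lim: "AE x in M. (\<lambda>k. f (r k) x) \<longlonglongrightarrow> g x"
    using conv by (auto simp: g_def convergent_LIMSEQ_iff)
  \<comment> \<open>Fatou along the subsequence; the shift by N keeps its indices
    \<open>r (k + N)\<close> at least N.\<close>
  have bound: "(\<integral>\<^sup>+x. nsq (f n x - g x) \<partial>M) \<le> ennreal e"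
    if "\<And>m. m \<ge> N \<Longrightarrow> D n m \<le> e" for n N e
  proof -
    have "(\<integral>\<^sup>+x. nsq (f n x - g x) \<partial>M)
        = (\<integral>\<^sup>+x. liminf (\<lambda>k. nsq (f n x - f (r (k + N)) x)) \<partial>M)"
    proof (intro nn_integral_cong_AE)
      show "AE x in M. nsq (f n x - g x) = liminf (\<lambda>k. nsq (f n x - f (r (k + N)) x))"
        using lim
      proof eventually_elim
        case (elim x)
        then have "(\<lambda>k. f (r (k + N)) x) \<longlonglongrightarrow> g x" by (rule LIMSEQ_ignore_initial_segment)
        then have "(\<lambda>k. nsq (f n x - f (r (k + N)) x)) \<longlonglongrightarrow> nsq (f n x - g x)"
          by (intro tendsto_intros tendsto_ennrealI)
        then show ?case by (rule lim_imp_Liminf[OF sequentially_bot, symmetric])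
      qed
    qed
    also have "\<dots> \<le> liminf (\<lambda>k. \<integral>\<^sup>+x. nsq (f n x - f (r (k + N)) x) \<partial>M)"
      by (intro nn_integral_liminf) measurable
    also have "\<dots> = liminf (\<lambda>k. ennreal (D n (r (k + N))))" by (simp add: nnD)
    also have "\<dots> \<le> liminf (\<lambda>k. ennreal e)"
      using r_ge by (intro Liminf_mono always_eventually allI ennreal_leI that) (meson add_leE le_trans)
    also have "\<dots> = ennreal e" by (simp add: Liminf_const)
    finally show ?thesis .
  qed
  obtain N1 where N1: "\<And>m n. m \<ge> N1 \<Longrightarrow> n \<ge> N1 \<Longrightarrow> D m n < 1"
    using Cauchy[of 1] unfolding D_def by auto
  have "L2 M (\<lambda>x. f N1 x - g x)"
    using bound[of N1 N1 1] N1 by (subst L2_iff_nn_integral) (auto simp: less_imp_le intro: le_less_trans)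
  from L2_diff[OF L2[of N1] this] have g: "L2 M g" by simp
  have "(\<lambda>n. sqnorm M (\<lambda>x. f n x - g x)) \<longlonglongrightarrow> 0"
  proof (rule LIMSEQ_I)
    fix e :: real assume "e > 0"
    then obtain N where N: "\<And>m n. m \<ge> N \<Longrightarrow> n \<ge> N \<Longrightarrow> D m n < e / 2"
      using Cauchy[of "e / 2"] unfolding D_def by auto
    have "sqnorm M (\<lambda>x. f n x - g x) \<le> e / 2" if "n \<ge> N" for n
      using bound[of N n "e / 2"] N[OF that] \<open>e > 0\<close>
      by (simp add: less_imp_le nn_integral_square_eq_dotp L2_diff L2 g)
    then show "\<exists>N. \<forall>n\<ge>N. norm (sqnorm M (\<lambda>x. f n x - g x) - 0) < e"
      using \<open>e > 0\<close> by (intro exI[of _ N]) (fastforce simp: dotp_self_nonneg)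
  qed
  with g show ?thesis by (rule that)
qed


section \<open>Separation of a point from a convex cone\<close>

lemma le_zero_if_le_small_multiples:
  fixes a b :: real
  assumes "\<And>e. 0 < e \<Longrightarrow> e \<le> 1 \<Longrightarrow> a \<le> e * b"
  shows "a \<le> 0"
proof (rule ccontr)
  assume "\<not> a \<le> 0"
  \<comment> \<open>Chosen so that e (|b| + 1) is at most a / 2; then a \<le> e b would give a \<le>
    a / 2.\<close>
  define e where "e = min 1 (a / (2 * (\<bar>b\<bar> + 1)))"
  have e: "0 < e" "e \<le> 1" using \<open>\<not> a \<le> 0\<close> by (auto simp: e_def)
  have "a \<le> e * b" by (rule assms[OF e])
  also have "\<dots> \<le> e * (\<bar>b\<bar> + 1)" using e by (intro mult_left_mono) auto
  also have "\<dots> \<le> a / (2 * (\<bar>b\<bar> + 1)) * (\<bar>b\<bar> + 1)"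
    by (intro mult_right_mono) (auto simp: e_def)
  also have "\<dots> = a / 2" by (simp add: field_simps)
  finally show False using \<open>\<not> a \<le> 0\<close> by simp
qed

text \<open>The separating vector is the difference between \<open>x\<close> and its projection onto the closure of
  the cone.\<close>

lemma L2_cone_separation:
  assumes x: "L2 M x" and C: "\<And>a. a \<in> C \<Longrightarrow> L2 M a" and ne: "C \<noteq> {}"
    and add: "\<And>a b. a \<in> C \<Longrightarrow> b \<in> C \<Longrightarrow> (\<lambda>z. a z + b z) \<in> C"
    and scale: "\<And>r a. 0 \<le> r \<Longrightarrow> a \<in> C \<Longrightarrow> (\<lambda>z. complex_of_real r * a z) \<in> C"
    and d: "d > 0" "\<And>a. a \<in> C \<Longrightarrow> d \<le> sqnorm M (\<lambda>z. x z - a z)"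
  obtains v where "L2 M v" "\<And>a. a \<in> C \<Longrightarrow> dotp M v a \<le> 0" "dotp M v x > 0"
proof -
  define Q where "Q f = dotp M f f" for f
  define D where "D = (\<lambda>a. Q (\<lambda>z. x z - a z)) ` C"
  define \<delta> where "\<delta> = Inf D"
  have bdd: "bdd_below D" using d by (auto simp: D_def Q_def bdd_below_def)
  have "d \<le> \<delta>" unfolding \<delta>_def using d(2) ne by (intro cInf_greatest) (auto simp: D_def Q_def)
  have Q_ge: "\<delta> \<le> Q (\<lambda>z. x z - a z)" if "a \<in> C" for a
    unfolding \<delta>_def using that bdd by (intro cInf_lower) (auto simp: D_def)
  have "\<exists>a\<in>C. Q (\<lambda>z. x z - a z) < \<delta> + inverse (Suc n)" for n
  proof -
    have "\<exists>y\<in>D. y < \<delta> + inverse (Suc n)"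
      unfolding \<delta>_def using ne bdd by (subst cInf_less_iff[symmetric]) (auto simp: D_def)
    then show ?thesis by (auto simp: D_def)
  qed
  then obtain c where c: "\<And>n. c n \<in> C" and c_le: "\<And>n. Q (\<lambda>z. x z - c n z) < \<delta> + inverse (Suc n)"
    by metis
  \<comment> \<open>The cone need not be closed, so the nearest point may lie outside it: all
    inequalities are proved for the minimising sequence \<open>c n\<close> and passed to the limit
    of the residuals \<open>h n\<close>.\<close>
  define h where "h n = (\<lambda>z. x z - c n z)" for n
  have h: "L2 M (h n)" for n unfolding h_def by (intro L2_diff x C c)
  have h_le: "Q (h n) < \<delta> + inverse (Suc n)" and h_ge: "\<delta> \<le> Q (h n)" for n
    using c_le Q_ge c by (auto simp: h_def)
  have expand: "Q (\<lambda>z. f z + of_real r * g z) = Q f + 2 * r * dotp M f g + r\<^sup>2 * Q g"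
    if "L2 M f" "L2 M g" for f g r
    unfolding Q_def by (rule dotp_add_scale_self[OF that])
  \<comment> \<open>The midpoint of two near-minimisers lies in the cone, so the parallelogram
    identity makes the residuals a Cauchy sequence.\<close>
  have diff: "Q (\<lambda>z. h m z - h n z) < 2 * (inverse (Suc m) + inverse (Suc n))" for m n
  proof -
    have "(\<lambda>z. of_real (1/2) * (c m z + c n z)) \<in> C" by (intro scale add c) auto
    then have "\<delta> \<le> Q (\<lambda>z. x z - of_real (1/2) * (c m z + c n z))" by (rule Q_ge)
    also have "(\<lambda>z. x z - of_real (1/2) * (c m z + c n z)) = (\<lambda>z. of_real (1/2) * h m z + of_real (1/2) * h n z)"
      by (auto simp: h_def field_simps)
    also have "Q \<dots> = 1/4 * Q (h m) + 1/2 * dotp M (h m) (h n) + 1/4 * Q (h n)"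
      by (subst expand[OF L2_scale[OF h] h])
         (simp add: Q_def dotp_scale_left dotp_commute[of M _ "\<lambda>z. of_real _ * _ z"] power2_eq_square
           del: of_real_divide)
    finally have "4 * \<delta> \<le> Q (h m) + 2 * dotp M (h m) (h n) + Q (h n)" by simp
    moreover have "Q (\<lambda>z. h m z - h n z) = Q (h m) - 2 * dotp M (h m) (h n) + Q (h n)"
      using expand[OF h h, of m "-1" n] by simp
    ultimately show ?thesis using h_le[of m] h_le[of n] by simp
  qed
  have inv0: "(\<lambda>n. inverse (real (Suc n))) \<longlonglongrightarrow> 0" by (rule LIMSEQ_inverse_real_of_nat)
  obtain v where v: "L2 M v" and lim: "(\<lambda>n. sqnorm M (\<lambda>z. h n z - v z)) \<longlonglongrightarrow> 0"
  proof (rule L2_complete[OF h])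
    fix e :: real assume "e > 0"
    then obtain N where N: "inverse (real (Suc N)) < e / 4"
      using reals_Archimedean[of "e / 4"] by auto
    have "sqnorm M (\<lambda>z. h m z - h n z) < e" if "m \<ge> N" "n \<ge> N" for m n
    proof -
      have "inverse (real (Suc m)) \<le> inverse (real (Suc N))" "inverse (real (Suc n)) \<le> inverse (real (Suc N))"
        using that by (auto intro!: le_imp_inverse_le)
      then have "2 * (inverse (real (Suc m)) + inverse (real (Suc n))) \<le> 2 * (inverse (real (Suc N)) + inverse (real (Suc N)))"
        by (intro mult_left_mono add_mono) simp_all
      also have "\<dots> < e" using N by simp
      finally show ?thesis using diff[of m n] unfolding Q_def by (rule less_trans[rotated])
    qed
    then show "\<exists>N. \<forall>m\<ge>N. \<forall>n\<ge>N. sqnorm M (\<lambda>z. h m z - h n z) < e" by blast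
  qed blast
  have Q_lim: "(\<lambda>n. Q (h n)) \<longlonglongrightarrow> \<delta>"
    by (rule tendsto_sandwich[OF _ _ tendsto_const tendsto_add[OF tendsto_const inv0, simplified]])
       (use h_le h_ge less_imp_le in \<open>auto intro!: always_eventually\<close>)
  note dot_lim = dotp_tendsto[OF h v _ lim]
  show ?thesis
  proof (rule that[OF v])
    fix a assume a: "a \<in> C"
    \<comment> \<open>First variation: adding e a to \<open>c n\<close> cannot push the squared
      distance to x below \<delta>.\<close>
    have "2 * dotp M v a \<le> e * Q a" if "0 < e" for e
    proof -
      have "\<delta> \<le> Q (h n) + 2 * (-e) * dotp M (h n) a + (-e)\<^sup>2 * Q a" for n
      proof -
        have "(\<lambda>z. c n z + of_real e * a z) \<in> C" using that by (intro add scale c a) auto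
        from Q_ge[OF this] show ?thesis
          using expand[OF h C[OF a], of n "-e"] by (simp add: h_def algebra_simps)
      qed
      moreover have "(\<lambda>n. Q (h n) + 2 * (-e) * dotp M (h n) a + (-e)\<^sup>2 * Q a)
          \<longlonglongrightarrow> \<delta> + 2 * (-e) * dotp M v a + (-e)\<^sup>2 * Q a"
        by (intro tendsto_intros Q_lim dot_lim C a)
      ultimately have "\<delta> \<le> \<delta> + 2 * (-e) * dotp M v a + (-e)\<^sup>2 * Q a"
        by (intro LIMSEQ_le_const) auto
      then have "e * (2 * dotp M v a) \<le> e * (e * Q a)" by (simp add: power2_eq_square algebra_simps)
      then show ?thesis using that by (simp only: mult_le_cancel_left_pos)
    qed
    then have "2 * dotp M v a \<le> 0" by (rule le_zero_if_le_small_multiples)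
    then show "dotp M v a \<le> 0" by simp
  next
    let ?B = "Q x - 2 * dotp M v x + \<delta>"
    \<comment> \<open>The other variation shrinks \<open>c n\<close> by the factor 1 - e, which
      stays in the cone because e \<le> 1; it shows that the product of v and x is at least
      \<delta>.\<close>
    have "2 * (\<delta> - dotp M v x) \<le> e * ?B" if e: "0 < e" "e \<le> 1" for e
    proof -
      have "\<delta> \<le> Q (h n) + 2 * e * (dotp M (h n) x - Q (h n)) + e\<^sup>2 * (Q x - 2 * dotp M (h n) x + Q (h n))" for n
      proof -
        have cn: "c n = (\<lambda>z. x z - h n z)" by (simp add: h_def)
        have "(\<lambda>z. of_real (1 - e) * c n z) \<in> C" using e by (intro scale c) auto
        then have "\<delta> \<le> Q (\<lambda>z. x z - of_real (1 - e) * c n z)" by (rule Q_ge)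
        also have "(\<lambda>z. x z - of_real (1 - e) * c n z) = (\<lambda>z. h n z + of_real e * c n z)"
          by (auto simp: h_def algebra_simps)
        also have "Q \<dots> = Q (h n) + 2 * e * dotp M (h n) (c n) + e\<^sup>2 * Q (c n)"
          by (intro expand h C c)
        also have "dotp M (h n) (c n) = dotp M (h n) x - Q (h n)"
          using dotp_diff_left[OF x h h, of n n] unfolding Q_def cn dotp_commute[of M "h n" x]
            dotp_commute[of M "h n" "\<lambda>z. x z - h n z"] .
        also have "Q (c n) = Q x - 2 * dotp M (h n) x + Q (h n)"
          using expand[OF x h, of "-1" n] dotp_commute[of M x "h n"] by (simp add: cn)
        finally show ?thesis .
      qed
      moreover have "(\<lambda>n. Q (h n) + 2 * e * (dotp M (h n) x - Q (h n)) + e\<^sup>2 * (Q x - 2 * dotp M (h n) x + Q (h n)))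
          \<longlonglongrightarrow> \<delta> + 2 * e * (dotp M v x - \<delta>) + e\<^sup>2 * ?B"
        by (intro tendsto_intros Q_lim dot_lim x)
      ultimately have "\<delta> \<le> \<delta> + 2 * e * (dotp M v x - \<delta>) + e\<^sup>2 * ?B"
        by (intro LIMSEQ_le_const) auto
      then have "e * (2 * (\<delta> - dotp M v x)) \<le> e * (e * ?B)" by (simp add: power2_eq_square algebra_simps)
      then show ?thesis using e by (simp only: mult_le_cancel_left_pos)
    qed
    then have "2 * (\<delta> - dotp M v x) \<le> 0" by (rule le_zero_if_le_small_multiples)
    then show "dotp M v x > 0" using d(1) \<open>d \<le> \<delta>\<close> by simp
  qed
qed

subsection \<open>Sums over the integers\<close>

text \<open>As an integral over counting measure, the sum that defines \<open>energy\<close> can be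
  interchanged with other integrals by Tonelli.\<close>

lemma infsum_ennreal_eq_nn_integral:
  fixes f :: "int \<Rightarrow> ennreal"
  shows "infsum f UNIV = (\<integral>\<^sup>+n. f n \<partial>count_space UNIV)"
proof (rule antisym)
  have "sum f F \<le> (\<integral>\<^sup>+n. f n \<partial>count_space UNIV)" if "finite F" for F
  proof -
    have "sum f F = (\<integral>\<^sup>+n. f n \<partial>count_space F)"
      using that by (simp add: nn_integral_count_space_finite)
    also have "\<dots> = (\<integral>\<^sup>+n. f n * indicator F n \<partial>count_space UNIV)"
      by (simp add: nn_integral_count_space_indicator)
    also have "\<dots> \<le> (\<integral>\<^sup>+n. f n \<partial>count_space UNIV)"
      by (intro nn_integral_mono) (auto split: split_indicator)
    finally show ?thesis .
  qed
  then show "infsum f UNIV \<le> (\<integral>\<^sup>+n. f n \<partial>count_space UNIV)"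
    by (subst nonneg_infsum_complete) (auto intro: SUP_least)
next
  have "(\<integral>\<^sup>+n. f n \<partial>count_space UNIV) = (\<integral>\<^sup>+n. f (int_decode n) \<partial>count_space UNIV)"
    by (rule nn_integral_bij_count_space[symmetric, OF bij_int_decode])
  also have "\<dots> = (\<Sum>n. f (int_decode n))" by (rule nn_integral_count_space_nat)
  also have "\<dots> = (SUP k. \<Sum>n<k. f (int_decode n))" by (rule suminf_eq_SUP)
  also have "\<dots> \<le> infsum f UNIV"
  proof (rule SUP_least)
    fix k
    have "(\<Sum>n<k. f (int_decode n)) = sum f (int_decode ` {..<k})"
      by (subst sum.reindex) (auto simp: inj_int_decode)
    also have "\<dots> \<le> infsum f UNIV"
      by (subst nonneg_infsum_complete) (auto intro: SUP_upper)
    finally show "(\<Sum>n<k. f (int_decode n)) \<le> infsum f UNIV" .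
  qed
  finally show "(\<integral>\<^sup>+n. f n \<partial>count_space UNIV) \<le> infsum f UNIV" .
qed

lemma integrable_count_space_iff_summable_on:
  fixes f :: "'a \<Rightarrow> real"
  shows "integrable (count_space A) f \<longleftrightarrow> f summable_on A"
  using summable_on_iff_abs_summable_on_real[of f A] abs_summable_equivalent[of f A]
    abs_summable_on_def[of f A] by blast

lemma integral_count_space_eq_infsum:
  fixes f :: "'a \<Rightarrow> real"
  assumes "integrable (count_space A) f"
  shows "(LINT x|count_space A. f x) = infsum f A"
  using infsetsum_infsum[of f A] assms by (simp add: abs_summable_on_def infsetsum_def)

lemma symmetric_partial_sums_tendsto:
  fixes f :: "int \<Rightarrow> real"
  assumes "integrable (count_space UNIV) f"
  shows "(\<lambda>N. \<Sum>n\<in>{-int N..int N}. f n) \<longlonglongrightarrow> (LINT n|count_space UNIV. f n)"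
proof -
  have "(f has_sum (LINT n|count_space UNIV. f n)) UNIV"
    using assms by (simp add: integral_count_space_eq_infsum integrable_count_space_iff_summable_on)
  moreover have "filterlim (\<lambda>N. {-int N..int N}) (finite_subsets_at_top UNIV) sequentially"
    unfolding filterlim_finite_subsets_at_top
  proof safe
    fix X :: "int set" assume X: "finite X"
    define K where "K = nat (Max (insert 0 (abs ` X)))"
    have "\<bar>x\<bar> \<le> int K" if "x \<in> X" for x
      unfolding K_def using X that by (subst nat_0_le) (auto intro!: Max_ge)
    then have "\<forall>N\<ge>K. X \<subseteq> {-int N..int N}" by fastforce
    then show "\<forall>\<^sub>F N in sequentially. finite {-int N..int N} \<and> X \<subseteq> {-int N..int N} \<and> {-int N..int N} \<subseteq> UNIV"
      by (auto simp: eventually_sequentially)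
  qed
  ultimately show ?thesis unfolding has_sum_def by (rule filterlim_compose)
qed

subsection \<open>Measures on the circle\<close>

lemma sets_circle_measure [measurable_cong, simp]: "sets \<mu> = sets circle_borel"
  by (simp add: circle_measure_def)

lemma space_circle_borel [simp]: "space circle_borel = unit_circle"
  by (simp add: circle_borel_def space_restrict_space)

lemma space_circle_measure [simp]: "space \<mu> = unit_circle"
  by (simp add: circle_measure_def)

lemma borel_measurable_circle_eq:
  "sets M = sets circle_borel \<Longrightarrow> borel_measurable M = borel_measurable circle_borel"
  by (rule measurable_cong_sets) auto

lemma circle_borel_measurable_continuous:
  "continuous_on unit_circle f \<Longrightarrow> f \<in> borel_measurable circle_borel"
  unfolding circle_borel_def by (rule borel_measurable_continuous_on_restrict)

lemma circle_borel_measurable_borel: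
  assumes "f \<in> borel_measurable borel"
  shows "f \<in> borel_measurable circle_borel"
  unfolding circle_borel_def by (intro measurable_restrict_space1 assms)

lemma sets_circle_borel_closed: "closed A \<Longrightarrow> A \<inter> unit_circle \<in> sets circle_borel"
  by (auto simp: circle_borel_def sets_restrict_space_iff)

lemma sets_circle_borel_compact: "compact A \<Longrightarrow> A \<subseteq> unit_circle \<Longrightarrow> A \<in> sets circle_borel"
  using sets_circle_borel_closed[of A] by (simp add: compact_imp_closed Int_absorb2)

lemma power_int_measurable [measurable]:
  "(\<lambda>z::complex. z powi n) \<in> borel_measurable circle_borel"
  by (intro circle_borel_measurable_continuous continuous_intros) auto

lemma norm_power_int_circle: "cmod z = 1 \<Longrightarrow> cmod (z powi n) = 1"
  by (simp add: norm_power_int)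

lemma cnj_power_int_circle: "cmod z = 1 \<Longrightarrow> cnj (z powi n) = z powi (-n)"
proof -
  assume "cmod z = 1"
  then have "cnj z = inverse z"
    using complex_norm_square[of z] by (intro inverse_unique[symmetric]) simp
  then show ?thesis by (simp add: power_int_minus power_int_inverse)
qed

lemma cis_measurable: "cis \<in> measurable (uniform_measure lborel {0..<2 * pi}) circle_borel"
  unfolding circle_borel_def
  by (intro measurable_restrict_space2 borel_measurable_continuous_onI)
     (auto simp: measurable_cong_sets[OF sets_uniform_measure refl] sets_lborel
           intro!: borel_measurable_continuous_onI continuous_intros)

interpretation circle: prob_space \<mu>
  by (rule prob_space_circle_measure)

lemma circle_integrable_bounded:
  fixes f :: "complex \<Rightarrow> 'b::{banach, second_countable_topology}"
  assumes "finite_measure M" "sets M = sets circle_borel" "f \<in> borel_measurable circle_borel"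
    "\<And>z. cmod z = 1 \<Longrightarrow> norm (f z) \<le> B"
  shows "integrable M f"
proof -
  interpret finite_measure M by fact
  have sp: "space M = unit_circle" using sets_eq_imp_space_eq[OF assms(2)] by simp
  show ?thesis
    by (rule integrable_const_bound[where B=B])
       (use assms sp borel_measurable_circle_eq[of M] in auto)
qed

lemma cis_mult_measurable [measurable]: "(\<lambda>x::real. cis (c * x)) \<in> borel_measurable borel"
  by (intro borel_measurable_continuous_onI continuous_intros)

lemma circle_measure_integral_power: "(LINT z|\<mu>. z powi n) = (if n = 0 then 1 else 0)"
proof -
  have "1 / ennreal (2 * pi) = ennreal (1 / (2 * pi))"
    by (subst ennreal_1[symmetric], subst divide_ennreal) auto
  then have uni: "uniform_measure lborel {0..<2 * pi} = density lborel (\<lambda>x. ennreal (indicator {0..<2*pi} x / (2*pi)))"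
    unfolding uniform_measure_def
    by (intro density_cong) (auto split: split_indicator)
  have "(LINT z|\<mu>. z powi n) = (LINT x|uniform_measure lborel {0..<2 * pi}. cis (of_int n * x))"
    unfolding circle_measure_def
    by (subst integral_distr[OF cis_measurable power_int_measurable]) (simp add: cis_power_int)
  also have "\<dots> = (LBINT x. (indicator {0..<2*pi} x / (2*pi)) *\<^sub>R cis (of_int n * x))"
    unfolding uni
    by (subst integral_density) auto
  also have "\<dots> = (LBINT x. (1 / (2*pi)) *\<^sub>R (indicator {0..2*pi} x *\<^sub>R cis (of_int n * x)))"
    by (rule integral_cong_AE) (use AE_lborel_singleton[of "2*pi"] in \<open>auto split: split_indicator\<close>)
  also have "\<dots> = (1 / (2*pi)) *\<^sub>R (LBINT x. indicator {0..2*pi} x *\<^sub>R cis (of_int n * x))"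
    by (rule integral_scaleR_right)
  also have "\<dots> = (if n = 0 then 1 else 0)"
  proof (cases "n = 0")
    case True
    then show ?thesis by (simp add: integral_indicator scaleR_conv_of_real)
  next
    case False
    have "(LBINT x. indicator {0..2*pi} x *\<^sub>R cis (of_int n * x))
        = cis (of_int n * (2*pi)) / (\<i> * of_int n) - cis (of_int n * 0) / (\<i> * of_int n)"
    proof (rule integral_FTC_atLeastAtMost[where F="\<lambda>x. cis (of_int n * x) / (\<i> * of_int n)"])
      fix x :: real
      show "((\<lambda>x. cis (of_int n * x) / (\<i> * of_int n)) has_vector_derivative cis (of_int n * x)) (at x within {0..2*pi})"
        unfolding cis_conv_exp using False
        by (auto intro!: derivative_eq_intros has_vector_derivative_real_field simp: field_simps)
    qed (auto intro!: continuous_intros)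
    also have "cis (of_int n * (2*pi)) = 1"
      using cis_multiple_2pi[of "of_int n"] by (simp add: mult.commute)
    finally show ?thesis using False by simp
  qed
  finally show ?thesis .
qed

text \<open>By Stone-Weierstrass, polynomials in the real and imaginary parts, which on the circle are
  trigonometric polynomials, approximate all continuous functions.\<close>

lemma circle_measure_unique:
  assumes M: "finite_measure M" "sets M = sets circle_borel"
    and N: "finite_measure N" "sets N = sets circle_borel"
    and eq: "\<And>n. (LINT z|M. z powi n) = (LINT z|N. z powi n)"
  shows "M = N"
proof -
  interpret M: finite_measure M by fact
  interpret N: finite_measure N by fact
  have spM: "space M = unit_circle" and spN: "space N = unit_circle"
    using sets_eq_imp_space_eq[OF M(2)] sets_eq_imp_space_eq[OF N(2)] by auto
  note [measurable_cong] = M(2) N(2)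
  \<comment> \<open>Bounded g for which the complex measures g dM and g dN have the same Fourier
    coefficients. Carrying all coefficients makes the class stable under trigonometric monomials,
    and keeping g arbitrary in the induction handles products: the hypothesis for q feeds the one
    for p.\<close>
  define G :: "(complex \<Rightarrow> complex) \<Rightarrow> bool" where
    "G g \<longleftrightarrow> g \<in> borel_measurable circle_borel \<and> (\<exists>B. \<forall>z\<in>unit_circle. cmod (g z) \<le> B) \<and>
       (\<forall>n. (LINT z|M. g z * z powi n) = (LINT z|N. g z * z powi n))" for g
  have int: "integrable M (\<lambda>z. g z * z powi n)" "integrable N (\<lambda>z. g z * z powi n)" if g: "G g" for g n
  proof -
    obtain B where "\<forall>z\<in>unit_circle. cmod (g z) \<le> B" using g by (auto simp: G_def)
    then have "\<And>z. cmod z = 1 \<Longrightarrow> cmod (g z * z powi n) \<le> B"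
      by (simp add: norm_mult norm_power_int_circle)
    moreover have "(\<lambda>z. g z * z powi n) \<in> borel_measurable circle_borel"
      using g by (auto simp: G_def)
    ultimately show "integrable M (\<lambda>z. g z * z powi n)" "integrable N (\<lambda>z. g z * z powi n)"
      using M N circle_integrable_bounded by blast+
  qed
  have G_add: "G (\<lambda>z. f z + g z)" if fg: "G f" "G g" for f g
  proof -
    from fg obtain A B where "\<forall>z\<in>unit_circle. cmod (f z) \<le> A" "\<forall>z\<in>unit_circle. cmod (g z) \<le> B"
      by (auto simp: G_def)
    then have "\<forall>z\<in>unit_circle. cmod (f z + g z) \<le> A + B"
      by (meson add_mono norm_triangle_le)
    moreover have "(LINT z|M. (f z + g z) * z powi n) = (LINT z|N. (f z + g z) * z powi n)" for n
      using fg int[OF fg(1)] int[OF fg(2)] by (simp add: ring_distribs G_def)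
    ultimately show ?thesis using fg by (auto simp: G_def)
  qed
  have G_mult: "G (\<lambda>z. c * z powi k * g z)" if g: "G g" for c k g
  proof -
    from g obtain B where "\<forall>z\<in>unit_circle. cmod (g z) \<le> B" by (auto simp: G_def)
    then have "\<forall>z\<in>unit_circle. cmod (c * z powi k * g z) \<le> cmod c * B"
      by (auto simp: norm_mult norm_power_int_circle intro: mult_left_mono)
    moreover have *: "(LINT z|X. c * z powi k * g z * z powi n) = c * (LINT z|X. g z * z powi (k + n))"
      if "space X = unit_circle" for n X
    proof -
      have "(LINT z|X. c * z powi k * g z * z powi n) = (LINT z|X. c * (g z * z powi (k + n)))"
      proof (rule Bochner_Integration.integral_cong)
        fix z assume "z \<in> space X"
        then have "z \<noteq> 0" using that by auto
        then show "c * z powi k * g z * z powi n = c * (g z * z powi (k + n))"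
          by (simp add: power_int_add)
      qed simp
      then show ?thesis by simp
    qed
    ultimately show ?thesis using g *[OF spM] *[OF spN] by (auto simp: G_def)
  qed
  have G_poly: "G (\<lambda>z. of_real (p z) * g z)" if "real_polynomial_function p" "G g" for p g
    using that
  proof (induction p arbitrary: g)
    case (linear p)
    interpret bounded_linear p by fact
    \<comment> \<open>A real-linear functional of z is a combination of z and its conjugate, which
      is z^{-1} on the circle.\<close>
    let ?a = "(of_real (p 1) - \<i> * of_real (p \<i>)) / 2"
    let ?b = "(of_real (p 1) + \<i> * of_real (p \<i>)) / 2"
    have pz: "of_real (p z) = ?a * z powi 1 + ?b * z powi (-1)" if "cmod z = 1" for z
    proof -
      have "z = Re z *\<^sub>R 1 + Im z *\<^sub>R \<i>" by (simp add: complex_eq_iff)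
      then have "p z = Re z * p 1 + Im z * p \<i>" by (metis add scaleR real_scaleR_def)
      moreover have "z powi (-1) = cnj z" using cnj_power_int_circle[OF that, of 1] by simp
      ultimately show ?thesis by (simp only:) (simp add: complex_eq_iff field_simps)
    qed
    have *: "G (\<lambda>z. ?a * z powi 1 * g z + ?b * z powi (-1) * g z)" by (intro G_add G_mult linear.prems)
    have pz': "of_real (p z) * g z = ?a * z powi 1 * g z + ?b * z powi (-1) * g z" if "cmod z = 1" for z
      by (subst pz[OF that]) (simp add: algebra_simps)
    have "p \<in> borel_measurable circle_borel"
      by (intro circle_borel_measurable_continuous linear_continuous_on linear.hyps)
    then have "(\<lambda>z. of_real (p z) * g z) \<in> borel_measurable circle_borel"
      using linear.prems unfolding G_def by (auto intro!: borel_measurable_times borel_measurable_of_real)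
    moreover have "(LINT z|X. of_real (p z) * g z * z powi n)
        = (LINT z|X. (?a * z powi 1 * g z + ?b * z powi (-1) * g z) * z powi n)" if "space X = unit_circle" for X n
      by (intro Bochner_Integration.integral_cong) (use that pz' in auto)
    moreover have "\<exists>B. \<forall>z\<in>unit_circle. cmod (of_real (p z) * g z) \<le> B"
      using * pz' by (auto simp: G_def)
    ultimately show ?case using * spM spN unfolding G_def by simp
  next
    case (const c)
    then show ?case using G_mult[of g "of_real c" 0] by simp
  next
    case (add p q)
    then show ?case using G_add[OF add.IH(1)[OF add.prems] add.IH(2)[OF add.prems]] by (simp add: algebra_simps)
  next
    case (mult p q)
    then show ?case using mult.IH(1)[OF mult.IH(2)[OF mult.prems]] by (simp add: mult.assoc)
  qed
  have G1: "G (\<lambda>z. 1)" using eq by (auto simp: G_def)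
  have poly: "(LINT z|M. p z) = (LINT z|N. p z)" if "real_polynomial_function p" for p :: "complex \<Rightarrow> real"
  proof -
    have "(LINT z|M. complex_of_real (p z)) = (LINT z|N. complex_of_real (p z))"
      using G_poly[OF that G1] unfolding G_def by (auto dest: spec[of _ 0])
    then show ?thesis by simp
  qed
  have cont: "(LINT z|M. \<phi> z) = (LINT z|N. \<phi> z)" if \<phi>: "continuous_on unit_circle \<phi>" for \<phi> :: "complex \<Rightarrow> real"
  proof -
    have intc: "integrable X \<psi>" if "finite_measure X" "sets X = sets circle_borel" "continuous_on unit_circle \<psi>"
      for X and \<psi> :: "complex \<Rightarrow> real"
    proof -
      have "bounded (\<psi> ` unit_circle)"
        using that by (intro compact_imp_bounded compact_continuous_image) auto
      then obtain B where "\<forall>x\<in>\<psi> ` unit_circle. norm x \<le> B" by (auto simp: bounded_iff)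
      then show ?thesis
        using that by (intro circle_integrable_bounded[of X \<psi> B] circle_borel_measurable_continuous) auto
    qed
    have pc: "continuous_on unit_circle p" if "real_polynomial_function p" for p :: "complex \<Rightarrow> real"
      using that by (simp add: continuous_on_polymonial_function real_polynomial_function_eq)
    have "\<bar>(LINT z|M. \<phi> z) - (LINT z|N. \<phi> z)\<bar> \<le> e * (measure M unit_circle + measure N unit_circle)" if e: "e > 0" for e
    proof -
      obtain p where p: "real_polynomial_function p" "\<And>x. x \<in> unit_circle \<Longrightarrow> \<bar>\<phi> x - p x\<bar> < e"
        using Stone_Weierstrass_real_polynomial_function[OF _ \<phi> e] by auto
      have *: "\<bar>(LINT z|X. \<phi> z) - (LINT z|X. p z)\<bar> \<le> e * measure X unit_circle"
        if X: "finite_measure X" "sets X = sets circle_borel" for X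
      proof -
        have spX: "space X = unit_circle" using sets_eq_imp_space_eq[OF X(2)] by simp
        have "\<bar>(LINT z|X. \<phi> z) - (LINT z|X. p z)\<bar> = norm (LINT z|X. \<phi> z - p z)"
          using intc[OF X \<phi>] intc[OF X pc[OF p(1)]] by simp
        also have "\<dots> \<le> (LINT z|X. norm (\<phi> z - p z))" by (rule integral_norm_bound)
        also have "\<dots> \<le> (LINT z|X. e)"
        proof (rule integral_mono)
          show "integrable X (\<lambda>z. norm (\<phi> z - p z))"
            by (intro integrable_norm Bochner_Integration.integrable_diff intc X \<phi> pc p)
          show "integrable X (\<lambda>z. e)" by (intro intc X continuous_intros)
          show "norm (\<phi> z - p z) \<le> e" if "z \<in> space X" for z
            using p(2)[of z] that spX by simp
        qed
        also have "\<dots> = e * measure X unit_circle" using spX by simp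
        finally show ?thesis .
      qed
      show ?thesis using *[OF M] *[OF N] poly[OF p(1)] by (simp add: algebra_simps abs_le_iff)
    qed
    then have "\<bar>(LINT z|M. \<phi> z) - (LINT z|N. \<phi> z)\<bar> \<le> 0" by (intro le_zero_if_le_small_multiples) auto
    then show ?thesis by simp
  qed
  have closed: "emeasure M (K \<inter> unit_circle) = emeasure N (K \<inter> unit_circle)" if K: "closed K" "K \<noteq> {}" for K
  proof -
    \<comment> \<open>Continuous tents decreasing to the indicator of K.\<close>
    define \<phi> where "\<phi> n = (\<lambda>z. max 0 (1 - real n * infdist z K))" for n
    have lim: "(\<lambda>n. LINT z|X. \<phi> n z) \<longlonglongrightarrow> measure X (K \<inter> unit_circle)"
      if X: "finite_measure X" "sets X = sets circle_borel" for X
    proof -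
      interpret X: finite_measure X by fact
      note [measurable_cong] = X(2)
      have spX: "space X = unit_circle" using sets_eq_imp_space_eq[OF X(2)] by simp
      have [measurable]: "K \<inter> unit_circle \<in> sets circle_borel" by (rule sets_circle_borel_closed[OF K(1)])
      have [measurable]: "\<phi> n \<in> borel_measurable circle_borel" for n
        unfolding \<phi>_def by (intro circle_borel_measurable_continuous continuous_intros)
      have phi: "\<phi> n \<in> borel_measurable X" for n by measurable
      have "(\<lambda>n. LINT z|X. \<phi> n z) \<longlonglongrightarrow> (LINT z|X. indicator (K \<inter> unit_circle) z)"
      proof (rule integral_dominated_convergence[where w="\<lambda>_. 1"])
        show "AE z in X. (\<lambda>n. \<phi> n z) \<longlonglongrightarrow> indicator (K \<inter> unit_circle) z"
        proof (rule AE_I2)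
          fix z assume z: "z \<in> space X"
          show "(\<lambda>n. \<phi> n z) \<longlonglongrightarrow> indicator (K \<inter> unit_circle) z"
          proof (cases "z \<in> K")
            case True
            then show ?thesis using z spX by (simp add: \<phi>_def)
          next
            case False
            then have "infdist z K > 0" using K by (metis in_closed_iff_infdist_zero infdist_nonneg less_eq_real_def)
            then obtain m where m: "1 < real m * infdist z K" using reals_Archimedean3 by blast
            have "\<phi> n z = 0" if "n \<ge> m" for n
            proof -
              have "real m * infdist z K \<le> real n * infdist z K"
                using that \<open>infdist z K > 0\<close> by (intro mult_right_mono) auto
              then show ?thesis using m by (simp add: \<phi>_def)
            qed
            then have "(\<lambda>n. \<phi> n z) \<longlonglongrightarrow> 0" by (intro tendsto_eventually) (auto simp: eventually_sequentially)
            then show ?thesis using False by simp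
          qed
        qed
      qed (use phi in \<open>auto simp: \<phi>_def infdist_nonneg\<close>)
      moreover have "(LINT z|X. indicat_real (K \<inter> unit_circle) z) = measure X (K \<inter> unit_circle)"
        using spX by (simp add: Int_absorb2)
      ultimately show ?thesis by simp
    qed
    have "(LINT z|M. \<phi> n z) = (LINT z|N. \<phi> n z)" for n
      unfolding \<phi>_def by (intro cont continuous_intros)
    then have "measure M (K \<inter> unit_circle) = measure N (K \<inter> unit_circle)"
      using lim[OF M] lim[OF N] by (simp add: LIMSEQ_unique)
    then show ?thesis by (simp add: M.emeasure_eq_measure N.emeasure_eq_measure)
  qed
  \<comment> \<open>Moved to the Borel sets of the whole plane, which are generated by the closed
    sets, a family stable under intersections.\<close>
  define T where "T X = distr X borel (\<lambda>z::complex. z)" for X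
  have idm: "(\<lambda>z::complex. z) \<in> measurable X borel" if "sets X = sets circle_borel" for X
    unfolding borel_measurable_circle_eq[OF that] by (rule circle_borel_measurable_borel) simp
  have "T M = T N"
  proof (rule measure_eqI_generator_eq[where E="{K::complex set. closed K}" and \<Omega>=UNIV and A="\<lambda>_. UNIV"])
    show "Int_stable {K::complex set. closed K}" by (auto simp: Int_stable_def)
    show "emeasure (T M) X = emeasure (T N) X" if "X \<in> {K. closed K}" for X
    proof (cases "X = {}")
      case False
      then show ?thesis
        using that closed[of X] unfolding T_def
        by (subst (1 2) emeasure_distr) (auto simp: spM spN intro!: idm[OF M(2)] idm[OF N(2)])
    qed simp
    show "sets (T M) = sigma_sets UNIV {K. closed K}" "sets (T N) = sigma_sets UNIV {K. closed K}"
      by (simp_all add: T_def borel_eq_closed)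
    show "emeasure (T M) UNIV \<noteq> \<infinity>" for i :: nat
      unfolding T_def by (subst emeasure_distr) (auto intro!: idm[OF M(2)])
  qed auto
  show "M = N"
  proof (rule measure_eqI)
    fix A assume "A \<in> sets M"
    then have A: "A \<in> sets borel" "A \<subseteq> unit_circle"
      using M by (auto simp: circle_borel_def sets_restrict_space_iff)
    have "emeasure (T M) A = emeasure (T N) A" using \<open>T M = T N\<close> by simp
    then show "emeasure M A = emeasure N A"
      using A unfolding T_def
      by (subst (asm) (1 2) emeasure_distr) (auto simp: spM spN Int_absorb2 intro!: idm[OF M(2)] idm[OF N(2)])
  qed (simp add: M(2) N(2))
qed


section \<open>Invariance of Lebesgue measure under rotations\<close>

lemma rotation_measurable [measurable]:
  assumes "cmod w = 1"
  shows "(\<lambda>z. w * z) \<in> measurable circle_borel circle_borel"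
proof -
  have "(\<lambda>z. w * z) \<in> borel_measurable circle_borel"
    by (intro circle_borel_measurable_continuous continuous_intros)
  then show ?thesis
    using assms unfolding circle_borel_def
    by (intro measurable_restrict_space2) (auto simp: space_restrict_space norm_mult)
qed

text \<open>Rotation by w multiplies the integral of the n-th power by w^n, and for this measure
  only the one with n = 0 is nonzero.\<close>

lemma distr_rotation:
  assumes w: "cmod w = 1"
  shows "distr \<mu> circle_borel (\<lambda>z. w * z) = \<mu>"
proof (rule circle_measure_unique)
  note [measurable] = rotation_measurable[OF w]
  show "finite_measure (distr \<mu> circle_borel (\<lambda>z. w * z))"
    by (intro circle.finite_measure_distr) measurable
  fix n
  have "(LINT z|distr \<mu> circle_borel (\<lambda>z. w * z). z powi n) = (LINT z|\<mu>. (w * z) powi n)"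
    by (intro integral_distr) measurable
  also have "\<dots> = w powi n * (LINT z|\<mu>. z powi n)"
    by (simp add: power_int_mult_distrib)
  also have "\<dots> = (LINT z|\<mu>. z powi n)"
    by (simp add: circle_measure_integral_power)
  finally show "(LINT z|distr \<mu> circle_borel (\<lambda>z. w * z). z powi n) = (LINT z|\<mu>. z powi n)" .
qed (auto intro: circle.finite_measure_axioms)

lemma nn_integral_rotation:
  assumes "cmod w = 1" "f \<in> borel_measurable circle_borel"
  shows "(\<integral>\<^sup>+z. f (w * z) \<partial>\<mu>) = (\<integral>\<^sup>+z. f z \<partial>\<mu>)"
  using nn_integral_distr[of "\<lambda>z. w * z" \<mu> circle_borel f] assms
  by (simp add: distr_rotation rotation_measurable)

lemma integral_rotation:
  fixes f :: "complex \<Rightarrow> 'b::{banach, second_countable_topology}"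
  assumes "cmod w = 1" "f \<in> borel_measurable circle_borel"
  shows "(LINT z|\<mu>. f (w * z)) = (LINT z|\<mu>. f z)"
  using integral_distr[of "\<lambda>z. w * z" \<mu> circle_borel f] assms
  by (simp add: distr_rotation rotation_measurable)

subsection \<open>Fourier series in $L^2$\<close>

lemma in_L2_iff: "in_L2 f \<longleftrightarrow> L2 \<mu> f"
  by (simp add: in_L2_def L2_def)

lemma L2_bounded:
  assumes "f \<in> borel_measurable circle_borel" "\<And>z. cmod z = 1 \<Longrightarrow> cmod (f z) \<le> B"
  shows "L2 \<mu> f"
proof (rule L2_bound[where f="\<lambda>_. 1" and C=B])
  show "L2 \<mu> (\<lambda>_. 1)" by (simp add: L2_def)
qed (use assms in auto)

lemma L2_mult_bounded:
  assumes "L2 \<mu> f" "g \<in> borel_measurable circle_borel" "\<And>z. cmod z = 1 \<Longrightarrow> cmod (g z) \<le> B"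
  shows "L2 \<mu> (\<lambda>z. g z * f z)"
  using assms L2_measurable[OF assms(1)]
  by (intro L2_bound[OF assms(1), where C=B]) (auto simp: norm_mult intro!: mult_right_mono AE_I2)

lemma L2_power: "L2 \<mu> (\<lambda>z. c * z powi n)"
  by (intro L2_scale L2_bounded[where B=1]) (auto simp: norm_power_int_circle)

lemma L2_imp_integrable:
  assumes "L2 \<mu> f"
  shows "integrable \<mu> f"
proof -
  have "integrable \<mu> (\<lambda>z. 1 + (cmod (f z))\<^sup>2)"
    using assms by (simp add: L2_def)
  then show ?thesis
  proof (rule Bochner_Integration.integrable_bound)
    have "cmod (f x) \<le> 1 + (cmod (f x))\<^sup>2" for x
      using sum_squares_bound[of "cmod (f x)" 1] norm_ge_zero[of "f x"] unfolding power_one mult_1_right by linarith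
    then show "AE x in \<mu>. norm (f x) \<le> norm (1 + (cmod (f x))\<^sup>2)" by simp
  qed (use assms in \<open>auto dest: L2_measurable\<close>)
qed

lemma integrable_power_mult:
  assumes "L2 \<mu> f"
  shows "integrable \<mu> (\<lambda>z. z powi n * f z)"
  by (intro L2_imp_integrable L2_mult_bounded[where B=1] assms) (auto simp: norm_power_int_circle)

lemma fun_fourier_diff:
  "L2 \<mu> f \<Longrightarrow> L2 \<mu> g \<Longrightarrow>
    fun_fourier (\<lambda>z. f z - g z) n = fun_fourier f n - fun_fourier g n"
  by (simp add: fun_fourier_def right_diff_distrib integrable_power_mult del: power_int_minus)

lemma fun_fourier_add:
  "L2 \<mu> f \<Longrightarrow> L2 \<mu> g \<Longrightarrow>
    fun_fourier (\<lambda>z. f z + g z) n = fun_fourier f n + fun_fourier g n"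
  by (simp add: fun_fourier_def distrib_left integrable_power_mult)

lemma fun_fourier_scale: "fun_fourier (\<lambda>z. c * f z) n = c * fun_fourier f n"
  by (simp add: fun_fourier_def mult.left_commute[of _ c])

lemma fun_fourier_sum:
  "(\<And>i. i \<in> I \<Longrightarrow> L2 \<mu> (f i)) \<Longrightarrow>
    fun_fourier (\<lambda>z. \<Sum>i\<in>I. f i z) n = (\<Sum>i\<in>I. fun_fourier (f i) n)"
proof (induction I rule: infinite_finite_induct)
  case (insert i I)
  then show ?case by (simp add: fun_fourier_add L2_sum)
qed (simp_all add: fun_fourier_def)

lemma fun_fourier_power: "fun_fourier (\<lambda>z. c * z powi k) n = (if n = k then c else 0)"
proof -
  have "(LINT z|\<mu>. z powi (-n) * (c * z powi k)) = (LINT z|\<mu>. c * z powi (k - n))"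
  proof (rule Bochner_Integration.integral_cong)
    fix z :: complex assume "z \<in> space \<mu>"
    then have "z \<noteq> 0" by auto
    then have "z powi (k - n) = z powi k * z powi (-n)" using power_int_add[of z k "-n"] by simp
    then show "z powi (-n) * (c * z powi k) = c * z powi (k - n)" by simp
  qed simp
  then show ?thesis by (simp add: fun_fourier_def circle_measure_integral_power)
qed

lemma fun_fourier_cong_AE:
  "f \<in> borel_measurable circle_borel \<Longrightarrow> g \<in> borel_measurable circle_borel \<Longrightarrow>
    AE z in \<mu>. f z = g z \<Longrightarrow> fun_fourier f n = fun_fourier g n"
  unfolding fun_fourier_def by (intro integral_cong_AE) (auto intro!: borel_measurable_times)

lemma dotp_power:
  assumes "L2 \<mu> f"
  shows "dotp \<mu> f (\<lambda>z. c * z powi n) = fun_fourier f n \<bullet> c"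
proof -
  have "(LINT z|\<mu>. f z \<bullet> (c * z powi n)) = (LINT z|\<mu>. (z powi (-n) * f z) \<bullet> c)"
  proof (rule Bochner_Integration.integral_cong)
    fix z assume "z \<in> space \<mu>"
    then have *: "z powi (-n) = cnj (z powi n)" by (intro cnj_power_int_circle[symmetric]) simp
    have "a \<bullet> (c * w) = (cnj w * a) \<bullet> c" for a w :: complex
      by (simp add: inner_complex_def algebra_simps)
    then show "f z \<bullet> (c * z powi n) = (z powi (-n) * f z) \<bullet> c"
      unfolding * by blast
  qed simp
  then show ?thesis
    using integrable_power_mult[OF assms, of "-n"] by (simp add: dotp_def fun_fourier_def)
qed

definition trig :: "int set \<Rightarrow> (int \<Rightarrow> complex) \<Rightarrow> complex \<Rightarrow> complex" where
  "trig F c z = (\<Sum>n\<in>F. c n * z powi n)"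

lemma L2_trig: "L2 \<mu> (trig F c)"
  unfolding trig_def[abs_def] by (intro L2_sum L2_power)

lemma dotp_trig:
  assumes "L2 \<mu> f"
  shows "dotp \<mu> f (trig F c) = (\<Sum>n\<in>F. fun_fourier f n \<bullet> c n)"
proof -
  have "dotp \<mu> f (trig F c) = (\<Sum>n\<in>F. dotp \<mu> f (\<lambda>z. c n * z powi n))"
    unfolding dotp_def trig_def inner_sum_right
    by (intro Bochner_Integration.integral_sum L2_integrable_dotp assms L2_power)
  then show ?thesis using assms by (simp add: dotp_power)
qed

lemma fun_fourier_trig:
  "finite F \<Longrightarrow> fun_fourier (trig F c) n = (if n \<in> F then c n else 0)"
  unfolding trig_def[abs_def] by (subst fun_fourier_sum[OF L2_power]) (simp add: fun_fourier_power)

lemma Bessel: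
  assumes f: "L2 \<mu> f" and F: "finite F"
  shows "(\<Sum>n\<in>F. (cmod (fun_fourier f n))\<^sup>2) \<le> dotp \<mu> f f"
proof -
  let ?S = "trig F (fun_fourier f)"
  have "dotp \<mu> ?S ?S = (\<Sum>n\<in>F. (cmod (fun_fourier f n))\<^sup>2)"
    using F by (simp add: dotp_trig L2_trig fun_fourier_trig dot_square_norm)
  moreover have "dotp \<mu> f ?S = (\<Sum>n\<in>F. (cmod (fun_fourier f n))\<^sup>2)"
    using f by (simp add: dotp_trig dot_square_norm)
  ultimately show ?thesis
    using dotp_add_scale_self[OF f L2_trig[of F "fun_fourier f"], of "-1"]
      dotp_self_nonneg[of \<mu> "\<lambda>x. f x + of_real (-1) * ?S x"] by simp
qed

lemma L2_count_space_iff: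
  "L2 (count_space UNIV) c \<longleftrightarrow> (\<lambda>n. (cmod (c n))\<^sup>2) summable_on UNIV"
  by (simp add: L2_def integrable_count_space_iff_summable_on)

lemma L2_fun_fourier:
  assumes f: "L2 \<mu> f"
  shows "L2 (count_space UNIV) (fun_fourier f)"
  unfolding L2_count_space_iff using Bessel[OF f]
  by (intro nonneg_bounded_partial_sums_imp_summable_on[where C="dotp \<mu> f f"]
        eventually_finite_subsets_at_top_weakI) auto

text \<open>Orthogonality turns distances between partial sums into differences of the numerical
  partial sums \<open>a\<close>. Convergence of the partial sums is part of the conclusion because
  \<open>Parseval\<close> is derived from it.\<close>

lemma Riesz_Fischer:
  assumes c: "L2 (count_space UNIV) c"
  obtains g where "L2 \<mu> g" "fun_fourier g = c"
    "(\<lambda>N. sqnorm \<mu> (\<lambda>z. trig {-int N..int N} c z - g z)) \<longlonglongrightarrow> 0"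
proof -
  define S where "S N = trig {-int N..int N} c" for N
  define a where "a N = (\<Sum>n\<in>{-int N..int N}. (cmod (c n))\<^sup>2)" for N
  have S: "L2 \<mu> (S N)" for N by (simp add: S_def L2_trig)
  have "a \<longlonglongrightarrow> (LINT n|count_space UNIV. (cmod (c n))\<^sup>2)"
    unfolding a_def by (rule symmetric_partial_sums_tendsto) (use c in \<open>simp add: L2_def\<close>)
  then have "Cauchy a" by (rule LIMSEQ_imp_Cauchy)
  have dotS: "dotp \<mu> (S m) (S n) = a (min m n)" for m n
  proof -
    have "dotp \<mu> (S m) (S n) = (\<Sum>k\<in>{-int n..int n}. if k \<in> {-int m..int m} then (cmod (c k))\<^sup>2 else 0)"
      unfolding S_def by (simp add: dotp_trig L2_trig fun_fourier_trig if_distrib[of "\<lambda>x. x \<bullet> _"] dot_square_norm cong: if_cong)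
    also have "\<dots> = (\<Sum>k\<in>{-int n..int n} \<inter> {-int m..int m}. (cmod (c k))\<^sup>2)"
      by (rule sum.inter_restrict[symmetric]) simp
    also have "{-int n..int n} \<inter> {-int m..int m} = {-int (min m n)..int (min m n)}" by auto
    finally show ?thesis by (simp add: a_def)
  qed
  have diff: "sqnorm \<mu> (\<lambda>z. S m z - S n z) = \<bar>a m - a n\<bar>" for m n
  proof -
    have mono: "a i \<le> a j" if "i \<le> j" for i j
      unfolding a_def using that by (intro sum_mono2) auto
    have "sqnorm \<mu> (\<lambda>z. S m z - S n z) = a m - 2 * a (min m n) + a n"
      using dotp_add_scale_self[OF S S, of m "-1" n] by (simp add: dotS)
    then show ?thesis using mono[of m n] mono[of n m] by (cases "m \<le> n") (auto simp: min_def)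
  qed
  obtain g where g: "L2 \<mu> g"
    and lim: "(\<lambda>N. sqnorm \<mu> (\<lambda>z. S N z - g z)) \<longlonglongrightarrow> 0"
  proof (rule L2_complete[OF S])
    fix e :: real assume "e > 0"
    then show "\<exists>N. \<forall>m\<ge>N. \<forall>n\<ge>N. sqnorm \<mu> (\<lambda>z. S m z - S n z) < e"
      using \<open>Cauchy a\<close> unfolding diff Cauchy_def dist_real_def by blast
  qed blast
  have "fun_fourier g n = c n" for n
  proof -
    have "fun_fourier g n \<bullet> d = c n \<bullet> d" for d
    proof (rule LIMSEQ_unique)
      show "(\<lambda>N. dotp \<mu> (S N) (\<lambda>z. d * z powi n)) \<longlonglongrightarrow> fun_fourier g n \<bullet> d"
        unfolding dotp_power[OF g, symmetric] by (intro dotp_tendsto S g L2_power lim)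
      have "dotp \<mu> (S N) (\<lambda>z. d * z powi n) = c n \<bullet> d" if "N \<ge> nat \<bar>n\<bar>" for N
        using that unfolding dotp_power[OF S] unfolding S_def by (auto simp: fun_fourier_trig)
      then show "(\<lambda>N. dotp \<mu> (S N) (\<lambda>z. d * z powi n)) \<longlonglongrightarrow> c n \<bullet> d"
        by (intro tendsto_eventually) (auto simp: eventually_sequentially)
    qed
    then show ?thesis by (subst vector_eq_rdot[symmetric]) blast
  qed
  then show ?thesis using g lim that[of g] unfolding S_def by blast
qed

lemma fun_fourier_cnj:
  assumes f: "L2 \<mu> f"
  shows "fun_fourier (\<lambda>z. cnj (f z)) n = cnj (fun_fourier f (-n))"
proof -
  have "fun_fourier (\<lambda>z. cnj (f z)) n = (LINT z|\<mu>. cnj (z powi n * f z))"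
    unfolding fun_fourier_def complex_cnj_mult
    by (intro Bochner_Integration.integral_cong) (auto simp: cnj_power_int_circle simp del: complex_cnj_power_int)
  also have "\<dots> = cnj (fun_fourier f (-n))"
    unfolding fun_fourier_def minus_minus
    by (rule integral_bounded_linear[OF bounded_linear_cnj integrable_power_mult[OF f]])
  finally show ?thesis .
qed

text \<open>Positive and negative part, taken as densities, are finite measures with the same
  Fourier coefficients. So they agree almost everywhere, and since one of them is zero at every
  point, both vanish.\<close>

lemma real_fun_fourier_zero_imp_zero:
  fixes f :: "complex \<Rightarrow> real"
  assumes f: "L2 \<mu> (\<lambda>z. of_real (f z))" and zero: "\<And>n. fun_fourier (\<lambda>z. of_real (f z)) n = 0"
  shows "AE z in \<mu>. f z = 0"
proof -
  have "(\<lambda>z. Re (of_real (f z))) \<in> borel_measurable circle_borel"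
    using L2_measurable[OF f] by measurable
  then have [measurable]: "f \<in> borel_measurable circle_borel" by simp
  have int: "integrable \<mu> f" using L2_imp_integrable[OF f] by (simp add: complex_of_real_integrable_eq)
  let ?D = "\<lambda>g. density \<mu> (\<lambda>z. ennreal (g z))"
  let ?p = "\<lambda>z. max 0 (f z)" and ?q = "\<lambda>z. max 0 (- f z)"
  have fin: "finite_measure (?D g)" if "integrable \<mu> g" "\<And>z. 0 \<le> g z" for g
  proof (rule finite_measureI)
    have "emeasure (?D g) (space \<mu>) = (\<integral>\<^sup>+z. ennreal (g z) \<partial>\<mu>)"
      using that by (subst emeasure_density[OF _ sets.top]) (auto intro!: nn_integral_cong)
    then show "emeasure (?D g) (space (?D g)) \<noteq> \<infinity>"
      using that by (simp add: integrable_iff_bounded less_top)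
  qed
  have ip: "integrable \<mu> ?p" and iq: "integrable \<mu> ?q"
    using int by auto
  have pq: "?D ?p = ?D ?q"
  proof (rule circle_measure_unique)
    fix n
    have *: "integrable \<mu> (\<lambda>z. g z *\<^sub>R z powi n)" if "integrable \<mu> g" for g :: "complex \<Rightarrow> real"
      by (rule Bochner_Integration.integrable_bound[OF that]) (use that in \<open>auto simp: norm_power_int_circle\<close>)
    have D: "(LINT z|?D g. z powi n) = (LINT z|\<mu>. g z *\<^sub>R z powi n)"
      if "g \<in> borel_measurable circle_borel" "\<And>z. 0 \<le> g z" for g
      using that by (intro integral_density) auto
    have "(LINT z|?D ?p. z powi n) - (LINT z|?D ?q. z powi n)
        = (LINT z|\<mu>. ?p z *\<^sub>R z powi n - ?q z *\<^sub>R z powi n)"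
      using *[OF ip] *[OF iq] by (subst (1 2) D) simp_all
    also have "\<dots> = (LINT z|\<mu>. z powi (-(-n)) * of_real (f z))"
      by (intro Bochner_Integration.integral_cong refl) (auto simp: max_def scaleR_conv_of_real)
    also have "\<dots> = 0" using zero[of "-n"] by (simp add: fun_fourier_def)
    finally show "(LINT z|?D ?p. z powi n) = (LINT z|?D ?q. z powi n)" by simp
  qed (use fin[OF ip] fin[OF iq] in auto)
  have "AE z in \<mu>. ennreal (?p z) = ennreal (?q z)"
    using pq ip by (subst (asm) finite_density_unique) (auto simp: integrable_iff_bounded cong: nn_integral_cong)
  then show ?thesis by eventually_elim (auto simp: max_def split: if_splits)
qed

text \<open>Conjugation sends the coefficient at -n to its conjugate at n, so the real and imaginary
  parts of f have vanishing coefficients too.\<close>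

lemma fun_fourier_zero_imp_zero:
  assumes f: "L2 \<mu> f" and zero: "\<And>n. fun_fourier f n = 0"
  shows "AE z in \<mu>. f z = 0"
proof -
  have [measurable]: "f \<in> borel_measurable circle_borel" using L2_measurable[OF f] by simp
  have "(\<lambda>z. cnj (f z)) \<in> borel_measurable circle_borel"
    by (rule measurable_compose[OF _ borel_measurable_continuous_onI]) (auto intro: continuous_intros)
  then have cnj: "L2 \<mu> (\<lambda>z. cnj (f z))" by (intro L2_bound[OF f, where C=1]) auto
  have "AE z in \<mu>. Re (f z) = 0"
  proof (rule real_fun_fourier_zero_imp_zero)
    have eq: "(\<lambda>z. of_real (Re (f z))) = (\<lambda>z. (1/2) * (f z + cnj (f z)))" by (auto simp: complex_eq_iff)
    show "L2 \<mu> (\<lambda>z. of_real (Re (f z)))" unfolding eq by (intro L2_scale L2_add f cnj)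
    show "fun_fourier (\<lambda>z. of_real (Re (f z))) n = 0" for n
      unfolding eq fun_fourier_scale by (simp add: fun_fourier_add f cnj fun_fourier_cnj zero)
  qed
  moreover have "AE z in \<mu>. Im (f z) = 0"
  proof (rule real_fun_fourier_zero_imp_zero)
    have eq: "(\<lambda>z. of_real (Im (f z))) = (\<lambda>z. (- \<i> / 2) * (f z - cnj (f z)))" by (auto simp: complex_eq_iff)
    show "L2 \<mu> (\<lambda>z. of_real (Im (f z)))" unfolding eq by (intro L2_scale L2_diff f cnj)
    show "fun_fourier (\<lambda>z. of_real (Im (f z))) n = 0" for n
      unfolding eq fun_fourier_scale by (simp add: fun_fourier_diff f cnj fun_fourier_cnj zero)
  qed
  ultimately show ?thesis by eventually_elim (simp add: complex_eq_iff)
qed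

text \<open>Riesz-Fischer rebuilds some g from the coefficients of f as a limit of partial sums.
  Uniqueness of coefficients identifies g with f, and pairing the partial sums with h gives the
  formula.\<close>

lemma Parseval:
  assumes f: "L2 \<mu> f" and h: "L2 \<mu> h"
  shows "dotp \<mu> f h = dotp (count_space UNIV) (fun_fourier f) (fun_fourier h)"
proof (rule LIMSEQ_unique)
  let ?S = "\<lambda>N. trig {-int N..int N} (fun_fourier f)"
  obtain g where g: "L2 \<mu> g" "fun_fourier g = fun_fourier f"
    and lim: "(\<lambda>N. sqnorm \<mu> (\<lambda>z. ?S N z - g z)) \<longlonglongrightarrow> 0"
    using Riesz_Fischer[OF L2_fun_fourier[OF f]] by blast
  have "AE z in \<mu>. f z - g z = 0"
    using f g by (intro fun_fourier_zero_imp_zero L2_diff) (simp_all add: fun_fourier_diff)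
  then have "dotp \<mu> f h = dotp \<mu> g h"
    using f g(1) h L2_measurable unfolding dotp_def by (intro integral_cong_AE) auto
  then show "(\<lambda>N. dotp \<mu> (?S N) h) \<longlonglongrightarrow> dotp \<mu> f h"
    using dotp_tendsto[OF L2_trig g(1) h lim] by simp
  have "dotp \<mu> (?S N) h = (\<Sum>n\<in>{-int N..int N}. fun_fourier f n \<bullet> fun_fourier h n)" for N
    using h by (subst dotp_commute) (simp add: dotp_trig inner_commute)
  then show "(\<lambda>N. dotp \<mu> (?S N) h) \<longlonglongrightarrow> dotp (count_space UNIV) (fun_fourier f) (fun_fourier h)"
    using symmetric_partial_sums_tendsto[OF L2_integrable_dotp[OF L2_fun_fourier[OF f] L2_fun_fourier[OF h]]]
    by (simp add: dotp_def)
qed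

subsection \<open>The moments of a weight\<close>

text \<open>The weight in the variable r = 1 - t, extended by zero, so that the moments and (C2)
  become integrals over the whole line.\<close>

definition weight_fun :: "(real \<Rightarrow> real) \<Rightarrow> real \<Rightarrow> real" where
  "weight_fun W r = indicator {0..<1} r * W (1 - r)"

lemma weight_fun_nonneg: "is_weight W \<Longrightarrow> 0 \<le> weight_fun W r"
  by (auto simp: weight_fun_def is_weight_def split: split_indicator)

lemma weight_fun_eq_0: "r \<notin> {0..<1} \<Longrightarrow> weight_fun W r = 0"
  by (simp add: weight_fun_def)

lemma integrable_weight_fun:
  assumes "is_weight W"
  shows "integrable lborel (weight_fun W)"
proof -
  have "integrable lborel (\<lambda>t. indicator {0<..1} t *\<^sub>R W t)"
    using assms by (simp add: is_weight_def set_integrable_def)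
  from lborel_integrable_real_affine[OF this, of "-1" 1]
  have "integrable lborel (\<lambda>r. indicator {0<..1} (1 - r) * W (1 - r))" by simp
  moreover have "(\<lambda>r. indicator {0<..1} (1 - r) * W (1 - r)) = weight_fun W"
    by (auto simp: weight_fun_def fun_eq_iff split: split_indicator)
  ultimately show ?thesis by simp
qed

lemma weight_fun_measurable: "is_weight W \<Longrightarrow> weight_fun W \<in> borel_measurable borel"
  using borel_measurable_integrable[OF integrable_weight_fun] by simp

lemma moment_eq: "moment W n = (LBINT r. r ^ n * weight_fun W r)"
  unfolding moment_def set_lebesgue_integral_def weight_fun_def
  by (intro Bochner_Integration.integral_cong) auto

lemma integrable_moment:
  assumes "is_weight W"
  shows "integrable lborel (\<lambda>r. r ^ n * weight_fun W r)"
proof (rule Bochner_Integration.integrable_bound[OF integrable_weight_fun[OF assms]])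
  have "\<bar>r ^ n * weight_fun W r\<bar> \<le> \<bar>weight_fun W r\<bar>" for r
    by (cases "r \<in> {0..<1}")
       (auto simp: weight_fun_eq_0 abs_mult power_abs intro!: mult_left_le_one_le power_le_one)
  then show "AE r in lborel. norm (r ^ n * weight_fun W r) \<le> norm (weight_fun W r)" by simp
qed (use weight_fun_measurable[OF assms] in auto)

lemma moment_nonneg: "is_weight W \<Longrightarrow> 0 \<le> r ^ n * weight_fun W r"
  by (cases "r \<in> {0..<1}") (auto simp: weight_fun_eq_0 weight_fun_nonneg)

lemma moment_antimono:
  assumes "is_weight W" "m \<le> n"
  shows "moment W n \<le> moment W m"
  unfolding moment_eq
proof (rule integral_mono)
  fix r
  show "r ^ n * weight_fun W r \<le> r ^ m * weight_fun W r"
    using assms weight_fun_nonneg[of W r]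
    by (cases "r \<in> {0..<1}") (auto simp: weight_fun_eq_0 intro!: mult_right_mono power_decreasing)
qed (use assms integrable_moment in auto)

lemma cond_C2_weight_fun:
  assumes "is_weight W" "cond_C2 W"
  shows "(\<integral>\<^sup>+r. ennreal (weight_fun W r / (1 - r)) \<partial>lborel) = \<infinity>"
proof -
  have [measurable]: "(\<lambda>t. indicator {0<..1} t * W t) \<in> borel_measurable borel"
    using assms(1) by (simp add: is_weight_def set_integrable_def integrable_iff_bounded)
  have "(\<integral>\<^sup>+t\<in>{0<..1}. ennreal (W t / t) \<partial>lborel) = (\<integral>\<^sup>+t. ennreal ((indicator {0<..1} t * W t) / t) \<partial>lborel)"
    by (intro nn_integral_cong) (auto split: split_indicator)
  also have "\<dots> = (\<integral>\<^sup>+r. ennreal ((indicator {0<..1} (1 - r) * W (1 - r)) / (1 - r)) \<partial>lborel)"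
    by (subst nn_integral_real_affine[where c="-1" and t=1]) auto
  also have "\<dots> = (\<integral>\<^sup>+r. ennreal (weight_fun W r / (1 - r)) \<partial>lborel)"
    by (intro nn_integral_cong) (auto simp: weight_fun_def split: split_indicator)
  finally show ?thesis using assms(2) by (simp add: cond_C2_def)
qed

text \<open>A vanishing moment would force W = 0 almost everywhere, against (C2).\<close>

lemma moment_pos:
  assumes "is_weight W" "cond_C2 W"
  shows "0 < moment W n"
proof (rule ccontr)
  assume "\<not> 0 < moment W n"
  moreover have "0 \<le> moment W n"
    unfolding moment_eq using moment_nonneg[OF assms(1)] by simp
  ultimately have "AE r in lborel. r ^ n * weight_fun W r = 0"
    using integral_nonneg_eq_0_iff_AE[OF integrable_moment[OF assms(1)]] moment_nonneg[OF assms(1)]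
    unfolding moment_eq by simp
  then have "AE r in lborel. weight_fun W r = 0"
    using AE_lborel_singleton[of 0] by eventually_elim auto
  then have "AE r in lborel. ennreal (weight_fun W r / (1 - r)) = 0" by eventually_elim simp
  then have "(\<integral>\<^sup>+r. ennreal (weight_fun W r / (1 - r)) \<partial>lborel) = (\<integral>\<^sup>+(r::real). 0 \<partial>lborel)"
    by (rule nn_integral_cong_AE)
  then show False using cond_C2_weight_fun[OF assms] by simp
qed

text \<open>If W increases, (C3) passes to (1 - r^2) / 2, which is at most 1 - r. If W decreases, 1
  - r^2 \<ge> 1 - r gives the bound with constant 1.\<close>

lemma weight_fun_square_le:
  assumes W: "is_weight W" "cond_C1 W" and c: "\<And>t. t \<in> {0<..<1} \<Longrightarrow> W t \<le> c * W (t / 2)"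
    and r: "0 < r" "r < 1"
  shows "weight_fun W (r\<^sup>2) \<le> max 1 c * weight_fun W r"
proof -
  have r2: "0 < r\<^sup>2" "r\<^sup>2 < r" using r by (auto simp: power2_eq_square)
  have nonneg: "0 \<le> W (1 - r)" using W(1) r by (simp add: is_weight_def)
  have "W (1 - r\<^sup>2) \<le> max 1 c * W (1 - r)"
    using W(2) unfolding cond_C1_def
  proof
    assume mono: "mono_on {0<..1} W"
    have "(1 - s) / 2 \<in> {0<..1}" if "0 < s" "s < 1" for s :: real using that by auto
    from this[OF r2(1) less_trans[OF r2(2) r(2)]] have mem: "(1 - r\<^sup>2) / 2 \<in> {0<..1}" .
    have "W (1 - r\<^sup>2) \<le> c * W ((1 - r\<^sup>2) / 2)" using c[of "1 - r\<^sup>2"] r r2 by simp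
    also have "\<dots> \<le> max 1 c * W ((1 - r\<^sup>2) / 2)"
      using W(1) mem by (intro mult_right_mono) (auto simp: is_weight_def)
    also have "(1 - r\<^sup>2) / 2 \<le> 1 - r"
      using zero_le_power2[of "1 - r"] by (simp add: power2_eq_square field_simps)
    then have "max 1 c * W ((1 - r\<^sup>2) / 2) \<le> max 1 c * W (1 - r)"
      using r mem by (intro mult_left_mono mono_onD[OF mono]) simp_all
    finally show ?thesis .
  next
    assume mono: "antimono_on {0<..1} W"
    have "W (1 - r\<^sup>2) \<le> 1 * W (1 - r)"
      unfolding mult_1 using r r2(2) less_trans[OF r2(2) r(2)] by (intro monotone_onD[OF mono]) auto
    also have "\<dots> \<le> max 1 c * W (1 - r)" using nonneg by (intro mult_right_mono) auto
    finally show ?thesis .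
  qed
  moreover have "r \<in> {0..<1}" "r\<^sup>2 \<in> {0..<1}" using r less_trans[OF r2(2) r(2)] by simp_all
  ultimately show ?thesis by (simp only: weight_fun_def indicator_simps mult_1)
qed

text \<open>Substitute \<open>r\<^sup>2\<close> for \<open>r\<close> in the integral.\<close>

lemma moment_doubling:
  assumes W: "is_weight W" "cond_C1 W" "cond_C3 W"
  obtains q where "1 \<le> q" "q < 4" "\<And>n. moment W n \<le> q * moment W (2 * n)"
proof -
  obtain c where c: "c < 2" "\<And>t. t \<in> {0<..<1} \<Longrightarrow> W t \<le> c * W (t / 2)"
    using W(3) by (auto simp: cond_C3_def)
  define C where "C = max 1 c"
  have C: "1 \<le> C" "C < 2" using c by (auto simp: C_def)
  \<comment> \<open>C comes from the weight and 2 from the Jacobian 2 r, so that c < 2 becomes 2 C <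
    4.\<close>
  have "moment W n \<le> 2 * C * moment W (2 * n)" for n
  proof -
    let ?f = "\<lambda>r. r ^ n * weight_fun W r"
    have int: "set_integrable lborel {power2 0..power2 1} ?f"
      unfolding set_integrable_def by (intro integrable_mult_indicator integrable_moment W) auto
    have der: "\<And>x::real. x \<in> {0..1} \<Longrightarrow> (power2 has_real_derivative 2 * x) (at x)"
      by (auto intro!: derivative_eq_intros)
    have cont: "continuous_on {0..1} (\<lambda>x::real. 2 * x)" by (intro continuous_intros)
    have "moment W n = (LBINT r. ?f r * indicator {0\<^sup>2..1\<^sup>2} r)"
      unfolding moment_eq
      by (intro Bochner_Integration.integral_cong) (auto simp: weight_fun_def split: split_indicator)
    also have "\<dots> = (LBINT r. ?f (r\<^sup>2) * (2 * r) * indicator {0..1} r)"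
      by (rule integral_substitution(2)[where g=power2, OF int der cont]) auto
    also have "\<dots> \<le> (LBINT r. 2 * C * (r ^ (2 * n) * weight_fun W r))"
    proof (rule integral_mono)
      show "integrable lborel (\<lambda>r. ?f (r\<^sup>2) * (2 * r) * indicator {0..1} r)"
        using integral_substitution(1)[where g=power2, OF int der cont]
        by (simp add: set_integrable_def mult_ac)
      fix r :: real
      show "?f (r\<^sup>2) * (2 * r) * indicator {0..1} r \<le> 2 * C * (r ^ (2 * n) * weight_fun W r)"
      proof (cases "0 < r \<and> r < 1")
        case True
        have "?f (r\<^sup>2) * (2 * r) \<le> ?f (r\<^sup>2) * 2"
          using True moment_nonneg[OF W(1)] by (intro mult_left_mono) auto
        also have "\<dots> \<le> r ^ (2 * n) * (C * weight_fun W r) * 2"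
          unfolding power_mult
          using True weight_fun_square_le[OF W(1,2) c(2), of r]
          by (intro mult_right_mono mult_left_mono) (auto simp: C_def)
        finally show ?thesis using True by (simp add: algebra_simps)
      next
        case False
        then show ?thesis using moment_nonneg[OF W(1), of r "2 * n"] C
          by (cases "r = 0 \<or> r = 1") (auto simp: weight_fun_eq_0)
      qed
    qed (intro integrable_mult_right integrable_moment W)
    also have "\<dots> = 2 * C * moment W (2 * n)" by (simp add: moment_eq)
    finally show ?thesis .
  qed
  then show ?thesis using that[of "2 * C"] C by simp
qed

subsection \<open>A Dirichlet form equivalent to the norm of the dual space\<close>

lemma Parseval_nn_integral:
  assumes "L2 \<mu> f"
  shows "(\<integral>\<^sup>+z. nsq (f z) \<partial>\<mu>) = (\<integral>\<^sup>+n. nsq (fun_fourier f n) \<partial>count_space UNIV)"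
  using assms L2_fun_fourier[OF assms] by (simp only: nn_integral_square_eq_dotp Parseval)

lemma L2_rotate:
  assumes f: "L2 \<mu> f" and w: "cmod w = 1"
  shows "L2 \<mu> (\<lambda>z. f (w * z))"
proof -
  have [measurable]: "f \<in> borel_measurable circle_borel" using L2_measurable[OF f] by simp
  note [measurable] = rotation_measurable[OF w]
  have "(\<integral>\<^sup>+z. nsq (f (w * z)) \<partial>\<mu>) = (\<integral>\<^sup>+z. nsq (f z) \<partial>\<mu>)"
    by (rule nn_integral_rotation[OF w]) measurable
  moreover have "(\<lambda>z. f (w * z)) \<in> borel_measurable circle_borel" by measurable
  ultimately show ?thesis using f by (simp add: L2_iff_nn_integral)
qed

lemma fun_fourier_rotate:
  assumes f: "L2 \<mu> f" and w: "cmod w = 1"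
  shows "fun_fourier (\<lambda>z. f (w * z)) n = w powi n * fun_fourier f n"
proof -
  have [measurable]: "f \<in> borel_measurable circle_borel" using L2_measurable[OF f] by simp
  have "w \<noteq> 0" using w by auto
  then have "fun_fourier (\<lambda>z. f (w * z)) n = (LINT z|\<mu>. w powi n * ((w * z) powi (-n) * f (w * z)))"
    unfolding fun_fourier_def
    by (intro Bochner_Integration.integral_cong) (auto simp: power_int_mult_distrib power_int_minus field_simps)
  also have "\<dots> = w powi n * (LINT z|\<mu>. (w * z) powi (-n) * f (w * z))" by simp
  also have "(LINT z|\<mu>. (w * z) powi (-n) * f (w * z)) = fun_fourier f n"
    unfolding fun_fourier_def by (rule integral_rotation[OF w]) measurable
  finally show ?thesis .
qed

text \<open>A jump form: mean square increments under rotation by t, weighted by \<kappa>. Since it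
  sees f only through increments, pointwise bounds between functions pass to it.\<close>

definition dirichlet_form :: "(real \<Rightarrow> ennreal) \<Rightarrow> (complex \<Rightarrow> complex) \<Rightarrow> ennreal" where
  "dirichlet_form \<kappa> f =
     (\<integral>\<^sup>+t. \<kappa> t * (\<integral>\<^sup>+z. nsq (f (cis t * z) - f z) \<partial>\<mu>) \<partial>lborel)"

lemma rotation_difference_fourier:
  assumes f: "L2 \<mu> f"
  shows "(\<integral>\<^sup>+z. nsq (f (cis t * z) - f z) \<partial>\<mu>)
    = (\<integral>\<^sup>+n. nsq (cis (of_int n * t) - 1) * nsq (fun_fourier f n) \<partial>count_space UNIV)"
proof -
  have "fun_fourier (\<lambda>z. f (cis t * z) - f z) n = (cis (of_int n * t) - 1) * fun_fourier f n" for n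
    by (subst fun_fourier_diff[OF L2_rotate[OF f] f])
       (simp_all add: fun_fourier_rotate[OF f] cis_power_int left_diff_distrib)
  then show ?thesis
    by (subst Parseval_nn_integral) (simp_all add: L2_diff L2_rotate f norm_mult power_mult_distrib ennreal_mult)
qed

text \<open>Measurability in t is read off the Fourier side, a countable sum of functions continuous
  in t.\<close>

lemma rotation_difference_measurable:
  assumes f: "L2 \<mu> f"
  shows "(\<lambda>t. \<integral>\<^sup>+z. nsq (f (cis t * z) - f z) \<partial>\<mu>) \<in> borel_measurable borel"
  unfolding rotation_difference_fourier[OF f] nn_integral_bij_count_space[symmetric, OF bij_int_decode]
    nn_integral_count_space_nat by measurable

text \<open>Rotations act diagonally on Fourier coefficients, so by Tonelli the form is given by a
  multiplier.\<close>

lemma dirichlet_form_fourier: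
  assumes f: "L2 \<mu> f" and [measurable]: "\<kappa> \<in> borel_measurable borel"
  shows "dirichlet_form \<kappa> f =
    (\<integral>\<^sup>+n. (\<integral>\<^sup>+t. \<kappa> t * nsq (cis (of_int n * t) - 1) \<partial>lborel) * nsq (fun_fourier f n) \<partial>count_space UNIV)"
proof -
  have "dirichlet_form \<kappa> f = (\<integral>\<^sup>+t. \<integral>\<^sup>+n. \<kappa> t * (nsq (cis (of_int n * t) - 1) * nsq (fun_fourier f n)) \<partial>count_space UNIV \<partial>lborel)"
    unfolding dirichlet_form_def rotation_difference_fourier[OF f] by (simp add: nn_integral_cmult)
  also have "\<dots> = (\<integral>\<^sup>+n. \<integral>\<^sup>+t. \<kappa> t * (nsq (cis (of_int n * t) - 1) * nsq (fun_fourier f n)) \<partial>lborel \<partial>count_space UNIV)"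
    by (rule nn_integral_count_space_nn_integral) (simp, measurable)
  also have "\<dots> = (\<integral>\<^sup>+n. (\<integral>\<^sup>+t. \<kappa> t * nsq (cis (of_int n * t) - 1) \<partial>lborel) * nsq (fun_fourier f n) \<partial>count_space UNIV)"
    by (intro nn_integral_cong) (simp add: nn_integral_multc flip: mult.assoc)
  finally show ?thesis .
qed

lemma norm_cis_diff_one_square: "(cmod (cis x - 1))\<^sup>2 = 2 - 2 * cos x"
  unfolding cmod_power2 using sin_cos_squared_add[of x] by (simp add: power2_eq_square algebra_simps)

lemma norm_cis_diff_one_le: "cmod (cis x - 1) \<le> \<bar>x\<bar>"
proof -
  have "2 - 2 * cos x = 4 * (sin (x / 2))\<^sup>2" using cos_double_sin[of "x / 2"] by simp
  also have "\<dots> \<le> 4 * (x / 2)\<^sup>2"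
    using abs_sin_x_le_abs_x[of "x / 2"] by (intro mult_left_mono abs_le_square_iff[THEN iffD1]) auto
  also have "\<dots> = x\<^sup>2" by (simp add: power2_eq_square)
  finally show ?thesis using norm_cis_diff_one_square[of x]
    by (metis abs_ge_zero power2_abs power2_le_imp_le)
qed

text \<open>B accounts for a contraction and L for a Lipschitz factor multiplied onto it: under
  rotation by t the second term is of size t, and integrability of t^2 against the kernel absorbs
  its square.\<close>

lemma dirichlet_form_contraction:
  assumes f: "L2 \<mu> f" and h: "L2 \<mu> h"
    and [measurable]: "\<kappa> \<in> borel_measurable borel"
    and contr: "\<And>z w. cmod z = 1 \<Longrightarrow> cmod w = 1 \<Longrightarrow>
      cmod (h w - h z) \<le> B * cmod (f w - f z) + L * cmod (w - z) * cmod (f z)"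
    and "0 \<le> B" "0 \<le> L"
    and fin: "dirichlet_form \<kappa> f < \<infinity>" "(\<integral>\<^sup>+t. \<kappa> t * ennreal (t\<^sup>2) \<partial>lborel) < \<infinity>"
  shows "dirichlet_form \<kappa> h < \<infinity>"
proof -
  let ?I = "\<lambda>g t. (\<integral>\<^sup>+z. nsq (g (cis t * z) - g z) \<partial>\<mu>)"
  let ?N = "ennreal (dotp \<mu> f f)"
  have [measurable]: "f \<in> borel_measurable circle_borel" using L2_measurable[OF f] by simp
  have "?I h t \<le> ennreal (2 * B\<^sup>2) * ?I f t + ennreal (2 * L\<^sup>2) * ?N * ennreal (t\<^sup>2)" for t
  proof -
    note [measurable] = rotation_measurable[of "cis t", simplified]
    have "?I h t \<le> (\<integral>\<^sup>+z. ennreal (2 * B\<^sup>2) * nsq (f (cis t * z) - f z) + ennreal (2 * L\<^sup>2 * t\<^sup>2) * nsq (f z) \<partial>\<mu>)"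
    proof (rule nn_integral_mono)
      fix z assume "z \<in> space \<mu>"
      then have z: "cmod z = 1" by simp
      have "cmod (h (cis t * z) - h z) \<le> B * cmod (f (cis t * z) - f z) + L * cmod (cis t * z - z) * cmod (f z)"
        using z by (intro contr) (auto simp: norm_mult)
      also have "cmod (cis t * z - z) = cmod (cis t - 1)"
        using z by (simp add: norm_mult flip: left_diff_distrib[of "cis t" 1 z, simplified])
      also have "B * cmod (f (cis t * z) - f z) + L * cmod (cis t - 1) * cmod (f z)
          \<le> B * cmod (f (cis t * z) - f z) + L * \<bar>t\<bar> * cmod (f z)"
        using assms(6) by (intro add_left_mono mult_right_mono mult_left_mono norm_cis_diff_one_le) auto
      finally have "(cmod (h (cis t * z) - h z))\<^sup>2 \<le> (B * cmod (f (cis t * z) - f z) + L * \<bar>t\<bar> * cmod (f z))\<^sup>2"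
        by (intro power_mono) auto
      also have "\<dots> \<le> 2 * (B * cmod (f (cis t * z) - f z))\<^sup>2 + 2 * (L * \<bar>t\<bar> * cmod (f z))\<^sup>2"
        using sum_squares_bound[of "B * cmod (f (cis t * z) - f z)" "L * \<bar>t\<bar> * cmod (f z)"]
        by (simp add: power2_sum)
      finally have "(cmod (h (cis t * z) - h z))\<^sup>2 \<le> 2 * B\<^sup>2 * (cmod (f (cis t * z) - f z))\<^sup>2 + 2 * L\<^sup>2 * t\<^sup>2 * (cmod (f z))\<^sup>2"
        by (simp add: power_mult_distrib algebra_simps)
      then show "nsq (h (cis t * z) - h z) \<le> ennreal (2 * B\<^sup>2) * nsq (f (cis t * z) - f z) + ennreal (2 * L\<^sup>2 * t\<^sup>2) * nsq (f z)"
        by (simp add: ennreal_leI flip: ennreal_mult ennreal_plus)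
    qed
    also have "\<dots> = ennreal (2 * B\<^sup>2) * ?I f t + ennreal (2 * L\<^sup>2 * t\<^sup>2) * ?N"
      using f by (simp add: nn_integral_add nn_integral_cmult nn_integral_square_eq_dotp)
    also have "ennreal (2 * L\<^sup>2 * t\<^sup>2) * ?N = ennreal (2 * L\<^sup>2) * ?N * ennreal (t\<^sup>2)"
      by (simp add: ennreal_mult mult_ac)
    finally show ?thesis .
  qed
  then have "dirichlet_form \<kappa> h \<le> (\<integral>\<^sup>+t. \<kappa> t * (ennreal (2 * B\<^sup>2) * ?I f t + ennreal (2 * L\<^sup>2) * ?N * ennreal (t\<^sup>2)) \<partial>lborel)"
    unfolding dirichlet_form_def by (intro nn_integral_mono mult_left_mono) auto
  also have "\<dots> = (\<integral>\<^sup>+t. ennreal (2 * B\<^sup>2) * (\<kappa> t * ?I f t) + ennreal (2 * L\<^sup>2) * ?N * (\<kappa> t * ennreal (t\<^sup>2)) \<partial>lborel)"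
    by (intro nn_integral_cong) (simp add: algebra_simps)
  also have "\<dots> = ennreal (2 * B\<^sup>2) * dirichlet_form \<kappa> f + ennreal (2 * L\<^sup>2) * ?N * (\<integral>\<^sup>+t. \<kappa> t * ennreal (t\<^sup>2) \<partial>lborel)"
  proof -
    have "(\<lambda>t. ?I f t) \<in> borel_measurable lborel"
      using rotation_difference_measurable[OF f] by simp
    then show ?thesis
      unfolding dirichlet_form_def by (subst nn_integral_add) (auto simp: nn_integral_cmult)
  qed
  also have "\<dots> < \<infinity>" using fin by (auto simp: ennreal_mult_less_top)
  finally show ?thesis .
qed


section \<open>A jump kernel adapted to a doubling weight\<close>

locale doubling_weight =
  fixes \<Omega> :: "nat \<Rightarrow> real" and q :: real
  assumes pos: "0 < \<Omega> n" and mono: "m \<le> n \<Longrightarrow> \<Omega> m \<le> \<Omega> n"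
    and doubling: "\<Omega> (2 * n) \<le> q * \<Omega> n" and q: "1 \<le> q" "q < 4"
begin

lemma doubling_power: "\<Omega> (2 ^ (i + j)) \<le> q ^ i * \<Omega> (2 ^ j)"
proof (induction i)
  case (Suc i)
  have "\<Omega> (2 ^ (Suc i + j)) \<le> q * \<Omega> (2 ^ (i + j))" using doubling[of "2 ^ (i + j)"] by simp
  also have "\<dots> \<le> q * (q ^ i * \<Omega> (2 ^ j))" using Suc q by (intro mult_left_mono) auto
  finally show ?case by simp
qed simp

text \<open>Dyadic increments of \<Omega>, started at \<Omega> 1 so that they telescope to \<Omega>
  (2^J).\<close>

definition jump :: "nat \<Rightarrow> real" where
  "jump j = (case j of 0 \<Rightarrow> \<Omega> 1 | Suc i \<Rightarrow> \<Omega> (2 ^ Suc i) - \<Omega> (2 ^ i))"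

lemma jump_nonneg: "0 \<le> jump j"
  using pos[of 1] mono[of "2 ^ (j - 1)" "2 ^ j"] by (auto simp: jump_def split: nat.split)

lemma jump_le: "jump j \<le> \<Omega> (2 ^ j)"
  using less_imp_le[OF pos] by (auto simp: jump_def split: nat.split)

lemma sum_jump: "(\<Sum>j\<le>J. jump j) = \<Omega> (2 ^ J)"
  by (induction J) (auto simp: jump_def)

text \<open>A superposition of uniform distributions on [0, 2/2^j], each of mass
  \<open>jump j\<close>. The j-th piece detects the frequencies |n| \<ge> 2^j: the length 2/2^j
  makes the mean of |cis (n t) - 1|^2 over the interval at least 1 for these n.\<close>

definition kernel :: "real \<Rightarrow> ennreal" where
  "kernel t = (\<Sum>j. ennreal (jump j * 2 ^ j / 2) * indicator {0..2 / 2 ^ j} t)"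

lemma kernel_measurable [measurable]: "kernel \<in> borel_measurable borel"
  unfolding kernel_def by measurable

lemma nn_integral_kernel:
  assumes [measurable]: "g \<in> borel_measurable borel"
  shows "(\<integral>\<^sup>+t. kernel t * g t \<partial>lborel) = (\<Sum>j. ennreal (jump j * 2 ^ j / 2) * (\<integral>\<^sup>+t\<in>{0..2 / 2 ^ j}. g t \<partial>lborel))"
proof -
  have "(\<integral>\<^sup>+t. kernel t * g t \<partial>lborel) = (\<integral>\<^sup>+t. (\<Sum>j. ennreal (jump j * 2 ^ j / 2) * (g t * indicator {0..2 / 2 ^ j} t)) \<partial>lborel)"
    unfolding kernel_def by (simp add: mult_ac flip: ennreal_suminf_multc)
  also have "\<dots> = (\<Sum>j. \<integral>\<^sup>+t. ennreal (jump j * 2 ^ j / 2) * (g t * indicator {0..2 / 2 ^ j} t) \<partial>lborel)"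
    by (intro nn_integral_suminf) measurable
  finally show ?thesis by (simp add: nn_integral_cmult)
qed

lemma kernel_term_le:
  fixes g :: "real \<Rightarrow> real"
  assumes "\<And>t. 0 \<le> t \<Longrightarrow> t \<le> 2 / 2 ^ j \<Longrightarrow> g t \<le> c" "0 \<le> c"
  shows "ennreal (jump j * 2 ^ j / 2) * (\<integral>\<^sup>+t\<in>{0..2 / 2 ^ j}. ennreal (g t) \<partial>lborel) \<le> ennreal (jump j * c)"
proof -
  have "(\<integral>\<^sup>+t\<in>{0..2 / 2 ^ j}. ennreal (g t) \<partial>lborel) \<le> (\<integral>\<^sup>+t. ennreal c * indicator {0..2 / 2 ^ j :: real} t \<partial>lborel)"
    by (intro nn_integral_mono) (auto split: split_indicator intro!: ennreal_leI assms)
  also have "\<dots> = ennreal (c * (2 / 2 ^ j))"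
    using assms by (simp add: nn_integral_cmult flip: ennreal_mult)
  finally have "ennreal (jump j * 2 ^ j / 2) * (\<integral>\<^sup>+t\<in>{0..2 / 2 ^ j}. ennreal (g t) \<partial>lborel)
      \<le> ennreal (jump j * 2 ^ j / 2) * ennreal (c * (2 / 2 ^ j))" by (rule mult_left_mono) simp
  also have "\<dots> = ennreal (jump j * c)"
    using assms jump_nonneg[of j] by (simp add: field_simps flip: ennreal_mult)
  finally show ?thesis .
qed

text \<open>\<open>jump j\<close> grows at most like q^j while t^2 is at most 4/4^j on the j-th
  interval; the resulting series converges because q < 4.\<close>

lemma kernel_square_finite: "(\<integral>\<^sup>+t. kernel t * ennreal (t\<^sup>2) \<partial>lborel) < \<infinity>"
proof -
  have sm: "summable (\<lambda>j. 4 * \<Omega> 1 * (q / 4) ^ j)" using q by (intro summable_mult summable_geometric) auto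
  have "(\<integral>\<^sup>+t. kernel t * ennreal (t\<^sup>2) \<partial>lborel) \<le> (\<Sum>j. ennreal (4 * \<Omega> 1 * (q / 4) ^ j))"
  proof (subst nn_integral_kernel, measurable, intro suminf_le)
    fix j
    have "ennreal (jump j * 2 ^ j / 2) * (\<integral>\<^sup>+t\<in>{0..2 / 2 ^ j}. ennreal (t\<^sup>2) \<partial>lborel) \<le> ennreal (jump j * (2 / 2 ^ j)\<^sup>2)"
      by (intro kernel_term_le power_mono) auto
    also have "\<dots> \<le> ennreal (4 * \<Omega> 1 * (q / 4) ^ j)"
    proof (rule ennreal_leI)
      have "jump j * (2 / 2 ^ j)\<^sup>2 \<le> (q ^ j * \<Omega> 1) * (2 / 2 ^ j)\<^sup>2"
        using jump_le[of j] doubling_power[of j 0] by (intro mult_right_mono) auto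
      also have eq: "(2 / 2 ^ j :: real)\<^sup>2 = 4 / 4 ^ j"
        by (simp add: power_divide power2_eq_square flip: power_mult_distrib)
      also have "q ^ j * \<Omega> 1 * (4 / 4 ^ j) = 4 * \<Omega> 1 * (q / 4) ^ j"
        by (simp add: power_divide)
      finally show "jump j * (2 / 2 ^ j)\<^sup>2 \<le> 4 * \<Omega> 1 * (q / 4) ^ j"
        unfolding eq .
    qed
    finally show "ennreal (jump j * 2 ^ j / 2) * (\<integral>\<^sup>+t\<in>{0..2 / 2 ^ j}. ennreal (t\<^sup>2) \<partial>lborel) \<le> ennreal (4 * \<Omega> 1 * (q / 4) ^ j)" .
  qed auto
  also have "\<dots> = ennreal (\<Sum>j. 4 * \<Omega> 1 * (q / 4) ^ j)"
    using q pos[of 1] sm by (intro suminf_ennreal2) auto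
  finally show ?thesis by (auto simp: top_unique less_top[symmetric])
qed

text \<open>The Fourier multiplier of the form with this kernel; two-sided comparison with \<Omega>
  is what makes the form equivalent to the norm.\<close>

definition symbol :: "int \<Rightarrow> ennreal" where
  "symbol n = (\<integral>\<^sup>+t. kernel t * nsq (cis (of_int n * t) - 1) \<partial>lborel)"

lemma symbol_eq:
  "symbol n = (\<Sum>j. ennreal (jump j * 2 ^ j / 2) * (\<integral>\<^sup>+t\<in>{0..2 / 2 ^ j}. nsq (cis (of_int n * t) - 1) \<partial>lborel))"
  unfolding symbol_def by (intro nn_integral_kernel) measurable

text \<open>Only the scales 2^j \<le> |n| are kept. Each contributes at least \<open>jump j\<close>,
  the sum telescopes to \<Omega> (2^J), and one doubling from 2^J passes |n| at the cost of
  q.\<close>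

lemma symbol_ge:
  assumes "n \<noteq> 0"
  shows "ennreal (\<Omega> (nat \<bar>n\<bar>)) \<le> ennreal q * symbol n"
proof -
  define N where "N = nat \<bar>n\<bar>"
  have N: "1 \<le> N" "real N = \<bar>real_of_int n\<bar>" using assms by (auto simp: N_def)
  obtain J where J: "2 ^ J \<le> N" "N < 2 ^ (J + 1)" using ex_power_ivl1[of 2 N] N by auto
  let ?T = "\<lambda>j. ennreal (jump j * 2 ^ j / 2) * (\<integral>\<^sup>+t\<in>{0..2 / 2 ^ j}. nsq (cis (of_int n * t) - 1) \<partial>lborel)"
  have T: "ennreal (jump j) \<le> ?T j" if "j \<le> J" for j
  proof -
    define h :: real where "h = 2 / 2 ^ j"
    have "h > 0" by (simp add: h_def)
    have "(2::nat) ^ j \<le> 2 ^ J" using that by simp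
    then have "real (2 ^ j) \<le> real N" using J(1) by (intro of_nat_mono) linarith
    then have hN: "2 / real N \<le> h" using N(1) by (simp add: h_def field_simps)
    have "(\<integral>\<^sup>+t. ennreal (2 - 2 * cos (of_int n * t)) * indicator {0..h} t \<partial>lborel)
        = ennreal ((2 * h - 2 * sin (of_int n * h) / of_int n) - (2 * 0 - 2 * sin (of_int n * 0) / of_int n))"
      using assms \<open>h > 0\<close> by (intro nn_integral_FTC_Icc) (auto intro!: derivative_eq_intros simp: field_simps)
    \<comment> \<open>The sine term is at most 2 / |n|, which is at most h for the scales
      considered.\<close>
    moreover have "h \<le> 2 * h - 2 * sin (of_int n * h) / of_int n"
    proof -
      have "\<bar>2 * sin (of_int n * h) / real_of_int n\<bar> \<le> 2 / real N"
        unfolding N(2) using N(1) by (simp add: abs_mult divide_right_mono)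
      then show ?thesis using hN by linarith
    qed
    ultimately have "ennreal h \<le> (\<integral>\<^sup>+t\<in>{0..h}. nsq (cis (of_int n * t) - 1) \<partial>lborel)"
      by (simp add: norm_cis_diff_one_square ennreal_leI)
    then have "ennreal (jump j * 2 ^ j / 2) * ennreal h \<le> ?T j" unfolding h_def by (intro mult_left_mono) auto
    moreover have "ennreal (jump j * 2 ^ j / 2) * ennreal h = ennreal (jump j * 2 ^ j / 2 * h)"
      using jump_nonneg[of j] \<open>h > 0\<close> by (intro ennreal_mult[symmetric]) auto
    moreover have "jump j * 2 ^ j / 2 * h = jump j" by (simp add: h_def)
    ultimately show ?thesis by (simp only:)
  qed
  have "\<Omega> N \<le> q * \<Omega> (2 ^ J)" using mono[of N "2 ^ (J + 1)"] J(2) doubling[of "2 ^ J"] by simp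
  then have "ennreal (\<Omega> N) \<le> ennreal q * ennreal (\<Omega> (2 ^ J))" using q pos[of "2 ^ J"] by (simp add: ennreal_leI flip: ennreal_mult)
  also have "ennreal (\<Omega> (2 ^ J)) = (\<Sum>j\<le>J. ennreal (jump j))" by (simp add: jump_nonneg flip: sum_jump)
  also have "\<dots> \<le> (\<Sum>j\<le>J. ?T j)" by (intro sum_mono T) auto
  also have "\<dots> \<le> symbol n" unfolding symbol_eq by (intro sum_le_suminf) auto
  finally show ?thesis by (simp add: N_def mult_left_mono)
qed

text \<open>The 4 bounds |cis x - 1|^2 at the scales up to |n|; the other term is the sum of the
  series of ratio q / 4 over the finer scales.\<close>

definition symbol_bound :: real where "symbol_bound = 4 + 4 * q / (1 - q / 4)"

text \<open>At scales 2^j \<le> |n| the squared increments are bounded by 4 and the jumps telescope.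
  At finer scales |cis x - 1| \<le> |x| gains a factor 4 per scale, against a growth of the jumps by
  q.\<close>

lemma symbol_le: "symbol n \<le> ennreal (symbol_bound * \<Omega> (nat \<bar>n\<bar>))"
proof (cases "n = 0")
  case True
  then show ?thesis by (simp add: symbol_def)
next
  case False
  define N where "N = nat \<bar>n\<bar>"
  have N: "1 \<le> N" "real N = \<bar>real_of_int n\<bar>" using False by (auto simp: N_def)
  obtain J where J: "2 ^ J \<le> N" "N < 2 ^ (J + 1)" using ex_power_ivl1[of 2 N] N by auto
  let ?T = "\<lambda>j. ennreal (jump j * 2 ^ j / 2) * (\<integral>\<^sup>+t\<in>{0..2 / 2 ^ j}. nsq (cis (of_int n * t) - 1) \<partial>lborel)"
  define b where "b j = (if j < Suc J then 4 * jump j else 4 * q * \<Omega> N * (q / 4) ^ (j - Suc J))" for j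
  have b_nonneg: "0 \<le> b j" for j using jump_nonneg[of j] pos[of N] q by (simp add: b_def)
  have T: "?T j \<le> ennreal (b j)" for j
  proof (cases "j < Suc J")
    case True
    have "?T j \<le> ennreal (jump j * 4)"
    proof (rule kernel_term_le)
      show "(cmod (cis (real_of_int n * t) - 1))\<^sup>2 \<le> 4" for t
        unfolding norm_cis_diff_one_square using cos_ge_minus_one[of "real_of_int n * t"] by linarith
    qed simp
    then show ?thesis using True by (simp add: b_def mult.commute)
  next
    case False
    then obtain i where i: "j = i + Suc J" by (metis add.commute less_iff_Suc_add le_Suc_ex not_less)
    have "?T j \<le> ennreal (jump j * (real N * (2 / 2 ^ j))\<^sup>2)"
    proof (rule kernel_term_le)
      fix t :: real assume "0 \<le> t" "t \<le> 2 / 2 ^ j"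
      then have "cmod (cis (real_of_int n * t) - 1) \<le> real N * (2 / 2 ^ j)"
        using norm_cis_diff_one_le[of "real_of_int n * t"] mult_left_mono[of t "2 / 2 ^ j" "real N"]
        by (simp add: abs_mult N(2))
      then show "(cmod (cis (real_of_int n * t) - 1))\<^sup>2 \<le> (real N * (2 / 2 ^ j))\<^sup>2" by (intro power_mono) auto
    qed simp
    also have "jump j * (real N * (2 / 2 ^ j))\<^sup>2 \<le> (q ^ Suc i * \<Omega> N) * (2 ^ Suc J * (2 / 2 ^ j))\<^sup>2"
    proof (rule mult_mono)
      have "jump j \<le> \<Omega> (2 ^ (Suc i + J))" using jump_le[of j] by (simp add: i)
      also have "\<dots> \<le> q ^ Suc i * \<Omega> (2 ^ J)" by (rule doubling_power)
      also have "\<dots> \<le> q ^ Suc i * \<Omega> N" using q by (intro mult_left_mono mono J) auto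
      finally show "jump j \<le> q ^ Suc i * \<Omega> N" .
      have "real N \<le> real (2 ^ Suc J)" using J(2) by (intro of_nat_mono) simp
      then show "(real N * (2 / 2 ^ j))\<^sup>2 \<le> (2 ^ Suc J * (2 / 2 ^ j))\<^sup>2"
        by (intro power_mono mult_right_mono) auto
      show "0 \<le> q ^ Suc i * \<Omega> N" using q pos[of N] by simp
    qed simp
    also have "(2 ^ Suc J * (2 / 2 ^ j))\<^sup>2 = (4 / 4 ^ i :: real)"
      by (simp add: i power_add power_divide power2_eq_square flip: power_mult_distrib)
    also have "q ^ Suc i * \<Omega> N * (4 / 4 ^ i) = b j" by (simp add: b_def i power_divide)
    finally show ?thesis by (simp add: ennreal_leI)
  qed
  have g: "(\<lambda>i. (q / 4) ^ i) sums (1 / (1 - q / 4))" using q by (intro geometric_sums) auto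
  have "(\<lambda>i. b (i + Suc J)) sums (4 * q * \<Omega> N * (1 / (1 - q / 4)))"
    using sums_mult[OF g, of "4 * q * \<Omega> N"] by (simp add: b_def)
  then have "b sums (4 * q * \<Omega> N * (1 / (1 - q / 4)) + (\<Sum>j<Suc J. b j))"
    by (simp only: sums_iff_shift)
  moreover have "(\<Sum>j<Suc J. b j) = 4 * \<Omega> (2 ^ J)"
    by (simp add: b_def lessThan_Suc_atMost sum_jump flip: sum_distrib_left)
  ultimately have sums: "b sums (4 * q * \<Omega> N * (1 / (1 - q / 4)) + 4 * \<Omega> (2 ^ J))" by simp
  have "symbol n \<le> (\<Sum>j. ennreal (b j))" unfolding symbol_eq by (intro suminf_le T) auto
  also have "\<dots> = ennreal (4 * q * \<Omega> N * (1 / (1 - q / 4)) + 4 * \<Omega> (2 ^ J))"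
    using sums b_nonneg by (subst suminf_ennreal2) (auto simp: sums_iff)
  also have "\<dots> \<le> ennreal (symbol_bound * \<Omega> N)"
    using mono[OF J(1)] by (intro ennreal_leI) (simp add: symbol_bound_def algebra_simps)
  finally show ?thesis by (simp add: N_def)
qed

definition norm2 :: "(complex \<Rightarrow> complex) \<Rightarrow> ennreal" where
  "norm2 f = (\<integral>\<^sup>+n. ennreal (\<Omega> (nat \<bar>n\<bar>)) * nsq (fun_fourier f n) \<partial>count_space UNIV)"

text \<open>\<open>symbol\<close> and \<Omega> are comparable except at n = 0, where the symbol
  vanishes; \<Omega> 0 times the squared L2-norm makes up for it.\<close>

lemma norm2_finite_iff:
  assumes f: "L2 \<mu> f"
  shows "norm2 f < \<infinity> \<longleftrightarrow> dirichlet_form kernel f < \<infinity>"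
proof
  have form: "dirichlet_form kernel f = (\<integral>\<^sup>+n. symbol n * nsq (fun_fourier f n) \<partial>count_space UNIV)"
    unfolding symbol_def by (rule dirichlet_form_fourier[OF f]) measurable
  {
    assume fin: "norm2 f < \<infinity>"
    have "dirichlet_form kernel f \<le> (\<integral>\<^sup>+n. ennreal symbol_bound * (ennreal (\<Omega> (nat \<bar>n\<bar>)) * nsq (fun_fourier f n)) \<partial>count_space UNIV)"
      unfolding form
    proof (rule nn_integral_mono)
      fix n :: int
      have "0 \<le> symbol_bound" using q by (simp add: symbol_bound_def)
      then have "symbol n \<le> ennreal symbol_bound * ennreal (\<Omega> (nat \<bar>n\<bar>))"
        using symbol_le[of n] less_imp_le[OF pos] by (simp add: ennreal_mult)
      then show "symbol n * nsq (fun_fourier f n) \<le> ennreal symbol_bound * (ennreal (\<Omega> (nat \<bar>n\<bar>)) * nsq (fun_fourier f n))"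
        unfolding mult.assoc[symmetric] by (rule mult_right_mono) simp
    qed
    also have "\<dots> = ennreal symbol_bound * norm2 f" by (simp add: norm2_def nn_integral_cmult)
    also have "\<dots> < \<infinity>" using fin by (simp add: ennreal_mult_less_top)
    finally show "dirichlet_form kernel f < \<infinity>" .
  }
  {
    assume fin: "dirichlet_form kernel f < \<infinity>"
    have "norm2 f \<le> (\<integral>\<^sup>+n. ennreal (\<Omega> 0) * nsq (fun_fourier f n) + ennreal q * (symbol n * nsq (fun_fourier f n)) \<partial>count_space UNIV)"
      unfolding norm2_def
    proof (rule nn_integral_mono)
      fix n :: int
      have "ennreal (\<Omega> (nat \<bar>n\<bar>)) \<le> ennreal (\<Omega> 0) + ennreal q * symbol n"
        using symbol_ge[of n] by (cases "n = 0") (auto simp: add_increasing add_increasing2)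
      then have "ennreal (\<Omega> (nat \<bar>n\<bar>)) * nsq (fun_fourier f n) \<le> (ennreal (\<Omega> 0) + ennreal q * symbol n) * nsq (fun_fourier f n)"
        by (rule mult_right_mono) simp
      then show "ennreal (\<Omega> (nat \<bar>n\<bar>)) * nsq (fun_fourier f n) \<le> ennreal (\<Omega> 0) * nsq (fun_fourier f n) + ennreal q * (symbol n * nsq (fun_fourier f n))"
        by (simp only: distrib_right mult.assoc)
    qed
    also have "\<dots> = ennreal (\<Omega> 0) * ennreal (dotp \<mu> f f) + ennreal q * dirichlet_form kernel f"
      unfolding form nn_integral_square_eq_dotp[OF f, symmetric] Parseval_nn_integral[OF f]
      by (simp add: nn_integral_add nn_integral_cmult)
    also have "\<dots> < \<infinity>" using fin by (simp add: ennreal_mult_less_top)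
    finally show "norm2 f < \<infinity>" .
  }
qed

lemma in_ell2_iff: "in_ell2 \<Omega> f \<longleftrightarrow> L2 \<mu> f \<and> norm2 f < \<infinity>"
proof -
  have "(\<lambda>n::int. (cmod (fun_fourier f n))\<^sup>2 * \<Omega> (nat \<bar>n\<bar>)) summable_on UNIV \<longleftrightarrow> norm2 f < \<infinity>"
    unfolding integrable_count_space_iff_summable_on[symmetric] integrable_iff_bounded norm2_def
    using less_imp_le[OF pos] by (simp add: abs_mult ennreal_mult mult.commute)
  then show ?thesis by (simp add: in_ell2_def in_L2_iff)
qed

text \<open>Makes the dual space stable under taking positive parts and under multiplication by
  bounded Lipschitz functions, the two operations applied to its elements.\<close>

lemma in_ell2_contraction:
  assumes f: "in_ell2 \<Omega> f" and h: "L2 \<mu> h"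
    and contr: "\<And>z w. cmod z = 1 \<Longrightarrow> cmod w = 1 \<Longrightarrow>
      cmod (h w - h z) \<le> B * cmod (f w - f z) + L * cmod (w - z) * cmod (f z)"
    and "0 \<le> B" "0 \<le> L"
  shows "in_ell2 \<Omega> h"
proof -
  have f': "L2 \<mu> f" using f by (simp add: in_ell2_iff)
  have "dirichlet_form kernel f < \<infinity>" using f unfolding in_ell2_iff by (metis norm2_finite_iff)
  then have "dirichlet_form kernel h < \<infinity>"
    by (intro dirichlet_form_contraction[OF f' h kernel_measurable _ assms(4,5) _ kernel_square_finite] contr)
  then show ?thesis using norm2_finite_iff[OF h] h by (simp add: in_ell2_iff)
qed

end

lemma of_real_measurable:
  "f \<in> borel_measurable M \<Longrightarrow> (\<lambda>x. complex_of_real (f x)) \<in> borel_measurable M"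
  by measurable

lemma one_divide_ennreal: "0 < x \<Longrightarrow> 1 / ennreal x = ennreal (1 / x)"
  using divide_ennreal[of 1 x] by simp

lemma one_divide_antimono_ennreal:
  fixes a b :: ennreal
  assumes "a \<le> b"
  shows "1 / b \<le> 1 / a"
proof (cases "a = 0 \<or> b = \<infinity>")
  case False
  then obtain x y where "a = ennreal x" "b = ennreal y" "0 < x" "0 < y" "x \<le> y"
    using assms by (cases a; cases b) (auto simp: top_unique ennreal_le_iff less_le)
  then show ?thesis by (simp add: one_divide_ennreal ennreal_leI frac_le)
qed (auto simp: divide_ennreal_def)

lemma nn_integral_count_space_le_UNIV:
  "(\<integral>\<^sup>+x. f x \<partial>count_space X) \<le> (\<integral>\<^sup>+x. f x \<partial>count_space UNIV)"
proof -
  have "(\<integral>\<^sup>+x. f x \<partial>count_space X) = (\<integral>\<^sup>+x. f x * indicator X x \<partial>count_space UNIV)"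
    by (rule nn_integral_count_space_indicator) (simp add: NO_MATCH_def)
  also have "\<dots> \<le> (\<integral>\<^sup>+x. f x \<partial>count_space UNIV)"
    by (intro nn_integral_mono) (auto split: split_indicator)
  finally show ?thesis .
qed

subsection \<open>Convolution of a function and a measure\<close>

text \<open>On the circle \<open>cnj w\<close> is the inverse of w, so this is convolution on the
  circle group.\<close>

definition conv :: "(complex \<Rightarrow> real) \<Rightarrow> complex measure \<Rightarrow> complex \<Rightarrow> real" where
  "conv \<phi> M z = (LINT w|M. \<phi> (z * cnj w))"

context
  fixes M :: "complex measure" and \<phi> :: "complex \<Rightarrow> real" and B :: real
  assumes fin: "finite_measure M" and sets_M: "sets M = sets circle_borel"
    and meas: "\<phi> \<in> borel_measurable borel"
    and bound: "\<And>z. cmod z = 1 \<Longrightarrow> 0 \<le> \<phi> z" "\<And>z. cmod z = 1 \<Longrightarrow> \<phi> z \<le> B"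
begin

lemma space_circle_sets: "space M = unit_circle"
  using sets_eq_imp_space_eq[OF sets_M] by simp

lemma conv_kernel_measurable:
  "(\<lambda>(z, w). \<phi> (z * cnj w)) \<in> borel_measurable (\<mu> \<Otimes>\<^sub>M M)"
proof -
  have 1: "(\<lambda>z. z) \<in> borel_measurable \<mu>" and 2: "cnj \<in> borel_measurable M"
    unfolding borel_measurable_circle_eq[OF sets_M] borel_measurable_circle_eq[OF sets_circle_measure]
    by (intro circle_borel_measurable_continuous continuous_intros)+
  have "(\<lambda>p. fst p * cnj (snd p)) \<in> borel_measurable (\<mu> \<Otimes>\<^sub>M M)"
    using measurable_compose[OF measurable_fst 1] measurable_compose[OF measurable_snd 2]
    by (intro borel_measurable_times)
  from measurable_compose[OF this meas] show ?thesis by (simp add: case_prod_beta)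
qed

lemma conv_measurable: "conv \<phi> M \<in> borel_measurable circle_borel"
proof -
  interpret M: finite_measure M by (rule fin)
  have "conv \<phi> M \<in> borel_measurable \<mu>"
    unfolding conv_def
    using M.borel_measurable_lebesgue_integral[OF conv_kernel_measurable] by simp
  then show ?thesis by (simp add: borel_measurable_circle_eq[OF sets_circle_measure])
qed

lemma conv_integrable:
  assumes "cmod z = 1"
  shows "integrable M (\<lambda>w. \<phi> (z * cnj w))"
proof (rule circle_integrable_bounded[OF fin sets_M])
  show "(\<lambda>w. \<phi> (z * cnj w)) \<in> borel_measurable circle_borel"
    by (rule measurable_compose[OF _ meas]) (intro circle_borel_measurable_continuous continuous_intros)
  show "norm (\<phi> (z * cnj w)) \<le> B" if "cmod w = 1" for w
    using bound[of "z * cnj w"] assms that by (simp add: norm_mult)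
qed

lemma conv_nonneg: "cmod z = 1 \<Longrightarrow> 0 \<le> conv \<phi> M z"
  unfolding conv_def using space_circle_sets
  by (intro integral_nonneg_AE AE_I2) (auto intro!: bound simp: norm_mult)

lemma conv_le:
  assumes "cmod z = 1"
  shows "conv \<phi> M z \<le> B * measure M unit_circle"
proof -
  interpret M: finite_measure M by (rule fin)
  have "conv \<phi> M z \<le> (LINT w|M. B)"
    unfolding conv_def using space_circle_sets assms
    by (intro integral_mono conv_integrable) (auto intro!: bound simp: norm_mult)
  then show ?thesis by (simp add: space_circle_sets mult.commute)
qed

lemma L2_conv: "L2 \<mu> (\<lambda>z. of_real (conv \<phi> M z))"
  using conv_measurable conv_nonneg conv_le
  by (intro L2_bounded[where B="B * measure M unit_circle"]) (auto intro!: of_real_measurable)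

text \<open>After Fubini, rotating z by w separates the two factors.\<close>

lemma fun_fourier_conv:
  "fun_fourier (\<lambda>z. of_real (conv \<phi> M z)) n = fun_fourier (\<lambda>z. of_real (\<phi> z)) n * measure_fourier M n"
proof -
  interpret M: finite_measure M by (rule fin)
  interpret P: pair_sigma_finite \<mu> M ..
  interpret PM: finite_measure "\<mu> \<Otimes>\<^sub>M M" by (rule finite_measure_pair_measure) unfold_locales
  have meas\<phi>: "(\<lambda>z. complex_of_real (\<phi> z)) \<in> borel_measurable circle_borel"
    by (rule of_real_measurable[OF circle_borel_measurable_borel[OF meas]])
  let ?F = "\<lambda>z w. z powi (-n) * of_real (\<phi> (z * cnj w))"
  have "fun_fourier (\<lambda>z. of_real (conv \<phi> M z)) n = (LINT z|\<mu>. LINT w|M. ?F z w)"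
    unfolding fun_fourier_def conv_def by (intro Bochner_Integration.integral_cong) simp_all
  also have "\<dots> = (LINT w|M. LINT z|\<mu>. ?F z w)"
  proof (rule P.Fubini_integral[symmetric])
    have 1: "(\<lambda>z. z powi (-n)) \<in> borel_measurable \<mu>"
      unfolding borel_measurable_circle_eq[OF sets_circle_measure] by (rule power_int_measurable)
    have "(\<lambda>(z, w). ?F z w) \<in> borel_measurable (\<mu> \<Otimes>\<^sub>M M)"
      using measurable_compose[OF measurable_fst 1] of_real_measurable[OF conv_kernel_measurable]
      unfolding case_prod_beta by (intro borel_measurable_times) auto
    moreover have "AE p in \<mu> \<Otimes>\<^sub>M M. norm ((\<lambda>(z, w). ?F z w) p) \<le> B"
    proof (rule AE_I2)
      fix p assume "p \<in> space (\<mu> \<Otimes>\<^sub>M M)"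
      then have "cmod (fst p) = 1" "cmod (snd p) = 1"
        by (auto simp: space_pair_measure space_circle_sets)
      then show "norm ((\<lambda>(z, w). ?F z w) p) \<le> B"
        using bound[of "fst p * cnj (snd p)"]
        by (simp add: case_prod_beta norm_mult norm_power_int_circle)
    qed
    ultimately show "integrable (\<mu> \<Otimes>\<^sub>M M) (\<lambda>(z, w). ?F z w)"
      by (intro PM.integrable_const_bound)
  qed
  also have "\<dots> = (LINT w|M. w powi (-n) * fun_fourier (\<lambda>z. of_real (\<phi> z)) n)"
  proof (rule Bochner_Integration.integral_cong)
    fix w assume "w \<in> space M"
    then have w: "cmod w = 1" by (simp add: space_circle_sets)
    then have ww: "w * cnj w = 1" using complex_norm_square[of w] by simp
    have "(LINT z|\<mu>. ?F z w) = (LINT z|\<mu>. ?F (w * z) w)"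
    proof (rule integral_rotation[OF w, symmetric])
      have "(\<lambda>z. \<phi> (z * cnj w)) \<in> borel_measurable circle_borel"
        by (rule measurable_compose[OF _ meas]) (intro circle_borel_measurable_continuous continuous_intros)
      then show "(\<lambda>z. ?F z w) \<in> borel_measurable circle_borel"
        by (intro borel_measurable_times power_int_measurable of_real_measurable)
    qed
    also have "(\<lambda>z. ?F (w * z) w) = (\<lambda>z. w powi (-n) * (z powi (-n) * of_real (\<phi> z)))"
      using ww by (auto simp: power_int_mult_distrib mult_ac simp flip: mult.assoc[of z w "cnj w" for z])
    finally show "(LINT z|\<mu>. ?F z w) = w powi (-n) * fun_fourier (\<lambda>z. of_real (\<phi> z)) n"
      by (simp add: fun_fourier_def)
  qed simp
  finally show ?thesis by (simp add: measure_fourier_def mult.commute)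
qed

end

lemma power_int_measurable':
  "sets M = sets circle_borel \<Longrightarrow> (\<lambda>z. z powi n) \<in> borel_measurable M"
  by (subst borel_measurable_circle_eq) (assumption, rule power_int_measurable)

subsection \<open>Densities as measures\<close>

lemma energy_eq:
  "energy \<omega> M = (\<integral>\<^sup>+n. ennreal (\<omega> (nat \<bar>n\<bar>) * (cmod (measure_fourier M n))\<^sup>2) \<partial>count_space UNIV)"
  by (simp add: energy_def infsum_ennreal_eq_nn_integral)

lemma fun_fourier_0:
  fixes g :: "complex \<Rightarrow> real"
  shows "fun_fourier (\<lambda>z. of_real (g z)) 0 = of_real (LINT z|\<mu>. g z)"
  by (simp add: fun_fourier_def)

lemma density_probs_on:
  fixes g :: "complex \<Rightarrow> real"
  assumes [measurable]: "g \<in> borel_measurable circle_borel" and nonneg: "\<And>z. cmod z = 1 \<Longrightarrow> 0 \<le> g z"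
    and zero: "\<And>z. cmod z = 1 \<Longrightarrow> z \<notin> K \<Longrightarrow> g z = 0" and K: "K \<in> sets circle_borel"
    and int: "integrable \<mu> g" "(LINT z|\<mu>. g z) = 1"
  shows "density \<mu> (\<lambda>z. ennreal (g z)) \<in> probs_on K"
    and "measure_fourier (density \<mu> (\<lambda>z. ennreal (g z))) n = fun_fourier (\<lambda>z. of_real (g z)) n"
proof -
  let ?D = "density \<mu> (\<lambda>z. ennreal (g z))"
  have "emeasure ?D (space \<mu>) = (\<integral>\<^sup>+z. ennreal (g z) \<partial>\<mu>)"
    by (subst emeasure_density[OF _ sets.top]) (auto intro!: nn_integral_cong)
  also have "\<dots> = ennreal (LINT z|\<mu>. g z)"
    by (rule nn_integral_eq_integral[OF int(1)]) (auto intro!: AE_I2 nonneg)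
  finally have "prob_space ?D" using int by (intro prob_spaceI) simp
  moreover have C: "unit_circle - K \<in> sets circle_borel"
    using K sets.compl_sets[of K circle_borel] by simp
  moreover have "emeasure ?D (unit_circle - K) = (\<integral>\<^sup>+z. 0 \<partial>\<mu>)"
  proof -
    have "emeasure ?D (unit_circle - K) = (\<integral>\<^sup>+z\<in>unit_circle - K. ennreal (g z) \<partial>\<mu>)"
      using C by (intro emeasure_density) auto
    also have "\<dots> = (\<integral>\<^sup>+z. 0 \<partial>\<mu>)"
      by (rule nn_integral_cong) (auto split: split_indicator simp: zero)
    finally show ?thesis .
  qed
  ultimately show "?D \<in> probs_on K" by (simp add: probs_on_def)
  show "measure_fourier ?D n = fun_fourier (\<lambda>z. of_real (g z)) n"
    unfolding measure_fourier_def fun_fourier_def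
    by (subst integral_density) (auto intro!: AE_I2 nonneg simp: scaleR_conv_of_real mult.commute)
qed

lemma Cap_mono: "A \<subseteq> B \<Longrightarrow> Cap \<omega> A \<le> Cap \<omega> B"
  unfolding Cap_def by (rule SUP_subset_mono) auto

lemma Cap_ge:
  assumes "compact K" "K \<subseteq> A" "M \<in> probs_on K"
  shows "1 / energy \<omega> M \<le> Cap \<omega> A"
proof -
  have "1 / energy \<omega> M \<le> Cap_compact \<omega> K" unfolding Cap_compact_def by (rule SUP_upper[OF assms(3)])
  also have "\<dots> \<le> Cap \<omega> A" unfolding Cap_def using assms(1,2) by (intro SUP_upper) auto
  finally show ?thesis .
qed

lemma Cap_leI:
  assumes "\<And>K M. compact K \<Longrightarrow> K \<subseteq> A \<Longrightarrow> M \<in> probs_on K \<Longrightarrow> 1 / energy \<omega> M \<le> c"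
  shows "Cap \<omega> A \<le> c"
  unfolding Cap_def Cap_compact_def using assms by (auto intro!: SUP_least)

lemma measure_fourier_0: "prob_space M \<Longrightarrow> measure_fourier M 0 = 1"
  by (simp add: measure_fourier_def prob_space.prob_space)

text \<open>Needed to normalise the mollifier. Chords are no longer than arcs, so an arc of small
  angles lies in the ball.\<close>

lemma circle_ball_pos:
  assumes "h > 0"
  shows "0 < measure \<mu> (ball 1 h \<inter> unit_circle)"
proof -
  define d where "d = min h (2 * pi)"
  have d: "0 < d" "d \<le> h" "d \<le> 2 * pi" using assms pi_gt_zero by (auto simp: d_def)
  have A: "ball 1 h \<inter> unit_circle \<in> sets circle_borel"
    by (auto simp: circle_borel_def sets_restrict_space_iff)
  have "{0..<d} \<subseteq> cis -` (ball 1 h \<inter> unit_circle)"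
  proof
    fix t assume "t \<in> {0..<d}"
    then show "t \<in> cis -` (ball 1 h \<inter> unit_circle)"
      using norm_cis_diff_one_le[of t] d by (auto simp: dist_norm norm_minus_commute)
  qed
  then have "{0..<d} \<subseteq> {0..<2 * pi} \<inter> (cis -` (ball 1 h \<inter> unit_circle) \<inter> space lborel)" using d by auto
  moreover have cis_sets: "cis -` (ball 1 h \<inter> unit_circle) \<inter> space lborel \<in> sets lborel"
    using measurable_sets[OF cis_measurable A] by simp
  ultimately have "emeasure lborel {0..<d} \<le> emeasure lborel ({0..<2 * pi} \<inter> (cis -` (ball 1 h \<inter> unit_circle) \<inter> space lborel))"
    by (intro emeasure_mono) auto
  then have "0 < emeasure lborel ({0..<2 * pi} \<inter> (cis -` (ball 1 h \<inter> unit_circle) \<inter> space lborel))"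
    using d by (simp add: less_le_trans[of 0 "ennreal d"])
  moreover have "emeasure \<mu> (ball 1 h \<inter> unit_circle)
      = emeasure lborel ({0..<2 * pi} \<inter> (cis -` (ball 1 h \<inter> unit_circle) \<inter> space lborel)) / emeasure lborel {0..<2 * pi}"
    unfolding circle_measure_def using cis_sets
    by (simp add: emeasure_distr[OF cis_measurable A] emeasure_uniform_measure)
  ultimately have "0 < emeasure \<mu> (ball 1 h \<inter> unit_circle)"
    by (simp add: ennreal_zero_less_divide)
  then show ?thesis by (simp add: circle.emeasure_eq_measure)
qed

text \<open>Convolution with the normalised indicator \<phi> of a small ball around 1. The
  coefficients of \<phi> have modulus at most 1, and a radius below the distance from K to the
  complement of U keeps the support in U. Capacities of open sets can thus be tested on
  square-integrable densities.\<close>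

lemma mollify:
  assumes M: "M \<in> probs_on K" and K: "compact K" "K \<subseteq> U"
    and U: "openin (top_of_set unit_circle) U"
  obtains g K' where "g \<in> borel_measurable circle_borel" "L2 \<mu> (\<lambda>z. of_real (g z))"
    "\<And>z. cmod z = 1 \<Longrightarrow> 0 \<le> g z" "compact K'" "K' \<subseteq> U" "\<And>z. cmod z = 1 \<Longrightarrow> z \<notin> K' \<Longrightarrow> g z = 0"
    "fun_fourier (\<lambda>z. of_real (g z)) 0 = 1"
    "\<And>n. cmod (fun_fourier (\<lambda>z. of_real (g z)) n) \<le> cmod (measure_fourier M n)"
proof -
  interpret M: prob_space M using M by (simp add: probs_on_def)
  have fM: "finite_measure M" by unfold_locales
  have sM: "sets M = sets circle_borel" using M by (simp add: probs_on_def)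
  have spM: "space M = unit_circle" by (rule space_circle_sets[OF fM sM borel_measurable_const, of 0]) auto
  have U_sub: "U \<subseteq> unit_circle" using openin_imp_subset[OF U] .
  have "K \<noteq> {}"
  proof
    assume "K = {}"
    then have "emeasure M (space M) = 0" using M by (simp add: probs_on_def spM)
    then show False using M.emeasure_space_1 by simp
  qed
  have "closedin (top_of_set unit_circle) (unit_circle - U)"
    using U by (metis closedin_diff closedin_topspace topspace_euclidean_subtopology)
  then have "closed (unit_circle - U)" by (rule closedin_closed_trans) simp
  then obtain d where d: "d > 0" "\<And>x y. x \<in> K \<Longrightarrow> y \<in> unit_circle - U \<Longrightarrow> d \<le> dist x y"
    using separate_compact_closed[OF K(1), of "unit_circle - U"] K(2) by blast
  define h where "h = d / 2"
  have h: "0 < h" "h < d" using d by (auto simp: h_def)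
  define K' where "K' = {y \<in> unit_circle. infdist y K \<le> h}"
  have "closed {y. infdist y K \<le> h}"
    by (intro closed_Collect_le continuous_intros)
  then have K': "compact K'"
    using compact_Int_closed[of unit_circle "{y. infdist y K \<le> h}"] by (simp add: K'_def Int_def)
  have K'U: "K' \<subseteq> U"
  proof
    fix y assume y: "y \<in> K'"
    obtain x where "x \<in> K" "infdist y K = dist y x"
      using infdist_attains_inf[OF compact_imp_closed[OF K(1)] \<open>K \<noteq> {}\<close>] by blast
    then have "\<not> d \<le> dist x y" using y h by (simp add: K'_def dist_commute)
    then show "y \<in> U" using d(2)[OF \<open>x \<in> K\<close>, of y] y by (auto simp: K'_def)
  qed
  define \<beta> where "\<beta> = measure \<mu> (ball 1 h \<inter> unit_circle)"
  have "\<beta> > 0" unfolding \<beta>_def using h by (intro circle_ball_pos)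
  define \<phi> :: "complex \<Rightarrow> real" where "\<phi> z = indicator (ball 1 h) z / \<beta>" for z
  have \<phi>_meas: "\<phi> \<in> borel_measurable borel" unfolding \<phi>_def[abs_def]
    by (intro borel_measurable_divide borel_measurable_indicator borel_measurable_const) auto
  have \<phi>_bound: "0 \<le> \<phi> z" "\<phi> z \<le> 1 / \<beta>" for z
    using \<open>\<beta> > 0\<close> by (auto simp: \<phi>_def split: split_indicator)
  note conv = fM sM \<phi>_meas \<phi>_bound
  have int\<phi>: "(LINT z|\<mu>. \<phi> z) = 1"
  proof -
    have "(LINT z|\<mu>. \<phi> z) = (LINT z|\<mu>. indicator (ball 1 h \<inter> unit_circle) z / \<beta>)"
      by (intro Bochner_Integration.integral_cong) (auto simp: \<phi>_def split: split_indicator)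
    also have "\<dots> = 1"
      using \<open>\<beta> > 0\<close> by (simp add: \<beta>_def Int_absorb2)
    finally show ?thesis .
  qed
  have rho: "cmod (fun_fourier (\<lambda>z. of_real (\<phi> z)) n) \<le> 1" for n
  proof -
    have "cmod (fun_fourier (\<lambda>z. of_real (\<phi> z)) n) \<le> (LINT z|\<mu>. cmod (z powi (-n) * of_real (\<phi> z)))"
      unfolding fun_fourier_def by (rule integral_norm_bound)
    also have "\<dots> = (LINT z|\<mu>. \<phi> z)"
      by (intro Bochner_Integration.integral_cong) (auto simp: norm_mult norm_power_int_circle \<phi>_bound)
    finally show ?thesis using int\<phi> by simp
  qed
  have zero: "conv \<phi> M z = 0" if z: "cmod z = 1" "z \<notin> K'" for z
  proof -
    have "AE w in M. w \<in> K"
    proof (rule AE_I)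
      show "{w \<in> space M. w \<notin> K} \<subseteq> unit_circle - K" unfolding spM by blast
      show "emeasure M (unit_circle - K) = 0" using M by (simp add: probs_on_def)
      show "unit_circle - K \<in> sets M"
        using sets.compl_sets[OF sets_circle_borel_compact[OF K(1)]] K(2) U_sub sM by auto
    qed
    then have "AE w in M. \<phi> (z * cnj w) = 0"
    proof eventually_elim
      case (elim w)
      then have w: "cmod w = 1" using K U_sub by auto
      have "h < dist z w" using z infdist_le[OF elim, of z] by (auto simp: K'_def)
      also have "dist z w = cmod ((z - w) * cnj w)" using w by (simp add: dist_norm norm_mult)
      also have "(z - w) * cnj w = z * cnj w - 1" using complex_norm_square[of w] w by (simp add: algebra_simps)
      finally show ?case by (simp add: \<phi>_def dist_norm norm_minus_commute)
    qed
    then have "(LINT w|M. \<phi> (z * cnj w)) = (LINT w|M. 0)"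
      using borel_measurable_integrable[OF conv_integrable[OF conv z(1)]] by (intro integral_cong_AE) auto
    then show ?thesis by (simp add: conv_def)
  qed
  show ?thesis
  proof (rule that[of "conv \<phi> M" K'])
    show "fun_fourier (\<lambda>z. of_real (conv \<phi> M z)) 0 = 1"
      unfolding fun_fourier_conv[OF conv] using int\<phi> M.prob_space_axioms by (simp add: fun_fourier_0 measure_fourier_0)
    show "cmod (fun_fourier (\<lambda>z. of_real (conv \<phi> M z)) n) \<le> cmod (measure_fourier M n)" for n
      unfolding fun_fourier_conv[OF conv] norm_mult using rho by (intro mult_left_le_one_le) auto
  qed (use conv_measurable[OF conv] L2_conv[OF conv] conv_nonneg[OF conv] K' K'U zero in auto)
qed


subsection \<open>The Poisson kernel and positivity of the energy kernel\<close>

lemma integrable_geometric_int: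
  assumes "0 \<le> x" "x < (1::real)"
  shows "integrable (count_space UNIV) (\<lambda>n::int. x ^ nat \<bar>n\<bar>)"
  unfolding integrable_count_space_iff_summable_on
proof (rule nonneg_bounded_partial_sums_imp_summable_on[where C="2 * (1 / (1 - x))"])
  have geo: "(\<Sum>k\<in>X. x ^ k) \<le> 1 / (1 - x)" if "finite X" for X
    using sum_le_suminf[OF summable_geometric that, of x] assms by (simp add: suminf_geometric)
  have "(\<Sum>n\<in>F. x ^ nat \<bar>n\<bar>) \<le> 2 * (1 / (1 - x))" if F: "finite F" for F :: "int set"
  proof -
    define X where "X = (\<lambda>n. nat \<bar>n\<bar>) ` F"
    have X: "finite X" using F by (simp add: X_def)
    have "F \<subseteq> int ` X \<union> (\<lambda>k. - int k) ` X"
    proof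
      fix n assume n: "n \<in> F"
      then have "nat \<bar>n\<bar> \<in> X" by (simp add: X_def)
      moreover have "n = int (nat \<bar>n\<bar>) \<or> n = - int (nat \<bar>n\<bar>)" by auto
      ultimately show "n \<in> int ` X \<union> (\<lambda>k. - int k) ` X" by blast
    qed
    then have "(\<Sum>n\<in>F. x ^ nat \<bar>n\<bar>) \<le> (\<Sum>n\<in>int ` X \<union> (\<lambda>k. - int k) ` X. x ^ nat \<bar>n\<bar>)"
      using X assms by (intro sum_mono2) auto
    also have "\<dots> \<le> (\<Sum>n\<in>int ` X. x ^ nat \<bar>n\<bar>) + (\<Sum>n\<in>(\<lambda>k. - int k) ` X. x ^ nat \<bar>n\<bar>)"
      using X assms by (simp add: sum_Un sum_nonneg)
    also have "\<dots> = 2 * (\<Sum>k\<in>X. x ^ k)"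
      by (simp add: sum.reindex inj_on_def)
    finally show ?thesis using geo[OF X] by linarith
  qed
  then show "\<forall>\<^sub>F F in finite_subsets_at_top UNIV. (\<Sum>n\<in>F. x ^ nat \<bar>n\<bar>) \<le> 2 * (1 / (1 - x))"
    by (intro eventually_finite_subsets_at_top_weakI) auto
qed (use assms in auto)

lemma fun_fourier_shift:
  assumes "L2 \<mu> f"
  shows "fun_fourier (\<lambda>z. z powi k * f z) n = fun_fourier f (n - k)"
  unfolding fun_fourier_def
proof (rule Bochner_Integration.integral_cong)
  fix z :: complex assume "z \<in> space \<mu>"
  then have "z \<noteq> 0" by auto
  then have "z powi (- (n - k)) = z powi (-n) * z powi k" using power_int_add[of z "-n" k] by simp
  then show "z powi (-n) * (z powi k * f z) = z powi (- (n - k)) * f z" by simp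
qed simp

definition poisson :: "real \<Rightarrow> complex \<Rightarrow> real" where
  "poisson s z = (1 - s\<^sup>2) / (cmod (1 - of_real s * z))\<^sup>2"

lemma poisson_measurable: "poisson s \<in> borel_measurable borel"
  unfolding poisson_def[abs_def]
  by (intro borel_measurable_divide borel_measurable_const borel_measurable_continuous_onI continuous_intros)

context
  fixes s :: real
  assumes s: "0 \<le> s" "s < 1"
begin

lemma poisson_denominator: "cmod z = 1 \<Longrightarrow> 1 - s \<le> cmod (1 - of_real s * z)"
  using norm_triangle_ineq2[of 1 "of_real s * z"] s by (simp add: norm_mult)

lemma poisson_nonneg: "0 \<le> poisson s z"
  unfolding poisson_def using s by (intro divide_nonneg_nonneg) (auto simp: power_le_one)

lemma poisson_le:
  assumes "cmod z = 1"
  shows "poisson s z \<le> (1 - s\<^sup>2) / (1 - s)\<^sup>2"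
  unfolding poisson_def using s poisson_denominator[OF assms]
  by (intro divide_left_mono power_mono mult_pos_pos zero_less_power) (auto simp: power_le_one)

text \<open>The function with coefficients \<open>s ^ \<bar>n\<bar>\<close> becomes constant on multiplication by the
  denominator of the Poisson kernel, a trigonometric polynomial.\<close>

lemma fun_fourier_poisson: "fun_fourier (\<lambda>z. of_real (poisson s z)) n = of_real (s ^ nat \<bar>n\<bar>)"
proof -
  define c where "c n = complex_of_real (s ^ nat \<bar>n\<bar>)" for n :: int
  have "(cmod (c n))\<^sup>2 = (s\<^sup>2) ^ nat \<bar>n\<bar>" for n
    using s by (simp add: c_def norm_power mult.commute flip: power_mult)
  then have "L2 (count_space UNIV) c"
    using integrable_geometric_int[of "s\<^sup>2"] s by (simp add: L2_def power_less_one_iff)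
  then obtain g where g: "L2 \<mu> g" "fun_fourier g = c" by (rule Riesz_Fischer)
  have sh: "L2 \<mu> (\<lambda>z. z powi k * g z)" for k
    by (intro L2_mult_bounded[OF g(1), where B=1] power_int_measurable) (simp add: norm_power_int_circle)
  \<comment> \<open>On the circle z^{-1} is the conjugate of z, so h is g times |1 - s z|^2.\<close>
  define h where "h z = (of_real (1 + s\<^sup>2) * g z - of_real s * (z powi 1 * g z)) - of_real s * (z powi (-1) * g z)" for z
  have L2h: "L2 \<mu> h"
    unfolding h_def[abs_def] by (intro L2_diff L2_scale sh g)
  have "fun_fourier h n = (of_real (1 + s\<^sup>2) * c n - of_real s * c (n - 1)) - of_real s * c (n + 1)" for n
    unfolding h_def[abs_def]
  proof -
    have 1: "fun_fourier (\<lambda>z. z powi 1 * g z) n = c (n - 1)" and 2: "fun_fourier (\<lambda>z. z powi (-1) * g z) n = c (n + 1)"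
      using fun_fourier_shift[OF g(1), of 1 n] fun_fourier_shift[OF g(1), of "-1" n] by (simp_all only: g(2) diff_minus_eq_add)
    show "fun_fourier (\<lambda>z. (of_real (1 + s\<^sup>2) * g z - of_real s * (z powi 1 * g z)) - of_real s * (z powi (-1) * g z)) n
        = (of_real (1 + s\<^sup>2) * c n - of_real s * c (n - 1)) - of_real s * c (n + 1)"
      by (simp only: fun_fourier_diff[OF L2_diff[OF L2_scale[OF g(1)] L2_scale[OF sh]] L2_scale[OF sh]]
            fun_fourier_diff[OF L2_scale[OF g(1)] L2_scale[OF sh]] fun_fourier_scale 1 2 g(2))
  qed
  \<comment> \<open>For n \<noteq> 0 the three neighbouring powers of s cancel; the kink of |n| at 0
    leaves 1 - s^2.\<close>
  moreover have "(of_real (1 + s\<^sup>2) * c n - of_real s * c (n - 1)) - of_real s * c (n + 1) = (if n = 0 then of_real (1 - s\<^sup>2) else 0)" for n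
  proof -
    have "(1 + s\<^sup>2) * s ^ nat \<bar>n\<bar> - s * s ^ nat \<bar>n - 1\<bar> - s * s ^ nat \<bar>n + 1\<bar> = (if n = 0 then 1 - s\<^sup>2 else 0)"
    proof -
      consider "n = 0" | m where "n = int (Suc m)" | m where "n = - int (Suc m)"
        by (metis int_cases3 not0_implies_Suc of_nat_0_less_iff gr0_conv_Suc)
      then show ?thesis
      proof cases
        case 1 then show ?thesis by (simp add: power2_eq_square)
      next
        case 2
        then have nats: "nat \<bar>n\<bar> = Suc m" "nat \<bar>n - 1\<bar> = m" "nat \<bar>n + 1\<bar> = Suc (Suc m)" and nz: "n \<noteq> 0"
          using 2 by auto
        show ?thesis unfolding nats using nz by (simp add: power2_eq_square algebra_simps)
      next
        case 3
        then have nats: "nat \<bar>n\<bar> = Suc m" "nat \<bar>n - 1\<bar> = Suc (Suc m)" "nat \<bar>n + 1\<bar> = m" and nz: "n \<noteq> 0"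
          using 3 by auto
        show ?thesis unfolding nats using nz by (simp add: power2_eq_square algebra_simps)
      qed
    qed
    from arg_cong[OF this, of complex_of_real] show ?thesis
      by (simp add: c_def split: if_splits)
  qed
  ultimately have fh: "fun_fourier h n = (if n = 0 then of_real (1 - s\<^sup>2) else 0)" for n by simp
  have L2c: "L2 \<mu> (\<lambda>z. complex_of_real (1 - s\<^sup>2))" by (intro L2_bounded) auto
  have "fun_fourier (\<lambda>z. complex_of_real (1 - s\<^sup>2)) n = (if n = 0 then of_real (1 - s\<^sup>2) else 0)" for n
    using fun_fourier_power[of "of_real (1 - s\<^sup>2)" 0 n] by (simp only: power_int_0_right mult_1_right)
  then have "fun_fourier (\<lambda>z. h z - of_real (1 - s\<^sup>2)) n = 0" for n
    by (simp only: fun_fourier_diff[OF L2h L2c] fh diff_self)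
  then have "AE z in \<mu>. h z - of_real (1 - s\<^sup>2) = 0"
    by (intro fun_fourier_zero_imp_zero L2_diff L2h L2c)
  then have "AE z in \<mu>. of_real (poisson s z) = g z"
    using AE_space
  proof eventually_elim
    case (elim z)
    then have z: "cmod z = 1" by simp
    have pm: "z powi (-1) = cnj z" using cnj_power_int_circle[OF z, of 1] by simp
    have zz: "z * cnj z = 1" using complex_norm_square[of z] z by simp
    have "complex_of_real ((cmod (1 - of_real s * z))\<^sup>2) = (1 - of_real s * z) * (1 - of_real s * cnj z)"
      using complex_norm_square[of "1 - of_real s * z"] by simp
    also have "\<dots> = 1 - of_real s * z - of_real s * cnj z + (of_real s)\<^sup>2 * (z * cnj z)"
      by (simp add: power2_eq_square algebra_simps)
    finally have "complex_of_real ((cmod (1 - of_real s * z))\<^sup>2) = of_real (1 + s\<^sup>2) - of_real s * z - of_real s * cnj z"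
      unfolding zz by simp
    then have "of_real ((cmod (1 - of_real s * z))\<^sup>2) * g z = h z"
      unfolding h_def pm by (simp only:) (simp add: algebra_simps)
    also have "\<dots> = of_real (1 - s\<^sup>2)" using elim by simp
    finally have "of_real ((cmod (1 - of_real s * z))\<^sup>2) * g z = of_real (1 - s\<^sup>2)" .
    moreover have "cmod (1 - of_real s * z) \<noteq> 0" using poisson_denominator[OF z] s by linarith
    ultimately show ?case by (simp add: poisson_def field_simps)
  qed
  then have "fun_fourier (\<lambda>z. of_real (poisson s z)) n = fun_fourier g n"
    using L2_measurable[OF g(1)] of_real_measurable[OF circle_borel_measurable_borel[OF poisson_measurable]]
    by (intro fun_fourier_cong_AE) auto
  then show ?thesis by (simp add: g(2) c_def)
qed

lemma poisson_conv:
  assumes M: "finite_measure M" "sets M = sets circle_borel"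
  shows "L2 \<mu> (\<lambda>z. of_real (conv (poisson s) M z))"
    and "fun_fourier (\<lambda>z. of_real (conv (poisson s) M z)) n = of_real (s ^ nat \<bar>n\<bar>) * measure_fourier M n"
    and "cmod z = 1 \<Longrightarrow> 0 \<le> conv (poisson s) M z"
    and "cmod z = 1 \<Longrightarrow> integrable M (\<lambda>w. poisson s (z * cnj w))"
  using L2_conv[OF M poisson_measurable poisson_nonneg poisson_le]
    fun_fourier_conv[OF M poisson_measurable poisson_nonneg poisson_le]
    conv_nonneg[OF M poisson_measurable poisson_nonneg poisson_le]
    conv_integrable[OF M poisson_measurable poisson_nonneg poisson_le]
  by (simp_all add: fun_fourier_poisson)

end

section \<open>Energy under restriction of a measure, and atoms\<close>

definition restr :: "complex measure \<Rightarrow> complex set \<Rightarrow> complex measure" where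
  "restr M A = density M (\<lambda>z. ennreal (indicator A z))"

lemma sets_restr [simp]: "sets (restr M A) = sets M"
  by (simp add: restr_def)

lemma finite_measure_restr:
  assumes "finite_measure M" "A \<in> sets M"
  shows "finite_measure (restr M A)"
proof -
  interpret finite_measure M by fact
  have "emeasure (restr M A) (space M) = (\<integral>\<^sup>+z. ennreal (indicator A z) * indicator (space M) z \<partial>M)"
    using assms(2) unfolding restr_def by (intro emeasure_density) auto
  also have "\<dots> = (\<integral>\<^sup>+z. indicator A z \<partial>M)" by (intro nn_integral_cong) (auto split: split_indicator)
  finally have "emeasure (restr M A) (space M) = emeasure M A" using assms(2) by simp
  then show ?thesis by (intro finite_measureI) (simp add: restr_def emeasure_finite)
qed

lemma integral_restr:
  fixes f :: "complex \<Rightarrow> 'b::{banach, second_countable_topology}"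
  assumes "A \<in> sets M" "f \<in> borel_measurable M"
  shows "(LINT z|restr M A. f z) = (LINT z|M. indicator A z *\<^sub>R f z)"
  unfolding restr_def using assms by (intro integral_density) auto

text \<open>The square root appears because Parseval squares the coefficients s^|n| of the Poisson
  kernel.\<close>

lemma poisson_slice:
  assumes M: "finite_measure M" "sets M = sets circle_borel" and r: "0 \<le> r" "r < 1"
  shows "(\<integral>\<^sup>+n. ennreal (r ^ nat \<bar>n\<bar> * (cmod (measure_fourier M n))\<^sup>2) \<partial>count_space UNIV)
    = (\<integral>\<^sup>+z. ennreal ((conv (poisson (sqrt r)) M z)\<^sup>2) \<partial>\<mu>)"
proof -
  have s: "0 \<le> sqrt r" "sqrt r < 1" using r by auto
  have "(cmod (fun_fourier (\<lambda>z. of_real (conv (poisson (sqrt r)) M z)) n))\<^sup>2 = r ^ nat \<bar>n\<bar> * (cmod (measure_fourier M n))\<^sup>2" for n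
  proof -
    have "(sqrt r ^ k)\<^sup>2 = r ^ k" for k
      using r by (simp add: power2_eq_square flip: power_mult_distrib)
    then show ?thesis
      unfolding poisson_conv(2)[OF s M] norm_mult norm_of_real power_mult_distrib power2_abs by simp
  qed
  then show ?thesis using Parseval_nn_integral[OF poisson_conv(1)[OF s M]] by simp
qed

text \<open>Moments are mixtures of the powers r^n, so by Tonelli the energy is a mixture, with
  nonnegative weight, of the sums in \<open>poisson_slice\<close>.\<close>

lemma energy_moment_eq:
  assumes W: "is_weight W"
  shows "energy (moment W) M = (\<integral>\<^sup>+r. ennreal (weight_fun W r) * (\<integral>\<^sup>+n. ennreal (r ^ nat \<bar>n\<bar> * (cmod (measure_fourier M n))\<^sup>2) \<partial>count_space UNIV) \<partial>lborel)"
proof -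
  have [measurable]: "weight_fun W \<in> borel_measurable borel" using W by (rule weight_fun_measurable)
  have m: "ennreal (moment W k) = (\<integral>\<^sup>+r. ennreal (r ^ k * weight_fun W r) \<partial>lborel)" for k
    unfolding moment_eq using moment_nonneg[OF W]
    by (intro nn_integral_eq_integral[symmetric] integrable_moment W) auto
  have "energy (moment W) M = (\<integral>\<^sup>+n. (\<integral>\<^sup>+r. ennreal (r ^ nat \<bar>n\<bar> * weight_fun W r) \<partial>lborel) * nsq (measure_fourier M n) \<partial>count_space UNIV)"
    unfolding energy_eq by (intro nn_integral_cong) (simp add: ennreal_mult'' m)
  also have "\<dots> = (\<integral>\<^sup>+n. \<integral>\<^sup>+r. ennreal (r ^ nat \<bar>n\<bar> * weight_fun W r) * nsq (measure_fourier M n) \<partial>lborel \<partial>count_space UNIV)"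
    by (intro nn_integral_cong nn_integral_multc[symmetric]) measurable
  also have "\<dots> = (\<integral>\<^sup>+r. \<integral>\<^sup>+n. ennreal (r ^ nat \<bar>n\<bar> * weight_fun W r) * nsq (measure_fourier M n) \<partial>count_space UNIV \<partial>lborel)"
    by (rule nn_integral_count_space_nn_integral[symmetric]) (simp, measurable)
  also have "\<dots> = (\<integral>\<^sup>+r. \<integral>\<^sup>+n. ennreal (weight_fun W r) * ennreal (r ^ nat \<bar>n\<bar> * (cmod (measure_fourier M n))\<^sup>2) \<partial>count_space UNIV \<partial>lborel)"
  proof (intro nn_integral_cong)
    fix r n
    show "ennreal (r ^ nat \<bar>n\<bar> * weight_fun W r) * nsq (measure_fourier M n)
        = ennreal (weight_fun W r) * ennreal (r ^ nat \<bar>n\<bar> * (cmod (measure_fourier M n))\<^sup>2)"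
    proof (cases "r \<in> {0..<1}")
      case True
      then show ?thesis using weight_fun_nonneg[OF W, of r]
        by (subst (1 2) ennreal_mult[symmetric]) (auto simp: mult_ac)
    qed (simp add: weight_fun_eq_0)
  qed
  also have "\<dots> = (\<integral>\<^sup>+r. ennreal (weight_fun W r) * (\<integral>\<^sup>+n. ennreal (r ^ nat \<bar>n\<bar> * (cmod (measure_fourier M n))\<^sup>2) \<partial>count_space UNIV) \<partial>lborel)"
    by (intro nn_integral_cong) (simp add: nn_integral_cmult)
  finally show ?thesis .
qed

text \<open>A smaller positive measure has a pointwise smaller Poisson integral, hence a smaller
  contribution at every r.\<close>

lemma energy_restr_le:
  assumes W: "is_weight W" and M: "finite_measure M" "sets M = sets circle_borel" and A: "A \<in> sets M"
  shows "energy (moment W) (restr M A) \<le> energy (moment W) M"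
  unfolding energy_moment_eq[OF W]
proof (intro nn_integral_mono)
  fix r :: real
  let ?b = "\<lambda>M. \<integral>\<^sup>+n. ennreal (r ^ nat \<bar>n\<bar> * (cmod (measure_fourier M n))\<^sup>2) \<partial>count_space UNIV"
  show "ennreal (weight_fun W r) * ?b (restr M A) \<le> ennreal (weight_fun W r) * ?b M"
  proof (cases "r \<in> {0..<1}")
    case True
    then have r: "0 \<le> r" "r < 1" by auto
    then have s: "0 \<le> sqrt r" "sqrt r < 1" by auto
    have M': "finite_measure (restr M A)" "sets (restr M A) = sets circle_borel"
      using finite_measure_restr[OF M(1) A] M(2) by auto
    have "?b (restr M A) \<le> ?b M"
      unfolding poisson_slice[OF M r] poisson_slice[OF M' r]
    proof (intro nn_integral_mono ennreal_leI power_mono)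
      fix z assume "z \<in> space \<mu>"
      then have z: "cmod z = 1" by simp
      have "conv (poisson (sqrt r)) (restr M A) z = (LINT w|M. indicator A w *\<^sub>R poisson (sqrt r) (z * cnj w))"
        unfolding conv_def using poisson_conv(4)[OF s M z] by (intro integral_restr A) auto
      also have "\<dots> \<le> conv (poisson (sqrt r)) M z"
        unfolding conv_def using poisson_conv(4)[OF s M z] poisson_nonneg[OF s]
        by (intro integral_mono integrable_mult_indicator A) (auto split: split_indicator)
      finally show "conv (poisson (sqrt r)) (restr M A) z \<le> conv (poisson (sqrt r)) M z" .
      show "0 \<le> conv (poisson (sqrt r)) (restr M A) z" by (rule poisson_conv(3)[OF s M' z])
    qed
    then show ?thesis by (rule mult_left_mono) simp
  qed (simp add: weight_fun_eq_0)
qed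

text \<open>(C2) in terms of moments: summing the geometric series under the integral turns the sum
  of the moments into the integral of W(t) / t with t = 1 - r.\<close>

lemma nn_integral_moment_infinite:
  assumes W: "is_weight W" "cond_C2 W"
  shows "(\<integral>\<^sup>+n. ennreal (moment W (nat \<bar>n\<bar>)) \<partial>count_space (UNIV::int set)) = \<infinity>"
proof -
  have [measurable]: "weight_fun W \<in> borel_measurable borel" using W(1) by (rule weight_fun_measurable)
  have "\<infinity> = (\<integral>\<^sup>+r. ennreal (weight_fun W r / (1 - r)) \<partial>lborel)" using cond_C2_weight_fun[OF W] by simp
  also have "\<dots> = (\<integral>\<^sup>+r. (\<Sum>k. ennreal (r ^ k * weight_fun W r)) \<partial>lborel)"
  proof (intro nn_integral_cong)
    fix r :: real
    show "ennreal (weight_fun W r / (1 - r)) = (\<Sum>k. ennreal (r ^ k * weight_fun W r))"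
    proof (cases "r \<in> {0..<1}")
      case True
      then have "(\<lambda>k. r ^ k * weight_fun W r) sums (1 / (1 - r) * weight_fun W r)"
        by (intro sums_mult2 geometric_sums) auto
      then show ?thesis using moment_nonneg[OF W(1), of r]
        by (subst suminf_ennreal2) (auto simp: sums_iff)
    qed (simp add: weight_fun_eq_0)
  qed
  also have "\<dots> = (\<Sum>k. \<integral>\<^sup>+r. ennreal (r ^ k * weight_fun W r) \<partial>lborel)" by (intro nn_integral_suminf) measurable
  also have "\<dots> = (\<Sum>k. ennreal (moment W k))"
    unfolding moment_eq using moment_nonneg[OF W(1)]
    by (intro suminf_cong nn_integral_eq_integral integrable_moment W) auto
  also have "\<dots> = (\<integral>\<^sup>+k. ennreal (moment W (nat \<bar>int k\<bar>)) \<partial>count_space UNIV)"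
    by (simp add: nn_integral_count_space_nat)
  also have "\<dots> = (\<integral>\<^sup>+n. ennreal (moment W (nat \<bar>n\<bar>)) \<partial>count_space (range int))"
    by (rule nn_integral_bij_count_space) (auto simp: bij_betw_def inj_on_def)
  also have "\<dots> \<le> (\<integral>\<^sup>+n. ennreal (moment W (nat \<bar>n\<bar>)) \<partial>count_space (UNIV::int set))"
    by (rule nn_integral_count_space_le_UNIV)
  finally show ?thesis by (simp add: top_unique)
qed

text \<open>The part of M at a single point has coefficients of constant modulus, so its energy is a
  multiple of the divergent sum of moments; by \<open>energy_restr_le\<close> the energy of M is at
  least as large.\<close>

lemma energy_atom:
  assumes W: "is_weight W" "cond_C2 W" and M: "finite_measure M" "sets M = sets circle_borel"
    and a: "cmod a = 1" "measure M {a} \<noteq> 0"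
  shows "energy (moment W) M = \<infinity>"
proof -
  have A: "{a} \<in> sets M" using sets_circle_borel_closed[of "{a}"] a M(2) by simp
  have c: "0 < measure M {a}" using a(2) by (simp add: zero_less_measure_iff)
  have "cmod (measure_fourier (restr M {a}) n) = measure M {a}" for n
  proof -
    have "measure_fourier (restr M {a}) n = (LINT z|M. indicator {a} z *\<^sub>R z powi (-n))"
      unfolding measure_fourier_def by (rule integral_restr[OF A power_int_measurable'[OF M(2)]])
    also have "\<dots> = (LINT z|M. indicator {a} z *\<^sub>R a powi (-n))"
      by (intro Bochner_Integration.integral_cong) (auto split: split_indicator)
    also have "\<dots> = measure M {a} *\<^sub>R a powi (-n)"
      using A sets.sets_into_space[OF A] finite_measure.emeasure_finite[OF M(1)] by (simp add: Int_absorb2 less_top)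
    finally show ?thesis using a c by (simp add: norm_power_int)
  qed
  then have "energy (moment W) (restr M {a}) = (\<integral>\<^sup>+n. ennreal ((measure M {a})\<^sup>2) * ennreal (moment W (nat \<bar>n\<bar>)) \<partial>count_space (UNIV::int set))"
    unfolding energy_eq using moment_pos[OF W] by (simp add: ennreal_mult less_imp_le mult.commute)
  also have "\<dots> = \<infinity>"
    using c by (simp add: nn_integral_cmult nn_integral_moment_infinite[OF W] ennreal_mult_top)
  finally show ?thesis using energy_restr_le[OF W(1) M A] by (simp add: top_unique)
qed

lemma energy_ge:
  assumes "prob_space M"
  shows "ennreal (\<omega> 0) \<le> energy \<omega> M"
proof -
  have "ennreal (\<omega> 0) = (\<integral>\<^sup>+n. ennreal (\<omega> (nat \<bar>n\<bar>) * (cmod (measure_fourier M n))\<^sup>2) \<partial>count_space {0})"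
    using measure_fourier_0[OF assms] by (simp add: nn_integral_count_space_finite)
  also have "\<dots> \<le> energy \<omega> M"
    unfolding energy_eq by (rule nn_integral_count_space_le_UNIV)
  finally show ?thesis .
qed

lemma openin_circle_exhaustion:
  assumes "openin (top_of_set unit_circle) U"
  obtains D :: "nat \<Rightarrow> complex set" where "\<And>n. compact (D n)" "incseq D" "(\<Union>n. D n) = U"
proof -
  obtain V where V: "open V" "U = unit_circle \<inter> V" using assms by (auto simp: openin_open)
  obtain C where C: "\<And>n. compact (C n)" "\<And>n. C n \<subseteq> V" "\<And>n. C n \<subseteq> interior (C (Suc n))" "(\<Union>n. C n) = V"
    using open_Union_compact_subsets[OF V(1)] by metis
  show ?thesis
  proof (rule that[of "\<lambda>n. unit_circle \<inter> C n"])
    show "incseq (\<lambda>n. unit_circle \<inter> C n)"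
      using C(3) interior_subset by (intro incseq_SucI) blast
  qed (use C V in \<open>auto intro!: compact_Int\<close>)
qed

text \<open>A measure of finite energy has no atoms and hence does not charge the finite set A - U.
  Conditioning it on compact sets \<open>D n\<close> that exhaust U multiplies the energy by at most
  1 / (a n)^2, and the masses \<open>a n\<close> tend to 1.\<close>

lemma Cap_le_Cap_open:
  assumes W: "is_weight W" "cond_C2 W" and U: "openin (top_of_set unit_circle) U"
    and A: "A \<subseteq> unit_circle" "finite (A - U)"
  shows "Cap (moment W) A \<le> Cap (moment W) U"
proof (rule Cap_leI)
  fix K M assume K: "compact K" "K \<subseteq> A" and M: "M \<in> probs_on K"
  interpret M: prob_space M using M by (simp add: probs_on_def)
  have fM: "finite_measure M" by unfold_locales
  have sM: "sets M = sets circle_borel" using M by (simp add: probs_on_def)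
  have spM: "space M = unit_circle" using sets_eq_imp_space_eq[OF sM] by simp
  have U_sub: "U \<subseteq> unit_circle" using openin_imp_subset[OF U] .
  show "1 / energy (moment W) M \<le> Cap (moment W) U"
  proof (cases "energy (moment W) M = \<infinity>")
    case False
    then obtain e where e: "energy (moment W) M = ennreal e" "0 \<le> e" by (cases "energy (moment W) M") auto
    have "0 < e" using energy_ge[OF M.prob_space_axioms, of "moment W"] moment_pos[OF W, of 0] e
      by (metis ennreal_le_iff less_le_trans)
    obtain D where D: "\<And>n. compact (D n)" "incseq D" "(\<Union>n. D n) = U"
      using openin_circle_exhaustion[OF U] by blast
    have D_sets: "D n \<in> sets M" for n
      using D U_sub sM by (intro sets_circle_borel_compact[of "D n", folded sM]) auto
    have U_sets: "U \<in> sets M" unfolding D(3)[symmetric] using D_sets by auto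
    have "measure M (unit_circle - U) = 0"
    proof -
      have f_sets: "A - U \<in> sets M"
      proof -
        have "compact (A - U)" using A(2) by (rule finite_imp_compact)
        then show ?thesis using sets_circle_borel_compact[of "A - U"] A(1) sM by auto
      qed
      have "{a} \<in> sets M" if "a \<in> A" for a
        using sets_circle_borel_compact[of "{a}"] that A(1) sM by auto
      then have "measure M (A - U) = (\<Sum>a\<in>A - U. measure M {a})"
        using A(2) by (intro M.finite_measure_eq_sum_singleton) auto
      also have "\<dots> = 0"
      proof (intro sum.neutral ballI)
        fix x assume "x \<in> A - U"
        then have "cmod x = 1" using A(1) by auto
        then show "measure M {x} = 0" using energy_atom[OF W fM sM] False by blast
      qed
      finally have 1: "measure M (A - U) = 0" .
      have K_sets: "unit_circle - K \<in> sets M"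
        using sets.compl_sets[OF sets_circle_borel_compact[OF K(1)]] K(2) A(1) sM by auto
      have 2: "measure M (unit_circle - K) = 0" using M by (simp add: probs_on_def measure_def)
      have "measure M (unit_circle - U) \<le> measure M ((unit_circle - K) \<union> (A - U))"
        using K K_sets f_sets by (intro M.finite_measure_mono) auto
      also have "\<dots> \<le> 0" using measure_Un_le[OF K_sets f_sets] 1 2 by simp
      finally show ?thesis by (simp add: measure_le_0_iff)
    qed
    then have MU: "measure M U = 1"
      using M.prob_compl[OF U_sets] spM by simp
    define a where "a = (\<lambda>n. measure M (D n))"
    have "range D \<subseteq> sets M" using D_sets by auto
    then have a_lim: "a \<longlonglongrightarrow> 1"
      using M.finite_Lim_measure_incseq[of D] D(2,3) MU by (simp add: a_def)
    have "ennreal ((a n)\<^sup>2 / e) \<le> Cap (moment W) U" if "0 < a n" for n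
    proof -
      let ?N = "uniform_measure M (D n)"
      have em: "emeasure M (D n) = ennreal (a n)" by (simp add: a_def M.emeasure_eq_measure)
      have "prob_space ?N" using that em by (intro prob_space_uniform_measure) auto
      moreover have "emeasure ?N (unit_circle - D n) = 0"
        using D_sets[of n] sets.compl_sets[OF D_sets[of n]] spM by (subst emeasure_uniform_measure) auto
      ultimately have N: "?N \<in> probs_on (D n)" using sM by (simp add: probs_on_def)
      have four: "measure_fourier ?N k = measure_fourier (restr M (D n)) k / of_real (a n)" for k
      proof -
        have "?N = density M (\<lambda>x. ennreal (indicator (D n) x / a n))"
          unfolding uniform_measure_def em using that
          using D_sets[of n]
          by (intro density_cong AE_I2) (auto split: split_indicator simp: one_divide_ennreal
            intro!: borel_measurable_divide_ennreal borel_measurable_divide borel_measurable_indicator)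
        then have "measure_fourier ?N k = (LINT z|M. (indicator (D n) z / a n) *\<^sub>R z powi (-k))"
          unfolding measure_fourier_def using that D_sets power_int_measurable'[OF sM]
          by (simp add: integral_density)
        also have "\<dots> = (LINT z|M. (1 / a n) *\<^sub>R (indicator (D n) z *\<^sub>R z powi (-k)))"
          by (intro Bochner_Integration.integral_cong) auto
        also have "\<dots> = (1 / a n) *\<^sub>R (LINT z|M. indicator (D n) z *\<^sub>R z powi (-k))"
          by (rule integral_scaleR_right)
        also have "(LINT z|M. indicator (D n) z *\<^sub>R z powi (-k)) = measure_fourier (restr M (D n)) k"
          unfolding measure_fourier_def by (rule integral_restr[OF D_sets power_int_measurable'[OF sM], symmetric])
        finally show ?thesis by (simp add: scaleR_conv_of_real)
      qed
      have "energy (moment W) ?N = (\<integral>\<^sup>+k. ennreal (1 / (a n)\<^sup>2) * ennreal (moment W (nat \<bar>k\<bar>) * (cmod (measure_fourier (restr M (D n)) k))\<^sup>2) \<partial>count_space UNIV)"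
        unfolding energy_eq four using moment_pos[OF W]
        by (intro nn_integral_cong) (simp add: norm_divide power_divide less_imp_le flip: ennreal_mult)
      also have "\<dots> = ennreal (1 / (a n)\<^sup>2) * energy (moment W) (restr M (D n))"
        by (simp add: nn_integral_cmult energy_eq)
      also have "\<dots> \<le> ennreal (1 / (a n)\<^sup>2) * ennreal e"
        using energy_restr_le[OF W(1) fM sM D_sets[of n]] e by (intro mult_left_mono) auto
      also have "\<dots> = ennreal (e / (a n)\<^sup>2)" using e by (simp flip: ennreal_mult)
      finally have "1 / ennreal (e / (a n)\<^sup>2) \<le> 1 / energy (moment W) ?N"
        by (rule one_divide_antimono_ennreal)
      also have "\<dots> \<le> Cap (moment W) U" by (rule Cap_ge[OF D(1) _ N]) (use D(3) in auto)
      also have "1 / ennreal (e / (a n)\<^sup>2) = ennreal ((a n)\<^sup>2 / e)"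
        using that \<open>0 < e\<close> by (simp add: one_divide_ennreal)
      finally show ?thesis .
    qed
    moreover have "\<forall>\<^sub>F n in sequentially. 0 < a n" using order_tendstoD(1)[OF a_lim, of 0] by simp
    ultimately have "\<forall>\<^sub>F n in sequentially. ennreal ((a n)\<^sup>2 / e) \<le> Cap (moment W) U"
      by (auto elim: eventually_mono)
    moreover have "(\<lambda>n. ennreal ((a n)\<^sup>2 / e)) \<longlonglongrightarrow> ennreal (1\<^sup>2 / e)"
      using \<open>0 < e\<close> by (intro tendsto_ennrealI tendsto_intros a_lim) auto
    ultimately have "ennreal (1\<^sup>2 / e) \<le> Cap (moment W) U"
      by (intro tendsto_upperbound[of _ _ sequentially]) auto
    then show ?thesis using e \<open>0 < e\<close> by (simp add: one_divide_ennreal)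
  qed simp
qed

subsection \<open>Approximation by densities off \<open>E\<close>\<close>

lemma norm_square_le_dotp_count_space:
  assumes "L2 (count_space UNIV) v"
  shows "(cmod (v i))\<^sup>2 \<le> dotp (count_space UNIV) v v"
proof -
  have "nsq (v i) = (\<integral>\<^sup>+x. nsq (v x) \<partial>count_space {i})"
    by (simp add: nn_integral_count_space_finite)
  also have "\<dots> \<le> (\<integral>\<^sup>+x. nsq (v x) \<partial>count_space UNIV)"
    by (rule nn_integral_count_space_le_UNIV)
  also have "\<dots> = ennreal (dotp (count_space UNIV) v v)" by (rule nn_integral_square_eq_dotp[OF assms])
  finally show ?thesis using dotp_self_nonneg[of "count_space UNIV" v] by (simp add: ennreal_le_iff)
qed

text \<open>With the square root of \<omega> as a factor the energy becomes a squared norm for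
  counting measure, so that Hilbert space separation applies.\<close>

definition wcoeff :: "(nat \<Rightarrow> real) \<Rightarrow> (complex \<Rightarrow> complex) \<Rightarrow> int \<Rightarrow> complex" where
  "wcoeff \<omega> f n = of_real (sqrt (\<omega> (nat \<bar>n\<bar>))) * fun_fourier f n"

text \<open>Left unnormalised so as to form a cone; elements of positive mass, scaled to mass 1,
  compete in \<open>Cap\<close> of A.\<close>

definition nonneg_on :: "complex set \<Rightarrow> (complex \<Rightarrow> real) set" where
  "nonneg_on A = {g. L2 \<mu> (\<lambda>z. of_real (g z)) \<and> (\<forall>z. cmod z = 1 \<longrightarrow> 0 \<le> g z) \<and>
     (\<exists>K. compact K \<and> K \<subseteq> A \<and> (\<forall>z. cmod z = 1 \<longrightarrow> z \<notin> K \<longrightarrow> g z = 0))}"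

lemma of_real_measurable_iff:
  "(\<lambda>x. complex_of_real (g x)) \<in> borel_measurable M \<longleftrightarrow> g \<in> borel_measurable M"
proof
  assume "(\<lambda>x. complex_of_real (g x)) \<in> borel_measurable M"
  then have "(\<lambda>x. Re (complex_of_real (g x))) \<in> borel_measurable M" by measurable
  then show "g \<in> borel_measurable M" by simp
qed (rule of_real_measurable)

lemma L2_real_measurable: "L2 \<mu> (\<lambda>z. of_real (g z)) \<Longrightarrow> g \<in> borel_measurable circle_borel"
  using L2_measurable[of \<mu> "\<lambda>z. of_real (g z)"]
  by (simp add: of_real_measurable_iff borel_measurable_circle_eq[OF sets_circle_measure])

lemma nonneg_on_add: "f \<in> nonneg_on A \<Longrightarrow> g \<in> nonneg_on A \<Longrightarrow> (\<lambda>z. f z + g z) \<in> nonneg_on A"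
  unfolding nonneg_on_def mem_Collect_eq
proof (elim conjE exE, intro conjI allI impI)
  fix K L
  assume *: "L2 \<mu> (\<lambda>z. of_real (f z))" "L2 \<mu> (\<lambda>z. of_real (g z))"
    "\<forall>z. cmod z = 1 \<longrightarrow> 0 \<le> f z" "\<forall>z. cmod z = 1 \<longrightarrow> 0 \<le> g z"
    "compact K" "K \<subseteq> A" "\<forall>z. cmod z = 1 \<longrightarrow> z \<notin> K \<longrightarrow> f z = 0"
    "compact L" "L \<subseteq> A" "\<forall>z. cmod z = 1 \<longrightarrow> z \<notin> L \<longrightarrow> g z = 0"
  show "L2 \<mu> (\<lambda>z. of_real (f z + g z))" using L2_add[OF *(1,2)] by simp
  show "0 \<le> f z + g z" if "cmod z = 1" for z using * that by simp
  show "\<exists>K. compact K \<and> K \<subseteq> A \<and> (\<forall>z. cmod z = 1 \<longrightarrow> z \<notin> K \<longrightarrow> f z + g z = 0)"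
    using * by (intro exI[of _ "K \<union> L"]) auto
qed

lemma nonneg_on_scale: "0 \<le> c \<Longrightarrow> g \<in> nonneg_on A \<Longrightarrow> (\<lambda>z. c * g z) \<in> nonneg_on A"
  unfolding nonneg_on_def using L2_scale[of \<mu> "\<lambda>z. of_real (g z)" "of_real c"] by auto

lemma dotp_of_real_right: "dotp M f (\<lambda>z. of_real (g z)) = (LINT z|M. Re (f z) * g z)"
  by (simp add: dotp_def inner_complex_def)

text \<open>Isolates what the duality argument uses about the moments; the facts on restriction and
  atoms stay with the weight W itself.\<close>

locale dual_weights =
  fixes \<omega> \<Omega> :: "nat \<Rightarrow> real" and q :: real
  assumes \<omega>_pos: "0 < \<omega> n" and \<omega>_antimono: "m \<le> n \<Longrightarrow> \<omega> n \<le> \<omega> m"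
    and \<omega>_doubling: "\<omega> n \<le> q * \<omega> (2 * n)" and q_bounds: "1 \<le> q" "q < 4"
    and \<Omega>_eq: "\<Omega> n = 1 / \<omega> n"

sublocale dual_weights \<subseteq> doubling_weight \<Omega> q
proof
  fix m n :: nat
  show "0 < \<Omega> n" by (simp add: \<Omega>_eq \<omega>_pos)
  show "m \<le> n \<Longrightarrow> \<Omega> m \<le> \<Omega> n" by (simp add: \<Omega>_eq \<omega>_pos \<omega>_antimono frac_le)
  show "\<Omega> (2 * n) \<le> q * \<Omega> n"
    using \<omega>_doubling[of n] \<omega>_pos[of n] \<omega>_pos[of "2 * n"] by (simp add: \<Omega>_eq field_simps)
qed (use q_bounds in auto)

context dual_weights
begin

abbreviation N :: "int measure" where "N \<equiv> count_space UNIV"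

abbreviation cf :: "(complex \<Rightarrow> real) \<Rightarrow> int \<Rightarrow> complex" where
  "cf g \<equiv> wcoeff \<omega> (\<lambda>z. of_real (g z))"

lemma L2_weighted:
  assumes "L2 N v"
  shows "L2 N (\<lambda>n. of_real (sqrt (\<omega> (nat \<bar>n\<bar>))) * v n)"
proof (rule L2_bound[OF assms, where C="sqrt (\<omega> 0)"])
  show "AE n in N. cmod (of_real (sqrt (\<omega> (nat \<bar>n\<bar>))) * v n) \<le> sqrt (\<omega> 0) * cmod (v n)"
    using \<omega>_antimono[of 0] less_imp_le[OF \<omega>_pos]
    by (auto simp: norm_mult intro!: mult_right_mono)
qed simp

lemma L2_wcoeff: "L2 \<mu> f \<Longrightarrow> L2 N (wcoeff \<omega> f)"
  unfolding wcoeff_def[abs_def] by (intro L2_weighted L2_fun_fourier)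

lemma dotp_weighted: "dotp N (\<lambda>n. of_real (sqrt (\<omega> (nat \<bar>n\<bar>))) * v n) (fun_fourier g) = dotp N v (wcoeff \<omega> g)"
  by (simp add: dotp_def wcoeff_def inner_mult_left inner_mult_right flip: scaleR_conv_of_real)

lemma energy_wcoeff:
  assumes "L2 \<mu> f"
  shows "(\<integral>\<^sup>+n. ennreal (\<omega> (nat \<bar>n\<bar>) * (cmod (fun_fourier f n))\<^sup>2) \<partial>N) = ennreal (sqnorm N (wcoeff \<omega> f))"
  unfolding nn_integral_square_eq_dotp[OF L2_wcoeff[OF assms], symmetric] using less_imp_le[OF \<omega>_pos]
  by (intro nn_integral_cong) (simp add: wcoeff_def norm_mult power_mult_distrib)

lemma Cap_ge_density:
  assumes g: "g \<in> nonneg_on A" and A: "A \<subseteq> unit_circle"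
    and a: "a = (LINT z|\<mu>. g z)" "0 < a"
  shows "ennreal (a\<^sup>2 / sqnorm N (cf g)) \<le> Cap \<omega> A"
proof -
  obtain K where K: "compact K" "K \<subseteq> A" "\<And>z. cmod z = 1 \<Longrightarrow> z \<notin> K \<Longrightarrow> g z = 0"
    using g by (auto simp: nonneg_on_def)
  have L2g: "L2 \<mu> (\<lambda>z. of_real (g z))" using g by (simp add: nonneg_on_def)
  have K_sets: "K \<in> sets circle_borel" using K A by (intro sets_circle_borel_compact) auto
  define h where "h = (\<lambda>z. g z / a)"
  have h_eq: "(\<lambda>z. complex_of_real (h z)) = (\<lambda>z. of_real (1 / a) * of_real (g z))" by (auto simp: h_def)
  have L2h: "L2 \<mu> (\<lambda>z. complex_of_real (h z))" unfolding h_eq by (intro L2_scale L2g)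
  have int_h: "integrable \<mu> h"
    using L2_imp_integrable[OF L2h] unfolding complex_of_real_integrable_eq .
  have h: "h \<in> borel_measurable circle_borel" "\<And>z. cmod z = 1 \<Longrightarrow> 0 \<le> h z" "\<And>z. cmod z = 1 \<Longrightarrow> z \<notin> K \<Longrightarrow> h z = 0"
    "(LINT z|\<mu>. h z) = 1"
    using L2_real_measurable[OF L2h] g a K(3) by (auto simp: h_def nonneg_on_def)
  let ?M = "density \<mu> (\<lambda>z. ennreal (h z))"
  have M: "?M \<in> probs_on K" and M_four: "\<And>n. measure_fourier ?M n = fun_fourier (\<lambda>z. of_real (h z)) n"
    using density_probs_on[OF h(1,2,3) K_sets int_h h(4)] by auto
  have "cf h = (\<lambda>n. of_real (1 / a) * cf g n)"
    unfolding wcoeff_def h_eq fun_fourier_scale by (auto simp: mult_ac)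
  then have e_h: "sqnorm N (cf h) = sqnorm N (cf g) / a\<^sup>2"
    by (simp add: dotp_self norm_divide power_divide)
  have energy: "energy \<omega> ?M = ennreal (sqnorm N (cf h))"
    unfolding energy_eq M_four by (rule energy_wcoeff[OF L2h])
  have "prob_space ?M" using M by (simp add: probs_on_def)
  from energy_ge[OF this, of \<omega>] have "\<omega> 0 \<le> sqnorm N (cf h)"
    unfolding energy by (simp add: dotp_self_nonneg)
  then have pos: "0 < sqnorm N (cf h)" using \<omega>_pos[of 0] by linarith
  have "ennreal (a\<^sup>2 / sqnorm N (cf g)) = 1 / energy \<omega> ?M"
    unfolding energy one_divide_ennreal[OF pos] using a(2) e_h by simp
  also have "\<dots> \<le> Cap \<omega> A" by (rule Cap_ge[OF K(1,2) M])
  finally show ?thesis .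
qed

text \<open>The approximants have mass near 1 only: convergence in the energy norm controls the
  coefficient at 0, because \<omega> 0 > 0, so normalising changes their energy by a factor tending
  to 1.\<close>

lemma Cap_ge_limit:
  assumes g0: "L2 \<mu> (\<lambda>z. of_real (g0 z))" "fun_fourier (\<lambda>z. of_real (g0 z)) 0 = 1"
    and A: "A \<subseteq> unit_circle"
    and approx: "\<And>e. e > 0 \<Longrightarrow> \<exists>g\<in>nonneg_on A. sqnorm N (\<lambda>n. cf g0 n - cf g n) < e"
  shows "1 / ennreal (sqnorm N (cf g0)) \<le> Cap \<omega> A"
proof -
  have "\<exists>g\<in>nonneg_on A. sqnorm N (\<lambda>n. cf g0 n - cf g n) < inverse (real (Suc k))" for k
    by (rule approx) simp
  then obtain g where g: "\<And>k. g k \<in> nonneg_on A"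
    and g_less: "\<And>k. sqnorm N (\<lambda>n. cf g0 n - cf (g k) n) < inverse (real (Suc k))"
    by metis
  have L2g: "L2 \<mu> (\<lambda>z. of_real (g k z))" for k using g by (simp add: nonneg_on_def)
  define d where "d k = sqnorm N (\<lambda>n. cf (g k) n - cf g0 n)" for k
  have d_eq: "d k = sqnorm N (\<lambda>n. cf g0 n - cf (g k) n)" for k
    unfolding d_def dotp_self by (simp add: norm_minus_commute)
  have d_lim: "d \<longlonglongrightarrow> 0"
    using g_less less_imp_le dotp_self_nonneg unfolding d_eq[abs_def]
    by (intro tendsto_sandwich[OF _ _ tendsto_const LIMSEQ_inverse_real_of_nat] always_eventually) auto
  have e_lim: "(\<lambda>k. sqnorm N (cf (g k))) \<longlonglongrightarrow> sqnorm N (cf g0)"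
    using d_lim unfolding d_def[abs_def] by (intro dotp_self_tendsto L2_wcoeff L2g g0)
  define a where "a k = (LINT z|\<mu>. g k z)" for k
  have sq: "(a k - 1)\<^sup>2 * \<omega> 0 \<le> d k" for k
  proof -
    have "cf (g k) 0 - cf g0 0 = of_real (sqrt (\<omega> 0) * (a k - 1))"
      using g0(2) by (simp add: wcoeff_def fun_fourier_0 a_def algebra_simps)
    then have "(cmod (cf (g k) 0 - cf g0 0))\<^sup>2 = (a k - 1)\<^sup>2 * \<omega> 0"
      using less_imp_le[OF \<omega>_pos[of 0]] by (simp add: power_mult_distrib del: of_real_mult of_real_diff)
    then show ?thesis
      using norm_square_le_dotp_count_space[OF L2_diff[OF L2_wcoeff[OF L2g[of k]] L2_wcoeff[OF g0(1)]], of 0]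
      by (simp add: d_def)
  qed
  have "(\<lambda>k. (a k - 1)\<^sup>2) \<longlonglongrightarrow> 0"
  proof (rule tendsto_sandwich[OF _ _ tendsto_const])
    show "(\<lambda>k. d k / \<omega> 0) \<longlonglongrightarrow> 0" using tendsto_divide[OF d_lim tendsto_const, of "\<omega> 0"] \<omega>_pos[of 0] by simp
    show "\<forall>\<^sub>F k in sequentially. (a k - 1)\<^sup>2 \<le> d k / \<omega> 0"
      using sq \<omega>_pos[of 0] by (simp add: field_simps)
  qed simp
  then have "(\<lambda>k. a k - 1) \<longlonglongrightarrow> 0" by simp
  then have a_lim: "a \<longlonglongrightarrow> 1" by (simp add: LIM_zero_iff)
  have "\<omega> 0 \<le> sqnorm N (cf g0)"
    using norm_square_le_dotp_count_space[OF L2_wcoeff[OF g0(1)], of 0] g0(2) \<omega>_pos[of 0]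
    by (simp add: wcoeff_def)
  then have pos: "0 < sqnorm N (cf g0)" using \<omega>_pos[of 0] by linarith
  have "\<forall>\<^sub>F k in sequentially. 0 < a k" using order_tendstoD(1)[OF a_lim, of 0] by simp
  then have "\<forall>\<^sub>F k in sequentially. ennreal ((a k)\<^sup>2 / sqnorm N (cf (g k))) \<le> Cap \<omega> A"
    by eventually_elim (intro Cap_ge_density g A a_def)
  moreover have "(\<lambda>k. ennreal ((a k)\<^sup>2 / sqnorm N (cf (g k)))) \<longlonglongrightarrow> ennreal (1\<^sup>2 / sqnorm N (cf g0))"
    using pos by (intro tendsto_ennrealI tendsto_intros a_lim e_lim) auto
  ultimately have "ennreal (1\<^sup>2 / sqnorm N (cf g0)) \<le> Cap \<omega> A"
    by (intro tendsto_upperbound[of _ _ sequentially]) auto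
  then show ?thesis by (simp add: one_divide_ennreal[OF pos])
qed

text \<open>A separating vector corresponds to an \<open>f\<close> in the dual space which is nonpositive on \<open>U - E\<close>
  but not on \<open>U\<close>. As the Dirichlet form decreases under contractions, its positive part, localised to
  \<open>U\<close>, is a nontrivial element of the dual space supported on \<open>E\<close>.\<close>

lemma approximation:
  assumes uniq: "\<And>f. in_ell2 \<Omega> f \<Longrightarrow> supports E f \<Longrightarrow> AE z in \<mu>. f z = 0"
    and E: "compact E" and U: "openin (top_of_set unit_circle) U"
    and g0: "L2 \<mu> (\<lambda>z. of_real (g0 z))" "\<And>z. cmod z = 1 \<Longrightarrow> 0 \<le> g0 z"
      "\<And>z. cmod z = 1 \<Longrightarrow> z \<notin> U \<Longrightarrow> g0 z = 0"
    and e: "e > 0"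
  shows "\<exists>g\<in>nonneg_on (U - E). sqnorm N (\<lambda>n. cf g0 n - cf g n) < e"
proof (rule ccontr)
  assume *: "\<not> ?thesis"
  have U_sub: "U \<subseteq> unit_circle" using openin_imp_subset[OF U] .
  define C where "C = cf ` nonneg_on (U - E)"
  have L2n: "L2 \<mu> (\<lambda>z. of_real (g z))" if "g \<in> nonneg_on A" for g A
    using that by (simp add: nonneg_on_def)
  obtain v where v: "L2 N v" "\<And>a. a \<in> C \<Longrightarrow> dotp N v a \<le> 0" "dotp N v (cf g0) > 0"
  proof (rule L2_cone_separation[of N "cf g0" C e])
    show "L2 N (cf g0)" by (intro L2_wcoeff g0)
    show "L2 N a" if "a \<in> C" for a using that L2n by (auto simp: C_def intro!: L2_wcoeff)
    have "(\<lambda>z. 0) \<in> nonneg_on (U - E)" by (auto simp: nonneg_on_def intro!: exI[of _ "{}"])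
    then show "C \<noteq> {}" by (auto simp: C_def)
    show "(\<lambda>n. a n + b n) \<in> C" if "a \<in> C" "b \<in> C" for a b
    proof -
      from that obtain f g where fg: "f \<in> nonneg_on (U - E)" "g \<in> nonneg_on (U - E)" "a = cf f" "b = cf g"
        by (auto simp: C_def)
      have eq: "(\<lambda>n. a n + b n) = cf (\<lambda>z. f z + g z)"
        using fun_fourier_add[OF L2n[OF fg(1)] L2n[OF fg(2)]]
        by (auto simp: fg wcoeff_def algebra_simps)
      show ?thesis unfolding eq C_def by (intro imageI nonneg_on_add fg)
    qed
    show "(\<lambda>n. complex_of_real r * a n) \<in> C" if "0 \<le> r" "a \<in> C" for r a
    proof -
      from that obtain g where g: "g \<in> nonneg_on (U - E)" "a = cf g" by (auto simp: C_def)
      have eq: "(\<lambda>n. complex_of_real r * a n) = cf (\<lambda>z. r * g z)"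
        by (auto simp: g wcoeff_def fun_fourier_scale)
      show ?thesis unfolding eq C_def by (intro imageI nonneg_on_scale that g)
    qed
    show "e \<le> sqnorm N (\<lambda>n. cf g0 n - a n)" if "a \<in> C" for a
      using that * by (auto simp: C_def not_less)
  qed (use e in auto)
  \<comment> \<open>The factor sqrt \<omega> puts f into the dual space, since |f^(n)|^2 \<Omega>
    becomes |v n|^2, and turns the L2 pairing of f with g into that of v with the weighted
    coefficients of g.\<close>
  obtain f where f: "L2 \<mu> f" "fun_fourier f = (\<lambda>n. of_real (sqrt (\<omega> (nat \<bar>n\<bar>))) * v n)"
    using Riesz_Fischer[OF L2_weighted[OF v(1)]] by blast
  have [measurable]: "f \<in> borel_measurable circle_borel" using L2_measurable[OF f(1)] by simp
  have dotf: "dotp \<mu> f g = dotp N v (wcoeff \<omega> g)" if "L2 \<mu> g" for g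
    unfolding Parseval[OF f(1) that] f(2) by (rule dotp_weighted)
  have "in_ell2 \<Omega> f"
  proof -
    have "(cmod (fun_fourier f n))\<^sup>2 * \<Omega> (nat \<bar>n\<bar>) = (cmod (v n))\<^sup>2" for n
      using \<omega>_pos[of "nat \<bar>n\<bar>"] by (simp add: f(2) \<Omega>_eq norm_mult power_mult_distrib)
    then show ?thesis using v(1) f(1) by (simp add: in_ell2_def in_L2_iff L2_count_space_iff)
  qed
  define p where "p z = max 0 (Re (f z))" for z
  have [measurable]: "p \<in> borel_measurable circle_borel" unfolding p_def[abs_def] by measurable
  have p_le: "\<bar>p z\<bar> \<le> cmod (f z)" for z
    using abs_Re_le_cmod[of "f z"] by (auto simp: p_def max_def)
  have p_zero: "AE z in \<mu>. z \<in> K \<longrightarrow> p z = 0" if K: "compact K" "K \<subseteq> U - E" for K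
  proof -
    have K_sets: "K \<in> sets circle_borel" using K U_sub by (intro sets_circle_borel_compact) auto
    \<comment> \<open>The positive part cut off to K is itself an admissible density. Its pairing
      with f is nonpositive, yet the integrand is p^2 on K.\<close>
    define g where "g z = indicator K z * p z" for z
    have g_meas: "g \<in> borel_measurable circle_borel"
      unfolding g_def[abs_def] using K_sets by (intro borel_measurable_times) auto
    have L2g: "L2 \<mu> (\<lambda>z. of_real (g z))"
    proof (rule L2_bound[OF f(1), where C=1])
      show "AE z in \<mu>. cmod (of_real (g z)) \<le> 1 * cmod (f z)"
        using p_le by (auto simp: g_def abs_mult split: split_indicator)
    qed (use of_real_measurable[OF g_meas] in simp)
    have "g \<in> nonneg_on (U - E)"
      using L2g K by (auto simp: nonneg_on_def g_def p_def intro!: exI[of _ K])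
    then have "dotp \<mu> f (\<lambda>z. of_real (g z)) \<le> 0"
      unfolding dotf[OF L2g] by (intro v(2)) (auto simp: C_def)
    moreover have fg_nonneg: "0 \<le> Re (f z) * g z" for z
      by (auto simp: g_def p_def max_def split: split_indicator)
    ultimately have "(LINT z|\<mu>. Re (f z) * g z) = 0"
      unfolding dotp_of_real_right by (intro antisym integral_nonneg) auto
    moreover have "integrable \<mu> (\<lambda>z. Re (f z) * g z)"
      using L2_integrable_dotp[OF f(1) L2g] by (simp add: inner_complex_def)
    ultimately have "AE z in \<mu>. Re (f z) * g z = 0"
      using fg_nonneg by (subst (asm) integral_nonneg_eq_0_iff_AE) auto
    then show ?thesis by eventually_elim (auto simp: g_def p_def max_def split: if_splits)
  qed
  have p_zero_UE: "AE z in \<mu>. z \<in> U - E \<longrightarrow> p z = 0"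
  proof -
    have "openin (top_of_set unit_circle) (U - E)"
    proof -
      obtain V where "open V" "U = unit_circle \<inter> V" using U by (auto simp: openin_open)
      then show ?thesis
        using E unfolding openin_open by (intro exI[of _ "V - E"]) (auto intro!: open_Diff compact_imp_closed)
    qed
    then obtain D where D: "\<And>n. compact (D n)" "incseq D" "(\<Union>n. D n) = U - E"
      using openin_circle_exhaustion by blast
    have "AE z in \<mu>. \<forall>n. z \<in> D n \<longrightarrow> p z = 0"
      unfolding AE_all_countable using D by (auto intro!: p_zero)
    then show ?thesis unfolding D(3)[symmetric] by eventually_elim auto
  qed
  \<comment> \<open>A Lipschitz cutoff vanishing exactly off U. \<open>infdist\<close> to the empty
    set is 0, so the case where U is the whole circle needs a separate value.\<close>
  define \<delta> where "\<delta> z = (if unit_circle - U = {} then 1 else infdist z (unit_circle - U))" for z :: complex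
  have \<delta>_bound: "\<bar>\<delta> z\<bar> \<le> 2" if "cmod z = 1" for z
  proof (cases "unit_circle - U = {}")
    case False
    then obtain w where w: "w \<in> unit_circle - U" by blast
    have "infdist z (unit_circle - U) \<le> dist z w" by (rule infdist_le[OF w])
    also have "\<dots> \<le> 2" using that w norm_triangle_ineq4[of z w] by (simp add: dist_norm)
    finally show ?thesis using infdist_nonneg[of z] by (simp add: \<delta>_def)
  qed (simp add: \<delta>_def)
  have \<delta>_Lipschitz: "\<bar>\<delta> w - \<delta> z\<bar> \<le> cmod (w - z)" for w z
    using infdist_triangle_abs[of w "unit_circle - U" z] by (simp add: \<delta>_def dist_norm)
  have closed: "closed (unit_circle - U)"
    using U by (metis closedin_diff closedin_topspace topspace_euclidean_subtopology closedin_closed_trans closed_sphere)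
  have \<delta>_zero: "\<delta> z = 0 \<longleftrightarrow> z \<notin> U" if "cmod z = 1" for z
    using in_closed_iff_infdist_zero[OF closed, of z] that by (auto simp: \<delta>_def)
  have [measurable]: "\<delta> \<in> borel_measurable circle_borel"
  proof (rule circle_borel_measurable_continuous)
    show "continuous_on unit_circle \<delta>"
      unfolding \<delta>_def[abs_def] by (cases "unit_circle - U = {}") (simp_all, intro continuous_intros)
  qed
  define h where "h z = complex_of_real (\<delta> z * p z)" for z
  have L2h: "L2 \<mu> h"
  proof (rule L2_bound[OF f(1), where C=2])
    show "h \<in> borel_measurable \<mu>"
      unfolding h_def[abs_def] by (intro of_real_measurable) simp
    show "AE z in \<mu>. cmod (h z) \<le> 2 * cmod (f z)"
    proof (rule AE_I2)
      fix z assume "z \<in> space \<mu>"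
      then have "\<bar>\<delta> z\<bar> * \<bar>p z\<bar> \<le> 2 * cmod (f z)" using p_le \<delta>_bound by (intro mult_mono) auto
      then show "cmod (h z) \<le> 2 * cmod (f z)" by (simp add: h_def abs_mult norm_mult)
    qed
  qed
  \<comment> \<open>Taking positive parts is a contraction and \<delta> is Lipschitz, so the Leibniz
    splitting of \<delta> p fits \<open>in_ell2_contraction\<close>.\<close>
  have "in_ell2 \<Omega> h"
  proof (rule in_ell2_contraction[OF \<open>in_ell2 \<Omega> f\<close> L2h])
    fix z w :: complex assume zw: "cmod z = 1" "cmod w = 1"
    have "cmod (h w - h z) = \<bar>\<delta> w * p w - \<delta> z * p z\<bar>"
      unfolding h_def of_real_diff[symmetric] norm_of_real ..
    also have "\<delta> w * p w - \<delta> z * p z = \<delta> w * (p w - p z) + (\<delta> w - \<delta> z) * p z" by (simp add: algebra_simps)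
    also have "\<bar>\<dots>\<bar> \<le> \<bar>\<delta> w\<bar> * \<bar>p w - p z\<bar> + \<bar>\<delta> w - \<delta> z\<bar> * \<bar>p z\<bar>"
      by (rule order_trans[OF abs_triangle_ineq]) (simp add: abs_mult)
    also have "\<dots> \<le> 2 * cmod (f w - f z) + 1 * cmod (w - z) * cmod (f z)"
    proof (intro add_mono mult_mono)
      have "\<bar>p w - p z\<bar> \<le> \<bar>Re (f w - f z)\<bar>" by (auto simp: p_def max_def)
      then show "\<bar>p w - p z\<bar> \<le> cmod (f w - f z)" using abs_Re_le_cmod[of "f w - f z"] by linarith
    qed (use zw \<delta>_bound \<delta>_Lipschitz p_le in auto)
    finally show "cmod (h w - h z) \<le> 2 * cmod (f w - f z) + 1 * cmod (w - z) * cmod (f z)" .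
  qed auto
  moreover have "supports E h"
    unfolding supports_def using p_zero_UE AE_space
  proof eventually_elim
    case (elim z)
    then show ?case using \<delta>_zero[of z] by (auto simp: h_def)
  qed
  ultimately have "AE z in \<mu>. h z = 0" by (rule uniq)
  \<comment> \<open>On U the cutoff \<delta> is nonzero, so h = 0 forces Re f \<le> 0 there; off U
    the density g0 is zero. This contradicts the separation.\<close>
  then have "AE z in \<mu>. Re (f z) * g0 z \<le> 0"
    using AE_space
  proof eventually_elim
    case (elim z)
    then have z: "cmod z = 1" by simp
    show ?case
    proof (cases "z \<in> U")
      case True
      then have "p z = 0" using elim(1) \<delta>_zero[OF z] by (simp add: h_def)
      then have "Re (f z) \<le> 0" by (simp add: p_def max_def split: if_splits)
      then show ?thesis using g0(2)[OF z] by (rule mult_nonpos_nonneg)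
    qed (simp add: g0(3)[OF z])
  qed
  then have "0 \<le> (LINT z|\<mu>. - (Re (f z) * g0 z))"
    by (intro integral_nonneg_AE) (auto elim: eventually_mono)
  then have "dotp \<mu> f (\<lambda>z. of_real (g0 z)) \<le> 0"
    unfolding dotp_of_real_right by simp
  then show False using v(3) dotf[OF g0(1)] by simp
qed

text \<open>Mollifying first replaces M by a square-integrable density in U of no larger energy,
  which \<open>approximation\<close> then moves off E.\<close>

lemma Cap_open_diff:
  assumes uniq: "\<And>f. in_ell2 \<Omega> f \<Longrightarrow> supports E f \<Longrightarrow> AE z in \<mu>. f z = 0"
    and E: "compact E" and U: "openin (top_of_set unit_circle) U"
  shows "Cap \<omega> U \<le> Cap \<omega> (U - E)"
proof (rule Cap_leI)
  fix K M assume K: "compact K" "K \<subseteq> U" and M: "M \<in> probs_on K"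
  have U_sub: "U \<subseteq> unit_circle" using openin_imp_subset[OF U] .
  from mollify[OF M K U] obtain g K' where g: "L2 \<mu> (\<lambda>z. of_real (g z))"
    "\<And>z. cmod z = 1 \<Longrightarrow> 0 \<le> g z" "K' \<subseteq> U" "\<And>z. cmod z = 1 \<Longrightarrow> z \<notin> K' \<Longrightarrow> g z = 0"
    "fun_fourier (\<lambda>z. of_real (g z)) 0 = 1"
    "\<And>n. cmod (fun_fourier (\<lambda>z. of_real (g z)) n) \<le> cmod (measure_fourier M n)"
    by metis
  have "ennreal (sqnorm N (cf g)) \<le> energy \<omega> M"
    unfolding energy_eq energy_wcoeff[OF g(1), symmetric]
    using g(6) less_imp_le[OF \<omega>_pos] by (intro nn_integral_mono ennreal_leI mult_left_mono power_mono) auto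
  then have "1 / energy \<omega> M \<le> 1 / ennreal (sqnorm N (cf g))" by (rule one_divide_antimono_ennreal)
  also have "\<dots> \<le> Cap \<omega> (U - E)"
    using U_sub g(3,4) by (intro Cap_ge_limit g approximation[OF uniq E U]) auto
  finally show "1 / energy \<omega> M \<le> Cap \<omega> (U - E)" .
qed

section \<open>Uniqueness from full capacity of the complement\<close>

lemma in_ell2_mult:
  assumes f: "in_ell2 \<Omega> f" and [measurable]: "u \<in> borel_measurable circle_borel"
    and u: "\<And>z. cmod z = 1 \<Longrightarrow> cmod (u z) \<le> 1" "\<And>z w. cmod z = 1 \<Longrightarrow> cmod w = 1 \<Longrightarrow> cmod (u w - u z) \<le> L * cmod (w - z)"
    and L: "0 \<le> L"
  shows "in_ell2 \<Omega> (\<lambda>z. u z * f z)"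
proof (rule in_ell2_contraction[OF f, where B=1 and L=L])
  show "L2 \<mu> (\<lambda>z. u z * f z)" using f u by (intro L2_mult_bounded) (auto simp: in_ell2_iff)
  fix z w :: complex assume zw: "cmod z = 1" "cmod w = 1"
  have "u w * f w - u z * f z = u w * (f w - f z) + (u w - u z) * f z" by (simp add: algebra_simps)
  then have "cmod (u w * f w - u z * f z) \<le> cmod (u w) * cmod (f w - f z) + cmod (u w - u z) * cmod (f z)"
    by (metis norm_mult norm_triangle_ineq)
  also have "\<dots> \<le> 1 * cmod (f w - f z) + L * cmod (w - z) * cmod (f z)"
    using u zw by (intro add_mono mult_right_mono) auto
  finally show "cmod (u w * f w - u z * f z) \<le> 1 * cmod (f w - f z) + L * cmod (w - z) * cmod (f z)" .
qed (use L in auto)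

lemma power_int_Lipschitz:
  assumes "cmod z = 1" "cmod w = 1"
  shows "cmod (w powi n - z powi n) \<le> \<bar>of_int n\<bar> * cmod (w - z)"
proof -
  have pow: "cmod (b ^ k - a ^ k) \<le> real k * cmod (b - a)" if "cmod a = 1" "cmod b = 1" for a b :: complex and k
    using norm_power_diff[of b a k] that by simp
  show ?thesis
  proof (cases "0 \<le> n")
    case True
    then show ?thesis using pow[OF assms, of "nat n"] by (simp add: power_int_def)
  next
    case False
    have "inverse w = cnj w" "inverse z = cnj z"
      using cnj_power_int_circle[OF assms(1), of 1] cnj_power_int_circle[OF assms(2), of 1] by (simp_all add: power_int_minus)
    then show ?thesis using pow[of "cnj z" "cnj w" "nat (- n)"] False assms
      by (simp add: power_int_def flip: complex_cnj_diff)
  qed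
qed

text \<open>A density g of mass 1 with energy below \<omega> 0 + e is at squared energy distance
  less than e from the constant 1. If g lives off E, then F pairs to zero with it, and
  Cauchy-Schwarz bounds the square of Re F^(0) by a multiple of e. Multiplying f by c z^(-n), which
  preserves the dual space and the support, moves every coefficient to position 0.\<close>

lemma capacity_imp_unique:
  assumes cap: "1 / ennreal (\<omega> 0) \<le> Cap \<omega> (unit_circle - E)" and E: "compact E"
    and f: "in_ell2 \<Omega> f" and supp: "supports E f"
  shows "AE z in \<mu>. f z = 0"
proof (rule fun_fourier_zero_imp_zero)
  show L2f: "L2 \<mu> f" using f by (simp add: in_ell2_iff)
  have U: "openin (top_of_set unit_circle) (unit_circle - E)"
    unfolding openin_open using E by (intro exI[of _ "- E"]) (auto intro: compact_imp_closed)
  have zero: "Re (fun_fourier F 0) = 0" if F: "in_ell2 \<Omega> F" "supports E F" for F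
  proof -
    have L2F: "L2 \<mu> F" using F by (simp add: in_ell2_iff)
    \<comment> \<open>With the factor sqrt \<Omega>, the L2 pairing of F with g becomes a pairing of
      v with the weighted coefficients of g, which Cauchy-Schwarz bounds by the energy of g.\<close>
    define v where "v n = of_real (sqrt (\<Omega> (nat \<bar>n\<bar>))) * fun_fourier F n" for n
    have "(cmod (v n))\<^sup>2 = (cmod (fun_fourier F n))\<^sup>2 * \<Omega> (nat \<bar>n\<bar>)" for n
      using less_imp_le[OF pos] by (simp add: v_def norm_mult power_mult_distrib)
    then have L2v: "L2 N v" using F(1) by (simp add: L2_count_space_iff in_ell2_def)
    have F_v: "fun_fourier F = (\<lambda>n. of_real (sqrt (\<omega> (nat \<bar>n\<bar>))) * v n)"
    proof
      fix n
      have "sqrt (\<omega> (nat \<bar>n\<bar>)) * sqrt (\<Omega> (nat \<bar>n\<bar>)) = 1"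
        using \<omega>_pos[of "nat \<bar>n\<bar>"] by (simp add: \<Omega>_eq flip: real_sqrt_mult)
      then have "complex_of_real (sqrt (\<omega> (nat \<bar>n\<bar>))) * complex_of_real (sqrt (\<Omega> (nat \<bar>n\<bar>))) = 1"
        by (simp flip: of_real_mult)
      then show "fun_fourier F n = of_real (sqrt (\<omega> (nat \<bar>n\<bar>))) * v n" by (simp add: v_def flip: mult.assoc)
    qed
    have dotF: "dotp \<mu> F g = dotp N v (wcoeff \<omega> g)" if "L2 \<mu> g" for g
      unfolding Parseval[OF L2F that] by (subst F_v) (rule dotp_weighted)
    let ?one = "\<lambda>z::complex. 1 :: complex"
    have one: "L2 \<mu> ?one" by (intro L2_bounded[where B=1]) auto
    have dot_one: "dotp \<mu> g ?one = Re (fun_fourier g 0)" if "L2 \<mu> g" for g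
      using dotp_power[OF that, of 1 0] by (simp add: inner_complex_def)
    have four_one: "fun_fourier ?one n = (if n = 0 then 1 else 0)" for n
      using fun_fourier_power[of 1 0 n] by simp
    have wone: "dotp N (wcoeff \<omega> g) (wcoeff \<omega> ?one) = \<omega> 0 * Re (fun_fourier g 0)" if g: "L2 \<mu> g" for g
    proof -
      have "dotp N (wcoeff \<omega> g) (wcoeff \<omega> ?one) = (LINT n|N. \<omega> 0 * (fun_fourier g n \<bullet> fun_fourier ?one n))"
        unfolding dotp_def using less_imp_le[OF \<omega>_pos[of 0]]
        by (intro Bochner_Integration.integral_cong) (auto simp: wcoeff_def four_one inner_mult_left inner_complex_def)
      also have "\<dots> = \<omega> 0 * dotp N (fun_fourier g) (fun_fourier ?one)" by (simp add: dotp_def)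
      also have "\<dots> = \<omega> 0 * Re (fun_fourier g 0)" unfolding Parseval[OF g one, symmetric] dot_one[OF g] ..
      finally show ?thesis .
    qed
    have "(Re (fun_fourier F 0))\<^sup>2 \<le> e * dotp N v v" if e: "0 < e" for e
    proof -
      \<comment> \<open>The capacity strictly exceeds 1 / (\<omega> 0 + e), so the supremum yields a
        measure of energy below \<omega> 0 + e.\<close>
      have lt: "1 / ennreal (\<omega> 0 + e) < 1 / ennreal (\<omega> 0)"
        using e \<omega>_pos[of 0]
        unfolding one_divide_ennreal[OF \<omega>_pos] one_divide_ennreal[OF add_pos_pos[OF \<omega>_pos e]]
        by (subst ennreal_less_iff) (auto intro!: frac_less2)
      then have "1 / ennreal (\<omega> 0 + e) < Cap \<omega> (unit_circle - E)" using cap by (rule less_le_trans)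
      then obtain K M where K: "compact K" "K \<subseteq> unit_circle - E" and M: "M \<in> probs_on K"
        and less: "1 / ennreal (\<omega> 0 + e) < 1 / energy \<omega> M"
        unfolding Cap_def Cap_compact_def less_SUP_iff by blast
      have energy_less: "energy \<omega> M < ennreal (\<omega> 0 + e)"
        using less one_divide_antimono_ennreal[of "ennreal (\<omega> 0 + e)" "energy \<omega> M"] by (meson leD leI)
      from mollify[OF M K U] obtain g K' where g: "L2 \<mu> (\<lambda>z. of_real (g z))"
        "K' \<subseteq> unit_circle - E" "\<And>z. cmod z = 1 \<Longrightarrow> z \<notin> K' \<Longrightarrow> g z = 0"
        "fun_fourier (\<lambda>z. of_real (g z)) 0 = 1"
        "\<And>n. cmod (fun_fourier (\<lambda>z. of_real (g z)) n) \<le> cmod (measure_fourier M n)"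
        by metis
      have "ennreal (sqnorm N (cf g)) \<le> energy \<omega> M"
        unfolding energy_eq energy_wcoeff[OF g(1), symmetric]
        using g(5) less_imp_le[OF \<omega>_pos] by (intro nn_integral_mono ennreal_leI mult_left_mono power_mono) auto
      also note energy_less
      finally have cf_less: "sqnorm N (cf g) < \<omega> 0 + e"
        using dotp_self_nonneg[of N "cf g"] by (simp add: ennreal_less_iff)
      let ?d = "\<lambda>n. cf g n + of_real (-1) * wcoeff \<omega> ?one n"
      have "dotp \<mu> F (\<lambda>z. of_real (g z)) = (LINT z|\<mu>. 0)"
        unfolding dotp_of_real_right
      proof (rule integral_cong_AE)
        show "AE z in \<mu>. Re (F z) * g z = 0"
          using F(2)[unfolded supports_def] AE_space
        proof eventually_elim
          case (elim z)
          then show ?case using g(2) g(3)[of z] by (cases "z \<in> K'") auto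
        qed
        show "(\<lambda>z. Re (F z) * g z) \<in> borel_measurable \<mu>"
          using L2_measurable[OF L2F] L2_real_measurable[OF g(1)] by measurable
      qed simp
      then have "dotp N v (cf g) = 0" using dotF[OF g(1)] by simp
      moreover have "dotp N v (wcoeff \<omega> ?one) = Re (fun_fourier F 0)"
        using dotF[OF one] dot_one[OF L2F] by simp
      moreover have L2d: "L2 N ?d" by (intro L2_add L2_scale L2_wcoeff g one)
      moreover have "dotp N ?d v = dotp N (cf g) v + dotp N (\<lambda>n. of_real (-1) * wcoeff \<omega> ?one n) v"
        by (intro dotp_add_left L2_scale L2_wcoeff g one L2v)
      ultimately have "dotp N ?d v = - Re (fun_fourier F 0)"
        unfolding dotp_scale_left by (simp add: dotp_commute[of N _ v])
      \<comment> \<open>Expands to the energy of g minus 2 \<omega> 0 plus \<omega> 0, since g and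
        the constant both have mean 1.\<close>
      moreover have "dotp N ?d ?d < e"
      proof -
        have "dotp N ?d ?d = sqnorm N (cf g) + 2 * (-1) * dotp N (cf g) (wcoeff \<omega> ?one) + (-1)\<^sup>2 * sqnorm N (wcoeff \<omega> ?one)"
          by (intro dotp_add_scale_self L2_wcoeff g one)
        then show ?thesis using cf_less wone[OF g(1)] wone[OF one] g(4) four_one[of 0] by simp
      qed
      ultimately show ?thesis
        using dotp_Cauchy_Schwarz[OF L2d L2v] mult_right_mono[of "dotp N ?d ?d" e "dotp N v v"] dotp_self_nonneg[of N v]
        by simp
    qed
    then have "(Re (fun_fourier F 0))\<^sup>2 \<le> 0" by (intro le_zero_if_le_small_multiples) auto
    then show ?thesis by simp
  qed
  show "fun_fourier f n = 0" for n
  proof -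
    \<comment> \<open>The factors c = 1 and c = \<i> give the real and the imaginary part.\<close>
    have *: "Re (c * fun_fourier f n) = 0" if c: "cmod c = 1" for c
    proof -
      have "in_ell2 \<Omega> (\<lambda>z. (c * z powi (-n)) * f z)"
      proof (rule in_ell2_mult[OF f, where L="\<bar>of_int n\<bar>"])
        fix z w :: complex assume zw: "cmod z = 1" "cmod w = 1"
        show "cmod (c * z powi (-n)) \<le> 1" using c zw by (simp only: norm_mult norm_power_int_circle)
        have "cmod (c * w powi (-n) - c * z powi (-n)) = cmod (w powi (-n) - z powi (-n))"
          using c by (simp only: norm_mult mult_1 flip: right_diff_distrib)
        then show "cmod (c * w powi (-n) - c * z powi (-n)) \<le> \<bar>of_int n\<bar> * cmod (w - z)"
          using power_int_Lipschitz[OF zw, of "-n"] by simp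
      qed (use power_int_measurable[of "-n"] in auto)
      moreover have "supports E (\<lambda>z. (c * z powi (-n)) * f z)"
        using supp unfolding supports_def by eventually_elim auto
      ultimately have "Re (fun_fourier (\<lambda>z. (c * z powi (-n)) * f z) 0) = 0" by (rule zero)
      also have "fun_fourier (\<lambda>z. (c * z powi (-n)) * f z) 0 = c * fun_fourier (\<lambda>z. z powi (-n) * f z) 0"
        by (simp only: mult.assoc fun_fourier_scale)
      also have "\<dots> = c * fun_fourier f n" using fun_fourier_shift[OF L2f, of "-n" 0] by simp
      finally show ?thesis .
    qed
    show ?thesis using *[of 1] *[of \<i>] by (simp add: complex_eq_iff)
  qed
qed

end

subsection \<open>Arcs\<close>

text \<open>\<open>Arg\<close> is continuous at 1 and inverts \<open>cis\<close> there: rotating a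
  point y near \<open>cis t\<close> back by t shows that t plus a small argument is an angle of
  y.\<close>

lemma openin_cis_image:
  assumes "open T"
  shows "openin (top_of_set unit_circle) (cis ` T)"
  unfolding openin_euclidean_subtopology_iff
proof (intro conjI ballI)
  show "cis ` T \<subseteq> unit_circle" by auto
  fix x assume "x \<in> cis ` T"
  then obtain t where t: "t \<in> T" "x = cis t" by auto
  obtain r where r: "r > 0" "\<And>s. dist s t < r \<Longrightarrow> s \<in> T" using assms t unfolding open_dist by blast
  have "isCont Arg 1" by (rule continuous_at_Arg) auto
  then obtain d where d: "d > 0" "\<And>z. dist z 1 < d \<Longrightarrow> dist (Arg z) (Arg 1) < r"
    unfolding continuous_at_eps_delta using r(1) by blast
  show "\<exists>e>0. \<forall>x'\<in>unit_circle. dist x' x < e \<longrightarrow> x' \<in> cis ` T"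
  proof (intro exI conjI ballI impI)
    fix y assume y: "y \<in> unit_circle" "dist y x < d"
    define z where "z = y * cis (- t)"
    have "z - 1 = (y - x) * cis (- t)" by (simp add: z_def t left_diff_distrib cis_mult)
    then have "dist z 1 < d" using y by (simp add: dist_norm norm_mult)
    then have "\<bar>Arg z\<bar> < r" using d(2)[of z] by (simp add: dist_real_def)
    then have "t + Arg z \<in> T" by (intro r(2)) (simp add: dist_real_def)
    moreover have "cis (t + Arg z) = y"
    proof -
      have "cmod z = 1" using y by (simp add: z_def norm_mult)
      then have "z \<noteq> 0" "sgn z = z" by (auto simp: sgn_eq)
      then have "cis (t + Arg z) = cis t * z" using cis_Arg[of z] by (simp flip: cis_mult)
      also have "\<dots> = y * (cis t * cis (- t))" by (simp add: z_def)
      finally show ?thesis by (simp add: cis_mult)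
    qed
    ultimately show "y \<in> cis ` T" by (metis imageI)
  qed (rule d)
qed

text \<open>A point strictly between two points of S is interior, so at most two points
  remain.\<close>

lemma finite_interval_diff_interior:
  fixes S :: "real set"
  assumes "is_interval S"
  shows "finite (S - interior S)"
proof (cases "\<exists>a b. a \<in> S - interior S \<and> b \<in> S - interior S \<and> a < b")
  case True
  then obtain a b where ab: "a \<in> S - interior S" "b \<in> S - interior S" "a < b" by blast
  have inside: "y \<in> interior S" if "x \<in> S" "z \<in> S" "x < y" "y < z" for x y z
  proof (rule interiorI[of "{x<..<z}"])
    show "{x<..<z} \<subseteq> S"
    proof
      fix w assume "w \<in> {x<..<z}"
      then have "x \<le> w" "w \<le> z" by auto
      then show "w \<in> S" using assms that(1,2) unfolding is_interval_1 by blast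
    qed
  qed (use that(3,4) in auto)
  have "c = a \<or> c = b" if "c \<in> S - interior S" for c
    using inside[of c b a] inside[of a b c] inside[of c a b] inside[of a c b] that ab
    by (metis DiffD1 DiffD2 linorder_neqE_linordered_idom)
  then have "S - interior S \<subseteq> {a, b}" by blast
  then show ?thesis by (rule finite_subset) simp
next
  case False
  show ?thesis
  proof (cases "S - interior S = {}")
    case True
    then show ?thesis by (simp only: finite.emptyI)
  next
    case ne: False
    then obtain a where a: "a \<in> S - interior S" by blast
    have "S - interior S \<subseteq> {a}"
    proof
      fix b assume "b \<in> S - interior S"
      then have "\<not> a < b" "\<not> b < a" using False a by blast+
      then show "b \<in> {a}" by simp
    qed
    then show ?thesis by (rule finite_subset) simp
  qed
qed

theorem theorem2p5:
  fixes W :: "real \<Rightarrow> real" and \<omega> \<Omega> :: "nat \<Rightarrow> real" and E :: "complex set"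
  assumes "is_weight W" and "cond_C1 W" and "cond_C2 W" and "cond_C3 W"
    and "\<And>n. \<omega> n = moment W n"
    and "\<And>n. \<Omega> n = 1 / \<omega> n"
    and "compact E" and "E \<subseteq> unit_circle" and "emeasure circle_measure E > 0"
  shows "((\<not> (\<exists>f. in_ell2 \<Omega> f \<and> supports E f \<and> \<not> (AE z in circle_measure. f z = 0)))
            \<longleftrightarrow> (\<forall>I. is_arc I \<longrightarrow> Cap \<omega> (I - E) = Cap \<omega> I))
       \<and> ((\<forall>I. is_arc I \<longrightarrow> Cap \<omega> (I - E) = Cap \<omega> I)
            \<longleftrightarrow> Cap \<omega> (unit_circle - E) = Cap \<omega> unit_circle)"
proof -
  have \<omega>: "\<omega> = moment W" using assms(5) by auto
  obtain q where q: "1 \<le> q" "q < 4" "\<And>n. moment W n \<le> q * moment W (2 * n)"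
    by (rule moment_doubling[OF assms(1,2,4)]) blast
  interpret dual_weights \<omega> \<Omega> q
    by unfold_locales
       (use q assms(6) moment_pos[OF assms(1,3)] moment_antimono[OF assms(1)] in \<open>auto simp: \<omega>\<close>)
  define unique where "unique \<longleftrightarrow> (\<forall>f. in_ell2 \<Omega> f \<longrightarrow> supports E f \<longrightarrow> (AE z in \<mu>. f z = 0))"
  have 1: "Cap \<omega> (I - E) = Cap \<omega> I" if unique and I: "is_arc I" for I
  proof (rule antisym)
    obtain S where S: "is_interval S" "I = cis ` S" using I by (auto simp: is_arc_def)
    \<comment> \<open>Passing to the interior of the parametrising interval loses at most two points
      of the arc, as \<open>Cap_le_Cap_open\<close> requires.\<close>
    define U where "U = cis ` interior S"
    have U: "openin (top_of_set unit_circle) U" unfolding U_def by (rule openin_cis_image) simp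
    have "I - U \<subseteq> cis ` (S - interior S)" by (auto simp: S U_def)
    then have fin: "finite (I - U)"
      using finite_interval_diff_interior[OF S(1)] by (meson finite_imageI finite_subset)
    have "I \<subseteq> unit_circle" by (auto simp: S)
    then have "Cap \<omega> I \<le> Cap \<omega> U" unfolding \<omega> by (rule Cap_le_Cap_open[OF assms(1,3) U _ fin])
    also have "\<dots> \<le> Cap \<omega> (U - E)"
      by (rule Cap_open_diff[OF _ assms(7) U]) (use \<open>unique\<close> in \<open>auto simp: unique_def\<close>)
    also have "\<dots> \<le> Cap \<omega> (I - E)"
      by (rule Cap_mono) (use interior_subset[of S] in \<open>auto simp: U_def S\<close>)
    finally show "Cap \<omega> I \<le> Cap \<omega> (I - E)" .
  qed (rule Cap_mono, blast)
  \<comment> \<open>The circle is the arc parametrised by the whole line, so (iii) is a case of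
    (ii).\<close>
  have "is_arc unit_circle"
  proof -
    have "z \<in> range cis" if "cmod z = 1" for z
    proof -
      have "z \<noteq> 0" using that by auto
      then have "z = cis (Arg z)" using that by (simp add: cis_Arg sgn_eq)
      then show ?thesis by (rule range_eqI)
    qed
    then have "unit_circle = cis ` UNIV" by auto
    then show ?thesis unfolding is_arc_def by (intro exI[of _ UNIV]) auto
  qed
  moreover have "unique" if eq: "Cap \<omega> (unit_circle - E) = Cap \<omega> unit_circle"
  proof -
    \<comment> \<open>Lebesgue measure has only the coefficient at 0, so it gives the lower bound 1
      / \<omega> 0 for the capacity of the circle.\<close>
    have "\<mu> \<in> probs_on unit_circle"
      by (simp add: probs_on_def prob_space_circle_measure)
    then have "1 / energy \<omega> \<mu> \<le> Cap \<omega> unit_circle" by (intro Cap_ge) auto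
    moreover have "energy \<omega> \<mu> = ennreal (\<omega> 0)"
    proof -
      have "measure_fourier \<mu> n = (if n = 0 then 1 else 0)" for n
        using circle_measure_integral_power[of "-n"] by (simp add: measure_fourier_def)
      then have "energy \<omega> \<mu> = (\<integral>\<^sup>+n. ennreal (\<omega> 0) * indicator {0} n \<partial>count_space (UNIV :: int set))"
        unfolding energy_eq by (intro nn_integral_cong) (auto split: split_indicator)
      then show ?thesis by (simp add: nn_integral_cmult)
    qed
    ultimately show ?thesis
      unfolding unique_def using capacity_imp_unique[OF _ assms(7)] eq by simp
  qed
  moreover have "unique \<longleftrightarrow> \<not> (\<exists>f. in_ell2 \<Omega> f \<and> supports E f \<and> \<not> (AE z in \<mu>. f z = 0))"
    by (auto simp: unique_def)
  ultimately show ?thesis using 1 by blast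
qed

end
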